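(* Let $n\ge1$ and let $\lambda$ be a partition with at most $n$ parts. Then $$K_{\lambda,0}^{C_n}(t)=\sum_{b\in\overline D_{2n}^{*}(\lambda)}t^{\mathrm{ch}_{C_n}(b)},\qquad\text{where}\qquad \mathrm{ch}_{C_n}(b)=\sum_{i=1}^{2n-1}(2n-i)\left\lceil\frac{\varepsilon_i(b)}{2}\right\rceil.$$
   Context: Generalized exponent: for $\mathfrak{sp}_{2n}$ (type $C_n$) with positive roots $R_+$, Weyl group $W$, length $\ell$, half-sum $\rho$ of positive roots, let $\prod_{\alpha\in R_+}\frac1{1-te^\alpha}=\sum_\beta P_t(\beta)e^\beta$, and $K^{C_n}_{\lambda,0}(t)=\sum_{w\in W}(-1)^{\ell(w)}P_t(w(\lambda+\rho)-\rho)$, where $\lambda=\sum_i\lambda_i\varepsilon_i$ is viewed as a dominant weight. $B_{2n}(\lambda)$ is the type $A_{2n-1}$ crystal of semistandard tableaux of shape $\lambda$ (English convention) with entries in $\{1,\dots,2n\}$. For $b\in B_{2n}(\lambda)$ and $1\le i\le 2n-1$: read $b$ by columns from right to left, each from top to bottom; keep only letters $i$ (written $+$) and $i+1$ (written $-$); recursively delete adjacent factors $+-$; the result is $-^p+^q$, and $\varepsilon_i(b)=p$, $\varphi_i(b)=q$. $\overline D_{2n}^{*}(\lambda)$ is the set of $b\in B_{2n}(\lambda)$ such that: (C1) $\varphi_i(b)=0$ for every odd $i$; (C2) $\varepsilon_i(b)$ is even for every odd $i$; (C3) the entries in row $i$ of $b$ are at least $2i-1$, for $i=1,\dots,n$.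 *)

theory Defs
  imports Complex_Main "HOL-Library.FuncSet" "HOL-Computational_Algebra.Polynomial"
begin

section \<open>The root system of type C\<close>

text \<open>Weights are vectors with coordinates in the basis \<open>\<epsilon>\<^sub>1, \<dots>, \<epsilon>\<^sub>n\<close>, encoded as functions
  \<open>nat \<Rightarrow> real\<close>; only the coordinates \<open>1, \<dots>, n\<close> are relevant, and the vectors below vanish
  at all other indices.\<close>

type_synonym vec = "nat \<Rightarrow> real"

definition eps_vec :: "nat \<Rightarrow> vec" where
  "eps_vec i = (\<lambda>k. if k = i then 1 else 0)"

definition pos_roots :: "nat \<Rightarrow> vec set" where
  "pos_roots n =
     {(\<lambda>k. eps_vec i k - eps_vec j k) | i j. 1 \<le> i \<and> i < j \<and> j \<le> n}
   \<union> {(\<lambda>k. eps_vec i k + eps_vec j k) | i j. 1 \<le> i \<and> i < j \<and> j \<le> n}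
   \<union> {(\<lambda>k. 2 * eps_vec i k) | i. 1 \<le> i \<and> i \<le> n}"

definition simple_root :: "nat \<Rightarrow> nat \<Rightarrow> vec" where
  "simple_root n i =
     (if i = n then (\<lambda>k. 2 * eps_vec n k) else (\<lambda>k. eps_vec i k - eps_vec (Suc i) k))"

definition rho :: "nat \<Rightarrow> vec" where
  "rho n = (\<lambda>k. (\<Sum>\<alpha>\<in>pos_roots n. \<alpha> k) / 2)"

definition dot :: "nat \<Rightarrow> vec \<Rightarrow> vec \<Rightarrow> real" where
  "dot n v w = (\<Sum>k=1..n. v k * w k)"

definition reflection :: "nat \<Rightarrow> vec \<Rightarrow> vec \<Rightarrow> vec" where
  "reflection n \<alpha> v = (\<lambda>k. v k - 2 * dot n v \<alpha> / dot n \<alpha> \<alpha> * \<alpha> k)"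

text \<open>The Weyl group as a group of transformations, generated by the simple reflections
  (which are involutions, so that words in the generators suffice).\<close>

definition word_action :: "nat \<Rightarrow> nat list \<Rightarrow> vec \<Rightarrow> vec" where
  "word_action n js = foldr (\<lambda>j f. reflection n (simple_root n j) \<circ> f) js id"

definition weyl_group :: "nat \<Rightarrow> (vec \<Rightarrow> vec) set" where
  "weyl_group n = word_action n ` lists {1..n}"

definition weyl_length :: "nat \<Rightarrow> (vec \<Rightarrow> vec) \<Rightarrow> nat" where
  "weyl_length n w = (LEAST l. \<exists>js\<in>lists {1..n}. length js = l \<and> word_action n js = w)"


section \<open>The generalized exponents\<close>

text \<open>Coefficient of \<open>e\<^sup>\<beta>\<close> in \<open>\<Prod>\<alpha>\<in>S. 1 / (1 - t e\<^sup>\<alpha>)\<close>: expanding every factor as the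
  geometric series \<open>\<Sum>m. t\<^sup>m e\<^bsup>m \<alpha>\<^esup>\<close>, one sums over the ways of choosing an exponent \<open>m \<alpha>\<close>
  for each factor. See \<open>partition_series_empty\<close> and \<open>partition_series_insert\<close> below.\<close>

definition partition_functions :: "vec set \<Rightarrow> vec \<Rightarrow> (vec \<Rightarrow> nat) set" where
  "partition_functions S \<beta> =
     {m. (\<forall>\<alpha>. \<alpha> \<notin> S \<longrightarrow> m \<alpha> = 0) \<and> (\<forall>k. (\<Sum>\<alpha>\<in>S. real (m \<alpha>) * \<alpha> k) = \<beta> k)}"

definition partition_series :: "vec set \<Rightarrow> vec \<Rightarrow> int poly" where
  "partition_series S \<beta> = (\<Sum>m\<in>partition_functions S \<beta>. monom 1 (\<Sum>\<alpha>\<in>S. m \<alpha>))"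

definition kostant_partition :: "nat \<Rightarrow> vec \<Rightarrow> int poly" where
  "kostant_partition n \<beta> = partition_series (pos_roots n) \<beta>"

definition gen_exponent_C :: "nat \<Rightarrow> vec \<Rightarrow> int poly" where
  "gen_exponent_C n \<Lambda> =
     (\<Sum>w\<in>weyl_group n. (-1) ^ weyl_length n w *
        kostant_partition n (\<lambda>k. w (\<lambda>j. \<Lambda> j + rho n j) k - rho n k))"


section \<open>Partitions, tableaux and crystals\<close>

definition is_partition :: "nat list \<Rightarrow> bool" where
  "is_partition lam \<longleftrightarrow> sorted_wrt (\<ge>) lam \<and> 0 \<notin> set lam"

definition weight_of :: "nat list \<Rightarrow> vec" where
  "weight_of lam = (\<lambda>k. if 1 \<le> k \<and> k \<le> length lam then real (lam ! (k - 1)) else 0)"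

text \<open>A tableau is the list of its rows, from top to bottom.\<close>

type_synonym tableau = "nat list list"

definition ssyt :: "nat \<Rightarrow> nat list \<Rightarrow> tableau set" where
  "ssyt N lam =
     {b. map length b = lam \<and>
         (\<forall>row\<in>set b. sorted row \<and> set row \<subseteq> {1..N}) \<and>
         (\<forall>r c. Suc r < length b \<and> c < length (b ! Suc r) \<longrightarrow> b ! r ! c < b ! Suc r ! c)}"

text \<open>\<open>transpose\<close> turns the list of rows into the list of columns, from left to right.\<close>

definition reading_word :: "tableau \<Rightarrow> nat list" where
  "reading_word b = concat (rev (transpose b))"

datatype sign = Plus | Minus

definition signature :: "nat \<Rightarrow> nat list \<Rightarrow> sign list" where
  "signature i w = map (\<lambda>x. if x = i then Plus else Minus) (filter (\<lambda>x. x = i \<or> x = Suc i) w)"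

text \<open>Recursive deletion of factors \<open>+-\<close>; by \<open>cancel_factor\<close> and \<open>cancel_normal_form\<close> below,
  the result does not depend on the order of deletions.\<close>

fun cancel :: "sign list \<Rightarrow> sign list" where
  "cancel [] = []"
| "cancel (x # xs) =
     (case (x, cancel xs) of (Plus, Minus # ys) \<Rightarrow> ys | (_, ys) \<Rightarrow> x # ys)"

definition crystal_eps :: "nat \<Rightarrow> tableau \<Rightarrow> nat" where
  "crystal_eps i b = count_list (cancel (signature i (reading_word b))) Minus"

definition crystal_phi :: "nat \<Rightarrow> tableau \<Rightarrow> nat" where
  "crystal_phi i b = count_list (cancel (signature i (reading_word b))) Plus"

text \<open>The list of rows is indexed from 0, so that row \<open>i\<close> is \<open>b ! (i - 1)\<close>.\<close>

definition Dbar_star :: "nat \<Rightarrow> nat list \<Rightarrow> tableau set" where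
  "Dbar_star n lam =
     {b \<in> ssyt (2 * n) lam.
        (\<forall>i\<in>{1..2 * n - 1}. odd i \<longrightarrow> crystal_phi i b = 0) \<and>
        (\<forall>i\<in>{1..2 * n - 1}. odd i \<longrightarrow> even (crystal_eps i b)) \<and>
        (\<forall>i\<in>{1..n}. i \<le> length b \<longrightarrow> (\<forall>x\<in>set (b ! (i - 1)). 2 * i - 1 \<le> x))}"

definition ch_C :: "nat \<Rightarrow> tableau \<Rightarrow> nat" where
  "ch_C n b = (\<Sum>i=1..2 * n - 1. (2 * n - i) * nat \<lceil>real (crystal_eps i b) / 2\<rceil>)"


section \<open>Basic properties of the definitions\<close>

lemma cancel_factor: "cancel (xs @ [Plus, Minus] @ ys) = cancel (xs @ ys)"
  by (induction xs) (auto split: sign.splits list.splits)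

lemma cancel_normal_form: "\<exists>p q. cancel xs = replicate p Minus @ replicate q Plus"
proof (induction xs)
  case Nil
  show ?case by simp
next
  case (Cons x xs)
  then obtain p q where pq: "cancel xs = replicate p Minus @ replicate q Plus" by blast
  show ?case
  proof (cases x)
    case Minus
    then have "cancel (x # xs) = replicate (Suc p) Minus @ replicate q Plus"
      using pq by simp
    then show ?thesis by blast
  next
    case Plus
    show ?thesis
    proof (cases p)
      case 0
      then have "cancel (x # xs) = replicate 0 Minus @ replicate (Suc q) Plus"
        using pq Plus by (cases q) auto
      then show ?thesis by blast
    next
      case (Suc p')
      then have "cancel (x # xs) = replicate p' Minus @ replicate q Plus"
        using pq Plus by simp
      then show ?thesis by blast
    qed
  qed
qed

lemma finite_ssyt: "finite (ssyt N lam)"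
proof -
  let ?R = "{row. set row \<subseteq> {1..N} \<and> length row \<le> sum_list lam}"
  have "ssyt N lam \<subseteq> {b. set b \<subseteq> ?R \<and> length b \<le> length lam}"
    by (auto simp: ssyt_def intro!: member_le_sum_list)
  moreover have "finite {b. set b \<subseteq> ?R \<and> length b \<le> length lam}"
    by (intro finite_lists_length_le) auto
  ultimately show ?thesis by (rule finite_subset)
qed

lemma finite_Dbar_star: "finite (Dbar_star n lam)"
  unfolding Dbar_star_def using finite_ssyt by simp

lemma finite_pos_roots: "finite (pos_roots n)"
proof -
  let ?I = "{1..n} \<times> {1..n}"
  have "pos_roots n \<subseteq> (\<lambda>(i, j) k. eps_vec i k - eps_vec j k) ` ?I
     \<union> (\<lambda>(i, j) k. eps_vec i k + eps_vec j k) ` ?I \<union> (\<lambda>i k. 2 * eps_vec i k) ` {1..n}"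
    unfolding pos_roots_def by (fastforce simp: image_iff)
  then show ?thesis by (rule finite_subset) auto
qed

lemma reflection_simple_root:
  assumes "j \<in> {1..n}"
  shows "reflection n (simple_root n j) v =
    (if j = n then v(n := - v n) else v(j := v (Suc j), Suc j := v j))"
proof (cases "j = n")
  case True
  have "dot n u (simple_root n n) = 2 * u n" for u
  proof -
    have "dot n u (simple_root n n) = (\<Sum>k=1..n. if k = n then 2 * u n else 0)"
      unfolding dot_def simple_root_def eps_vec_def by (rule sum.cong) auto
    then show ?thesis using assms True by simp
  qed
  then show ?thesis using True
    by (auto simp: reflection_def simple_root_def eps_vec_def fun_eq_iff)
next
  case False
  then have j: "Suc j \<in> {1..n}" using assms by auto
  have d: "dot n u (simple_root n j) = u j - u (Suc j)" for u
  proof -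
    have "dot n u (simple_root n j) =
      (\<Sum>k=1..n. (if k = j then u j else 0) - (if k = Suc j then u (Suc j) else 0))"
      unfolding dot_def simple_root_def eps_vec_def using False by (intro sum.cong) auto
    then show ?thesis using assms j by (simp add: sum_subtractf)
  qed
  then show ?thesis using False
    by (auto simp: reflection_def d fun_eq_iff)
      (auto simp: simple_root_def eps_vec_def field_simps)
qed

lemma finite_weyl_group: "finite (weyl_group n)"
proof -
  let ?P = "{1..n} \<rightarrow>\<^sub>E {1..n}"
  let ?C = "{1..n} \<rightarrow>\<^sub>E {-1, 1::real}"
  let ?F = "\<lambda>(p, c) (v::vec) k. if k \<in> {1..n} then c k * v (p k) else v k"
  have "word_action n js \<in> ?F ` (?P \<times> ?C)" if "js \<in> lists {1..n}" for js
    using that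
  proof (induction js)
    case Nil
    have "word_action n [] = ?F (restrict id {1..n}, restrict (\<lambda>_. 1) {1..n})"
      by (auto simp: word_action_def fun_eq_iff)
    then show ?case by (rule image_eqI) auto
  next
    case (Cons j js)
    then obtain p c where pc: "p \<in> ?P" "c \<in> ?C" and eq: "word_action n js = ?F (p, c)"
      by auto
    have j: "j \<in> {1..n}" using Cons by simp
    have step: "word_action n (j # js) v = reflection n (simple_root n j) (?F (p, c) v)" for v
      using eq by (simp add: word_action_def)
    show ?case
    proof (cases "j = n")
      case True
      have "word_action n (j # js) = ?F (p, c(n := - c n))"
        by (intro ext, unfold step reflection_simple_root[OF j]) (use j True in auto)
      moreover have "c(n := - c n) \<in> ?C"
        using pc(2) j True by (fastforce simp: PiE_iff extensional_def)
      ultimately show ?thesis using pc(1) by (intro image_eqI[of _ _ "(p, c(n := - c n))"]) auto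
    next
      case False
      let ?p = "p(j := p (Suc j), Suc j := p j)" and ?c = "c(j := c (Suc j), Suc j := c j)"
      have "word_action n (j # js) = ?F (?p, ?c)"
        by (intro ext, unfold step reflection_simple_root[OF j]) (use j False in auto)
      moreover have "?c \<in> ?C" "?p \<in> ?P"
        using pc j False by (fastforce simp: PiE_iff extensional_def)+
      ultimately show ?thesis by (intro image_eqI[of _ _ "(?p, ?c)"]) auto
    qed
  qed
  then have "weyl_group n \<subseteq> ?F ` (?P \<times> ?C)" unfolding weyl_group_def by blast
  moreover have "finite (?F ` (?P \<times> ?C))" by (intro finite_imageI finite_cartesian_product finite_PiE) auto
  ultimately show ?thesis by (rule finite_subset)
qed

definition height :: "nat \<Rightarrow> vec \<Rightarrow> real" where
  "height n v = (\<Sum>k=1..n. (real n + 1 - real k) * v k)"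

lemma height_pos_root:
  assumes "\<alpha> \<in> pos_roots n"
  shows "height n \<alpha> \<ge> 1"
proof -
  have e: "height n (eps_vec i) = real n + 1 - real i" if "i \<in> {1..n}" for i
  proof -
    have "height n (eps_vec i) = (\<Sum>k=1..n. if k = i then real n + 1 - real i else 0)"
      unfolding height_def eps_vec_def by (rule sum.cong) auto
    then show ?thesis using that by simp
  qed
  have "height n (\<lambda>k. u k - v k) = height n u - height n v"
    "height n (\<lambda>k. u k + v k) = height n u + height n v"
    "height n (\<lambda>k. 2 * u k) = 2 * height n u" for u v
    by (simp_all add: height_def algebra_simps sum.distrib sum_subtractf sum_distrib_left)
  then show ?thesis using assms by (auto simp: pos_roots_def e)
qed

lemma finite_partition_functions:
  assumes "S \<subseteq> pos_roots n"
  shows "finite (partition_functions S \<beta>)"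
proof -
  have fin: "finite S" by (rule finite_subset[OF assms finite_pos_roots])
  let ?B = "{..nat \<lceil>height n \<beta>\<rceil>}"
  have "m \<alpha> \<in> ?B" if m: "m \<in> partition_functions S \<beta>" and a: "\<alpha> \<in> S" for m \<alpha>
  proof -
    have "\<beta> = (\<lambda>k. \<Sum>\<alpha>\<in>S. real (m \<alpha>) * \<alpha> k)"
      using m by (auto simp: partition_functions_def)
    then have "height n \<beta> = (\<Sum>k=1..n. \<Sum>\<alpha>\<in>S. (real n + 1 - real k) * (real (m \<alpha>) * \<alpha> k))"
      by (simp add: height_def sum_distrib_left)
    also have "\<dots> = (\<Sum>\<alpha>\<in>S. real (m \<alpha>) * height n \<alpha>)"
      by (subst sum.swap) (simp add: height_def sum_distrib_left mult_ac)
    finally have h: "height n \<beta> = (\<Sum>\<alpha>\<in>S. real (m \<alpha>) * height n \<alpha>)" .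
    have ge: "height n \<gamma> \<ge> 1" if "\<gamma> \<in> S" for \<gamma> using that assms height_pos_root by blast
    have "real (m \<alpha>) * 1 \<le> real (m \<alpha>) * height n \<alpha>"
      using ge[OF a] by (intro mult_left_mono) auto
    also have "\<dots> \<le> height n \<beta>"
      unfolding h by (rule member_le_sum[OF a _ fin]) (use ge in \<open>force intro!: mult_nonneg_nonneg\<close>)
    finally show ?thesis by simp linarith
  qed
  then have "partition_functions S \<beta> \<subseteq>
      {m. \<forall>\<alpha>. (\<alpha> \<in> S \<longrightarrow> m \<alpha> \<in> ?B) \<and> (\<alpha> \<notin> S \<longrightarrow> m \<alpha> = 0)}"
    by (auto simp: partition_functions_def)
  then show ?thesis
    by (rule finite_subset) (intro finite_set_of_finite_funs fin finite_atMost)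
qed

text \<open>The empty product is \<open>e\<^sup>0\<close>, and enlarging the index set by \<open>\<alpha>\<close> divides the product
  by \<open>1 - t e\<^sup>\<alpha>\<close>.\<close>

lemma partition_series_empty: "partition_series {} \<beta> = (if \<beta> = (\<lambda>_. 0) then 1 else 0)"
proof -
  have "partition_functions {} \<beta> = (if \<beta> = (\<lambda>_. 0) then {\<lambda>_. 0} else {})"
    by (auto simp: partition_functions_def fun_eq_iff)
  then show ?thesis by (simp add: partition_series_def monom_0)
qed

lemma partition_series_insert:
  assumes "insert \<alpha> S \<subseteq> pos_roots n" "\<alpha> \<notin> S"
  shows "partition_series (insert \<alpha> S) \<beta>
    - monom 1 1 * partition_series (insert \<alpha> S) (\<lambda>k. \<beta> k - \<alpha> k) = partition_series S \<beta>"
proof -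
  let ?S = "insert \<alpha> S" and ?\<gamma> = "\<lambda>k. \<beta> k - \<alpha> k"
  let ?M = "partition_functions ?S \<beta>"
  let ?t = "\<lambda>m. monom (1::int) (\<Sum>\<alpha>\<in>?S. m \<alpha>)"
  let ?u = "\<lambda>m. m(\<alpha> := Suc (m \<alpha>))"
  have fin: "finite S" using finite_subset[OF assms(1) finite_pos_roots] by simp
  have updr: "(\<Sum>\<gamma>\<in>S. real ((m(\<alpha> := x)) \<gamma>) * \<gamma> k) = (\<Sum>\<gamma>\<in>S. real (m \<gamma>) * \<gamma> k)" for m x k
    by (rule sum.cong) (use assms(2) in auto)
  have updn: "(\<Sum>\<gamma>\<in>S. (m(\<alpha> := x)) \<gamma>) = (\<Sum>\<gamma>\<in>S. m \<gamma>)" for m and x :: nat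
    by (rule sum.cong) (use assms(2) in auto)
  have mem: "m \<in> partition_functions ?S \<delta> \<longleftrightarrow> (\<forall>\<gamma>. \<gamma> \<notin> ?S \<longrightarrow> m \<gamma> = 0) \<and>
      (\<forall>k. real (m \<alpha>) * \<alpha> k + (\<Sum>\<gamma>\<in>S. real (m \<gamma>) * \<gamma> k) = \<delta> k)" for m \<delta>
    unfolding partition_functions_def using fin assms(2) by simp
  have shift: "?u m \<in> ?M \<longleftrightarrow> m \<in> partition_functions ?S ?\<gamma>" for m
  proof -
    have "real (Suc (m \<alpha>)) * \<alpha> k + c = \<beta> k \<longleftrightarrow> real (m \<alpha>) * \<alpha> k + c = \<beta> k - \<alpha> k" for c k
      by (simp add: algebra_simps)
    moreover have "(\<forall>\<gamma>. \<gamma> \<notin> ?S \<longrightarrow> ?u m \<gamma> = 0) \<longleftrightarrow> (\<forall>\<gamma>. \<gamma> \<notin> ?S \<longrightarrow> m \<gamma> = 0)"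
      by auto
    ultimately show ?thesis unfolding mem updr fun_upd_same by simp
  qed
  have zero: "{m \<in> ?M. m \<alpha> = 0} = partition_functions S \<beta>"
  proof (intro set_eqI)
    fix m
    have "m \<in> partition_functions S \<beta> \<longleftrightarrow> (\<forall>\<gamma>. \<gamma> \<notin> S \<longrightarrow> m \<gamma> = 0) \<and>
        (\<forall>k. (\<Sum>\<gamma>\<in>S. real (m \<gamma>) * \<gamma> k) = \<beta> k)"
      by (simp add: partition_functions_def)
    moreover have "(\<forall>\<gamma>. \<gamma> \<notin> S \<longrightarrow> m \<gamma> = 0) \<longleftrightarrow> (\<forall>\<gamma>. \<gamma> \<notin> ?S \<longrightarrow> m \<gamma> = 0) \<and> m \<alpha> = 0"
      by (metis assms(2) insert_iff)
    ultimately show "m \<in> {m \<in> ?M. m \<alpha> = 0} \<longleftrightarrow> m \<in> partition_functions S \<beta>"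
      unfolding mem mem_Collect_eq by (cases "m \<alpha> = 0") simp_all
  qed
  have suc: "{m \<in> ?M. m \<alpha> \<noteq> 0} = ?u ` partition_functions ?S ?\<gamma>"
  proof (intro equalityI subsetI)
    fix m assume m: "m \<in> {m \<in> ?M. m \<alpha> \<noteq> 0}"
    let ?m = "m(\<alpha> := m \<alpha> - 1)"
    have eq: "?u ?m = m" using m by auto
    have "m \<in> ?M" using m by (simp only: mem_Collect_eq)
    then have "?u ?m \<in> ?M" by (simp only: eq)
    then have "?m \<in> partition_functions ?S ?\<gamma>" by (rule shift[THEN iffD1])
    with eq[symmetric] show "m \<in> ?u ` partition_functions ?S ?\<gamma>" by (rule image_eqI)
  next
    fix m assume "m \<in> ?u ` partition_functions ?S ?\<gamma>"
    then obtain m' where m': "m = ?u m'" "m' \<in> partition_functions ?S ?\<gamma>" by (rule imageE)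
    then have "m \<in> ?M" using shift[of m'] by (simp only:)
    moreover have "m \<alpha> \<noteq> 0" unfolding m'(1) by simp
    ultimately show "m \<in> {m \<in> ?M. m \<alpha> \<noteq> 0}" by (simp only: mem_Collect_eq simp_thms)
  qed
  have inj: "inj_on ?u (partition_functions ?S ?\<gamma>)"
  proof (rule inj_onI)
    fix m m' assume "?u m = ?u m'"
    then have eq: "?u m \<gamma> = ?u m' \<gamma>" for \<gamma> by (rule fun_cong)
    show "m = m'"
    proof
      fix \<gamma> show "m \<gamma> = m' \<gamma>" using eq[of \<gamma>] by (cases "\<gamma> = \<alpha>") auto
    qed
  qed
  have finM: "finite ?M" by (rule finite_partition_functions[OF assms(1)])
  have "partition_series ?S \<beta> = sum ?t {m \<in> ?M. m \<alpha> = 0} + sum ?t {m \<in> ?M. m \<alpha> \<noteq> 0}"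
  proof -
    have "?M = {m \<in> ?M. m \<alpha> = 0} \<union> {m \<in> ?M. m \<alpha> \<noteq> 0}" by blast
    then have "sum ?t ?M = sum ?t ({m \<in> ?M. m \<alpha> = 0} \<union> {m \<in> ?M. m \<alpha> \<noteq> 0})" by (rule arg_cong)
    also have "\<dots> = sum ?t {m \<in> ?M. m \<alpha> = 0} + sum ?t {m \<in> ?M. m \<alpha> \<noteq> 0}"
      by (rule sum.union_disjoint) (use finM in auto)
    finally show ?thesis unfolding partition_series_def .
  qed
  also have "sum ?t {m \<in> ?M. m \<alpha> = 0} = partition_series S \<beta>"
    unfolding zero partition_series_def
    by (rule sum.cong) (use fin assms(2) in \<open>auto simp: partition_functions_def\<close>)
  also have "sum ?t {m \<in> ?M. m \<alpha> \<noteq> 0} = monom 1 1 * partition_series ?S ?\<gamma>"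
  proof -
    have "?t (?u m) = monom 1 1 * ?t m" for m
    proof -
      have "(\<Sum>\<gamma>\<in>?S. ?u m \<gamma>) = 1 + (\<Sum>\<gamma>\<in>?S. m \<gamma>)"
        unfolding sum.insert[OF fin assms(2)] updn by simp
      then show ?thesis by (simp only: mult_monom mult_1)
    qed
    then show ?thesis
      unfolding suc sum.reindex[OF inj] partition_series_def sum_distrib_left comp_def by simp
  qed
  finally show ?thesis by simp
qed

end

theory Submission
  imports Defs "Jordan_Normal_Form.Determinant" "HOL-Library.Poly_Mapping" "HOL-Library.Function_Algebras"
    "HOL-Computational_Algebra.Formal_Power_Series"
begin

text \<open>Littlewood's identity states that
  \<open>\<Sum>\<mu>. t\<^bsup>|\<mu>|\<^esup> det (z\<^sub>j\<^bsup>2\<mu>\<^sub>i + i\<^esup>)\<close>, times the product of \<open>1 - t z\<^sub>a z\<^sub>b\<close> over \<open>a \<le> b\<close>, is the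
  Vandermonde determinant. Specialise the \<open>2n\<close> variables to the pairs \<open>x\<^sub>k\<^bsup>-1\<^esup>, x\<^sub>k\<close>. The product
  becomes \<open>(1 - t)\<^bsup>n\<^esup>\<close> times the product of \<open>1 - t e\<^bsup>\<alpha>\<^esup>\<close> over all roots, and splitting off one pair at
  a time expresses each alternant, up to the Vandermonde determinant in the \<open>x\<^sub>k + x\<^sub>k\<^bsup>-1\<^esup>\<close>, as a
  sum of Weyl alternants of type C over certain arrays of natural numbers. On the other side,
  multiplying the alternating sum of \<open>e\<^bsup>\<rho>\<^esup> \<Prod>\<alpha>>0. 1 / (1 - t e\<^bsup>\<alpha>\<^esup>)\<close> by the invariant product over all
  roots leaves a multiple of the Weyl denominator. Hence \<open>K\<^sub>\<lambda>\<^sub>,\<^sub>0\<close> is, up to a power series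
  independent of \<open>\<lambda>\<close>, the coefficient of \<open>e\<^bsup>\<lambda> + \<rho>\<^esup>\<close> in the sum over \<open>\<mu>\<close> and the arrays.

  A sign-reversing involution cancels all arrays except those satisfying a lattice condition, and
  these are the letter counts of the semistandard tableaux satisfying (C3). The inequalities
  between \<open>\<mu>\<close> and the array of \<open>b\<close> then say that \<open>\<epsilon>\<^sub>i(b) \<le> 2(\<mu>\<^sub>i - \<mu>\<^sub>i\<^sub>-\<^sub>1)\<close>, with equality and
  \<open>\<phi>\<^sub>i(b) = 0\<close> for odd \<open>i\<close>. Given \<open>b\<close>, the smallest solution has \<open>|\<mu>| = ch(b)\<close>, and the
  differences to it range over a set independent of \<open>b\<close> and \<open>\<lambda>\<close>. The remaining factor is determined
  by \<open>\<lambda> = \<emptyset>\<close>, where both sides equal 1.\<close>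

section \<open>Alternants\<close>

text \<open>The constants of the statement arise as follows. Splitting off one pair of inverse
  variables uses up the two smallest exponents, so the \<open>i\<close>-th pair, counted from 0,
  only touches columns from \<open>2 * i\<close> on; this is (C3). Each exponent has the parity of
  its index, so the gap \<open>e (Suc j) - e j - 1\<close> is twice a difference of consecutive
  parts of \<mu>. The interlacing inequalities between columns \<open>j\<close> and
  \<open>Suc j\<close>, taken over all rows, bound this gap below by one crystal statistic
  \<epsilon>, and halving a bound on an even number produces the ceiling. Raising the difference at
  index \<open>i\<close> raises the \<open>2 * n - i\<close> parts from there on, which is the
  weight in the charge. The Kostant partition function knows only the positive roots and is not
  invariant under the Weyl group. The product over all roots is invariant, so it passes through the
  alternating sum, and there it leaves only weights with all coordinates at most \<open>n\<close> in
  absolute value; their alternants are integer multiples of the Weyl denominator.\<close>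

type_synonym laurent = "(nat \<Rightarrow> real) \<Rightarrow>\<^sub>0 int"

definition mon :: "(nat \<Rightarrow> real) \<Rightarrow> laurent" where
  "mon v = Poly_Mapping.single v 1"

lemma mon_add: "mon (u + v) = mon u * mon v"
  by (simp add: mon_def mult_single)

lemma mon_zero [simp]: "mon 0 = 1"
  by (simp add: mon_def)

lemma lookup_mon: "Poly_Mapping.lookup (mon v) u = (if u = v then 1 else 0)"
  by (auto simp: mon_def lookup_single when_def)

text \<open>A variable is represented by the exponent vector \<open>z\<close> of a monomial, and
  \<open>pw z e\<close> is its power. Substituting inverse variables is then negation of vectors,
  and no ring homomorphism has to be set up.\<close>

definition pw :: "(nat \<Rightarrow> real) \<Rightarrow> int \<Rightarrow> laurent" where
  "pw z e = mon (\<lambda>k. of_int e * z k)"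

lemma pw_add: "pw z (a + b) = pw z a * pw z b"
  by (simp add: pw_def mon_add [symmetric] plus_fun_def algebra_simps)

lemma pw_zero [simp]: "pw z 0 = 1"
  by (simp add: pw_def zero_fun_def [symmetric])

lemma pw_uminus: "pw (- z) e = pw z (- e)"
  by (simp add: pw_def fun_Compl_def)

lemma pw_sum: "pw z (sum f A) = (\<Prod>i\<in>A. pw z (f i))"
  by (induction A rule: infinite_finite_induct) (auto simp: pw_add)

lemma pw_cancel [simp]: "pw z a * pw z (- a) = 1"
  by (simp add: pw_add [symmetric])

lemma pw_power: "pw z a ^ k = pw z (int k * a)"
  by (induction k) (auto simp: pw_add algebra_simps)

section \<open>Determinants of matrices given by a function\<close>

abbreviation skip :: "nat \<Rightarrow> nat \<Rightarrow> nat" where "skip \<equiv> insert_index"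

lemma det_mat_column:
  fixes f :: "nat \<times> nat \<Rightarrow> 'a :: comm_ring_1"
  assumes "j < Suc m"
  shows "det (mat (Suc m) (Suc m) f) =
    (\<Sum>i<Suc m. (-1) ^ (i + j) * f (i, j) * det (mat m m (\<lambda>(a, b). f (skip i a, skip j b))))"
proof -
  let ?A = "mat (Suc m) (Suc m) f"
  have "det ?A = (\<Sum>i<Suc m. ?A $$ (i, j) * cofactor ?A i j)"
    by (rule laplace_expansion_column) (use assms in auto)
  also have "\<dots> = (\<Sum>i<Suc m. (-1) ^ (i + j) * f (i, j) * det (mat m m (\<lambda>(a, b). f (skip i a, skip j b))))"
  proof (rule sum.cong)
    fix i assume "i \<in> {..<Suc m}"
    then have "mat_delete ?A i j = mat m m (\<lambda>(a, b). f (skip i a, skip j b))"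
      using assms by (intro eq_matI) (auto simp: mat_delete_def insert_index_def)
    then show "?A $$ (i, j) * cofactor ?A i j = (-1) ^ (i + j) * f (i, j) * det (mat m m (\<lambda>(a, b). f (skip i a, skip j b)))"
      using assms \<open>i \<in> _\<close> by (simp add: cofactor_def)
  qed simp
  finally show ?thesis .
qed

lemma det_mat_row:
  fixes f :: "nat \<times> nat \<Rightarrow> 'a :: comm_ring_1"
  assumes "i < Suc m"
  shows "det (mat (Suc m) (Suc m) f) =
    (\<Sum>j<Suc m. (-1) ^ (i + j) * f (i, j) * det (mat m m (\<lambda>(a, b). f (skip i a, skip j b))))"
proof -
  let ?A = "mat (Suc m) (Suc m) f"
  have "det ?A = (\<Sum>j<Suc m. ?A $$ (i, j) * cofactor ?A i j)"
    by (rule laplace_expansion_row) (use assms in auto)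
  also have "\<dots> = (\<Sum>j<Suc m. (-1) ^ (i + j) * f (i, j) * det (mat m m (\<lambda>(a, b). f (skip i a, skip j b))))"
  proof (rule sum.cong)
    fix j assume "j \<in> {..<Suc m}"
    then have "mat_delete ?A i j = mat m m (\<lambda>(a, b). f (skip i a, skip j b))"
      using assms by (intro eq_matI) (auto simp: mat_delete_def insert_index_def)
    then show "?A $$ (i, j) * cofactor ?A i j = (-1) ^ (i + j) * f (i, j) * det (mat m m (\<lambda>(a, b). f (skip i a, skip j b)))"
      using assms \<open>j \<in> _\<close> by (simp add: cofactor_def)
  qed simp
  finally show ?thesis .
qed

lemma det_mat_sum:
  fixes f :: "nat \<times> nat \<Rightarrow> 'a :: comm_ring_1"
  shows "det (mat m m f) = (\<Sum>p | p permutes {0..<m}. of_int (sign p) * (\<Prod>i<m. f (i, p i)))"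
proof -
  have "(\<Prod>i = 0..<m. mat m m f $$ (i, p i)) = (\<Prod>i<m. f (i, p i))" if "p permutes {0..<m}" for p
    unfolding atLeast0LessThan by (rule prod.cong) (use that permutes_in_image[OF that] in auto)
  then show ?thesis by (subst det_def'[of _ m]) auto
qed

lemma det_mat_cong:
  assumes "\<And>i j. i < m \<Longrightarrow> j < m \<Longrightarrow> f (i, j) = g (i, j)"
  shows "det (mat m m f) = det (mat m m g)"
  by (rule arg_cong[where f = det]) (rule eq_matI, use assms in auto)

lemma det_mat_scale_columns:
  fixes f :: "nat \<times> nat \<Rightarrow> 'a :: comm_ring_1"
  shows "det (mat m m (\<lambda>(i, j). c j * f (i, j))) = (\<Prod>j<m. c j) * det (mat m m f)"
proof -
  have "(\<Prod>i<m. c (p i)) = (\<Prod>j<m. c j)" if "p permutes {0..<m}" for p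
    using prod.permute[OF that, of c] by (simp add: atLeast0LessThan comp_def)
  then show ?thesis
    by (simp add: det_mat_sum prod.distrib sum_distrib_left algebra_simps)
qed

lemma det_mat_scale_rows:
  fixes f :: "nat \<times> nat \<Rightarrow> 'a :: comm_ring_1"
  shows "det (mat m m (\<lambda>(i, j). c i * f (i, j))) = (\<Prod>j<m. c j) * det (mat m m f)"
  by (simp add: det_mat_sum prod.distrib sum_distrib_left algebra_simps)

lemma det_mat_equal_rows:
  fixes f :: "nat \<times> nat \<Rightarrow> 'a :: comm_ring_1"
  assumes "i < m" "i' < m" "i \<noteq> i'" "\<And>j. j < m \<Longrightarrow> f (i, j) = f (i', j)"
  shows "det (mat m m f) = 0"
  by (rule det_identical_rows[of _ m i i']) (use assms in \<open>auto intro!: eq_vecI simp: row_def\<close>)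

text \<open>Multilinearity in the rows: \<open>g\<close> chooses one summand in each row.\<close>

lemma det_mat_rows_PiE:
  fixes f :: "nat \<Rightarrow> 'c \<Rightarrow> nat \<Rightarrow> 'a :: comm_ring_1"
  assumes "\<And>i. i < m \<Longrightarrow> finite (B i)"
  shows "det (mat m m (\<lambda>(i, j). \<Sum>c\<in>B i. f i c j)) =
    (\<Sum>g\<in>Pi\<^sub>E {..<m} B. det (mat m m (\<lambda>(i, j). f i (g i) j)))"
proof -
  have "(\<Prod>i<m. \<Sum>c\<in>B i. f i c (p i)) = (\<Sum>g\<in>Pi\<^sub>E {..<m} B. \<Prod>i<m. f i (g i) (p i))" for p
    by (rule prod_sum_PiE) (use assms in auto)
  then show ?thesis
    by (simp add: det_mat_sum sum_distrib_left sum.swap[of _ "Pi\<^sub>E _ _"])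
qed

section \<open>Alternants and their branching rule\<close>

definition alternant :: "nat \<Rightarrow> (nat \<Rightarrow> int) \<Rightarrow> (nat \<Rightarrow> nat \<Rightarrow> real) \<Rightarrow> laurent" where
  "alternant m e z = det (mat m m (\<lambda>(i, j). pw (z j) (e i)))"

lemma alternant_column:
  assumes "j < Suc m"
  shows "alternant (Suc m) e z =
    (\<Sum>i<Suc m. (-1) ^ (i + j) * pw (z j) (e i) * alternant m (e \<circ> skip i) (z \<circ> skip j))"
  unfolding alternant_def by (subst det_mat_column[OF assms]) simp

lemma alternant_row:
  assumes "i < Suc m"
  shows "alternant (Suc m) e z =
    (\<Sum>j<Suc m. (-1) ^ (i + j) * pw (z j) (e i) * alternant m (e \<circ> skip i) (z \<circ> skip j))"
  unfolding alternant_def by (subst det_mat_row[OF assms]) simp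

lemma alternant_equal:
  assumes "i < m" "i' < m" "i \<noteq> i'" "e i = e i'"
  shows "alternant m e z = 0"
  unfolding alternant_def by (rule det_mat_equal_rows[OF assms(1-3)]) (use assms in auto)

lemma sum_int_telescope:
  fixes f :: "int \<Rightarrow> 'a :: ab_group_add"
  assumes "a \<le> b"
  shows "(\<Sum>c\<in>{a<..b}. f c - f (c - 1)) = f b - f a"
  using assms
proof (induction b rule: int_ge_induct)
  case base then show ?case by simp
next
  case (step b)
  have "{a<..b + 1} = insert (b + 1) {a<..b}" using step by auto
  then show ?case using step by simp
qed

text \<open>Subtracting from each row a multiple of the preceding one clears the first column, and the
  differences in the other columns are telescoping sums.\<close>

lemma alternant_branching:
  assumes mono: "\<And>q. q < m \<Longrightarrow> e q < e (Suc q)"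
  shows "alternant (Suc m) e (case_nat x y) =
    pw x (e 0) * (\<Prod>j<m. 1 - pw x 1 * pw (y j) (- 1)) *
      (\<Sum>g\<in>(\<Pi>\<^sub>E q\<in>{..<m}. {e q<..e (Suc q)}).
         pw x (\<Sum>q<m. e (Suc q) - g q) * alternant m g y)"
proof -
  let ?z = "case_nat x y"
  define M where "M = mat (Suc m) (Suc m) (\<lambda>(i, j). pw (?z j) (e i))"
  define U where "U = mat (Suc m) (Suc m) (\<lambda>(i, j). if i = j then 1 else
     if i = Suc j then - pw x (e i - e j) else (0::laurent))"
  have U: "U \<in> carrier_mat (Suc m) (Suc m)" and M: "M \<in> carrier_mat (Suc m) (Suc m)"
    by (auto simp: U_def M_def)
  have "det U = prod_list (diag_mat U)"
    by (rule det_lower_triangular[OF _ U]) (auto simp: U_def)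
  also have "diag_mat U = replicate (Suc m) 1"
    by (rule nth_equalityI) (auto simp: diag_mat_def U_def simp del: upt_Suc replicate_Suc)
  finally have detU: "det U = 1" by simp
  have UM: "U * M = mat (Suc m) (Suc m) (\<lambda>(i, j). if i = 0 then pw (?z j) (e 0) else
      pw (?z j) (e i) - pw x (e i - e (i - 1)) * pw (?z j) (e (i - 1)))" (is "_ = mat _ _ ?F")
  proof (rule eq_matI)
    fix i j assume "i < dim_row (mat (Suc m) (Suc m) ?F)" "j < dim_col (mat (Suc m) (Suc m) ?F)"
    then have i: "i < Suc m" and j: "j < Suc m" by auto
    have "(U * M) $$ (i, j) = (\<Sum>k<Suc m. U $$ (i, k) * M $$ (k, j))"
      using i j U M by (simp add: scalar_prod_def atLeast0LessThan del: sum.lessThan_Suc)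
    also have "\<dots> = (\<Sum>k<Suc m. (if k = i then pw (?z j) (e i) else 0) +
        (if i = Suc k then - pw x (e i - e k) * pw (?z j) (e k) else 0))"
      by (rule sum.cong) (use i j in \<open>auto simp: U_def M_def\<close>)
    also have "\<dots> = ?F (i, j)"
      using i by (cases i) (auto simp: sum.distrib simp del: sum.lessThan_Suc)
    finally show "(U * M) $$ (i, j) = mat (Suc m) (Suc m) ?F $$ (i, j)" using i j by simp
  qed (auto simp: U_def M_def)
  have "alternant (Suc m) e ?z = det (U * M)"
    using det_mult[OF U M] detU by (simp add: alternant_def M_def)
  also have "\<dots> = (\<Sum>i<Suc m. (-1) ^ (i + 0) * ?F (i, 0) * det (mat m m (\<lambda>(a, b). ?F (skip i a, skip 0 b))))"
    unfolding UM by (subst det_mat_column[of 0]) (auto simp del: sum.lessThan_Suc simp add: if_distrib)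
  also have "\<dots> = (\<Sum>i<Suc m. if i = 0 then pw x (e 0) * det (mat m m (\<lambda>(a, b). ?F (skip 0 a, skip 0 b))) else 0)"
    by (rule sum.cong) (auto simp: pw_add [symmetric])
  also have "\<dots> = pw x (e 0) * det (mat m m (\<lambda>(a, b). ?F (skip 0 a, skip 0 b)))"
    by (simp del: sum.lessThan_Suc)
  also have "det (mat m m (\<lambda>(a, b). ?F (skip 0 a, skip 0 b))) =
     det (mat m m (\<lambda>(i, j). \<Sum>c\<in>{e i<..e (Suc i)}. (1 - pw x 1 * pw (y j) (- 1)) * (pw x (e (Suc i) - c) * pw (y j) c)))"
  proof (rule det_mat_cong)
    fix i j assume ij: "i < m" "j < m"
    let ?f = "\<lambda>c. pw x (e (Suc i) - c) * pw (y j) c"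
    \<comment> \<open>The factor \<open>1 - x / y\<close> turns every summand into a difference of
      neighbours. It depends on the column only, so it can be pulled out of the determinant
      afterwards.\<close>
    have "(1 - pw x 1 * pw (y j) (- 1)) * (pw x (e (Suc i) - c) * pw (y j) c) = ?f c - ?f (c - 1)" for c
    proof -
      have "pw x 1 * pw (y j) (- 1) * (pw x (e (Suc i) - c) * pw (y j) c) =
          (pw x 1 * pw x (e (Suc i) - c)) * (pw (y j) (- 1) * pw (y j) c)" by (simp only: ac_simps)
      also have "\<dots> = ?f (c - 1)" by (simp add: pw_add [symmetric] algebra_simps)
      finally show ?thesis by (simp add: algebra_simps)
    qed
    then have "(\<Sum>c\<in>{e i<..e (Suc i)}. (1 - pw x 1 * pw (y j) (- 1)) * (pw x (e (Suc i) - c) * pw (y j) c)) =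
        ?f (e (Suc i)) - ?f (e i)"
      using sum_int_telescope[of "e i" "e (Suc i)" ?f] mono[OF ij(1)] by simp
    then show "(case (i, j) of (a, b) \<Rightarrow> ?F (skip 0 a, skip 0 b)) =
       (case (i, j) of (i, j) \<Rightarrow> \<Sum>c\<in>{e i<..e (Suc i)}. (1 - pw x 1 * pw (y j) (- 1)) * (pw x (e (Suc i) - c) * pw (y j) c))"
      by simp
  qed
  also have "\<dots> = (\<Sum>g\<in>(\<Pi>\<^sub>E q\<in>{..<m}. {e q<..e (Suc q)}).
      det (mat m m (\<lambda>(i, j). (1 - pw x 1 * pw (y j) (- 1)) * (pw x (e (Suc i) - g i) * pw (y j) (g i)))))"
    by (rule det_mat_rows_PiE) simp
  also have "\<dots> = (\<Sum>g\<in>(\<Pi>\<^sub>E q\<in>{..<m}. {e q<..e (Suc q)}).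
      (\<Prod>j<m. 1 - pw x 1 * pw (y j) (- 1)) * (pw x (\<Sum>q<m. e (Suc q) - g q) * alternant m g y))"
  proof (rule sum.cong)
    fix g
    show "det (mat m m (\<lambda>(i, j). (1 - pw x 1 * pw (y j) (- 1)) * (pw x (e (Suc i) - g i) * pw (y j) (g i)))) =
      (\<Prod>j<m. 1 - pw x 1 * pw (y j) (- 1)) * (pw x (\<Sum>q<m. e (Suc q) - g q) * alternant m g y)"
      using det_mat_scale_columns[of m "\<lambda>j. 1 - pw x 1 * pw (y j) (- 1)" "\<lambda>(i, j). pw x (e (Suc i) - g i) * pw (y j) (g i)"]
        det_mat_scale_rows[of m "\<lambda>i. pw x (e (Suc i) - g i)" "\<lambda>(i, j). pw (y j) (g i)"]
      by (simp add: alternant_def pw_sum)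
  qed simp
  finally show ?thesis by (simp only: sum_distrib_left [symmetric] mult.assoc)
qed

section \<open>Alternants in pairs of inverse variables\<close>

text \<open>The inverse stands directly before its variable. Because the two are adjacent, whichever
  of them is removed first leaves the other one in the even column \<open>2 * k\<close>.\<close>

definition pairs :: "(nat \<Rightarrow> nat \<Rightarrow> real) \<Rightarrow> nat \<Rightarrow> nat \<Rightarrow> real" where
  "pairs v j = (if even j then - v (j div 2) else v (j div 2))"

lemma pairs_double [simp]: "pairs v (2 * k) = - v k" "pairs v (Suc (2 * k)) = v k"
  by (simp_all add: pairs_def)

lemma pairs_skip_even: "(pairs v \<circ> skip (2 * k)) \<circ> skip (2 * k) = pairs (v \<circ> skip k)"
proof
  fix b show "((pairs v \<circ> skip (2 * k)) \<circ> skip (2 * k)) b = pairs (v \<circ> skip k) b"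
    by (cases "b < 2 * k") (auto simp: pairs_def insert_index_def)
qed

lemma pairs_skip_odd: "(pairs v \<circ> skip (Suc (2 * k))) \<circ> skip (2 * k) = pairs (v \<circ> skip k)"
proof
  fix b show "((pairs v \<circ> skip (Suc (2 * k))) \<circ> skip (2 * k)) b = pairs (v \<circ> skip k) b"
    by (cases "b < 2 * k") (auto simp: pairs_def insert_index_def)
qed

lemma sum_lessThan_double:
  "(\<Sum>j<2 * N. f j) = (\<Sum>k<N. f (2 * k) + f (Suc (2 * k)))"
  for f :: "nat \<Rightarrow> 'a :: comm_monoid_add"
  by (induction N) (simp_all add: add.assoc)

lemma prod_lessThan_double:
  "(\<Prod>j<2 * N. f j) = (\<Prod>k<N. f (2 * k) * f (Suc (2 * k)))"
  for f :: "nat \<Rightarrow> 'a :: comm_monoid_mult"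
  by (induction N) (simp_all add: mult.assoc)

text \<open>On its way to the front the column passes an even number of others, so no sign appears;
  the Laplace expansions of both sides along the moved column coincide.\<close>

lemma alternant_even_column_to_front:
  assumes "2 * k < Suc m"
  shows "alternant (Suc m) e z = alternant (Suc m) e (case_nat (z (2 * k)) (z \<circ> skip (2 * k)))"
proof -
  let ?z = "case_nat (z (2 * k)) (z \<circ> skip (2 * k))"
  have "?z \<circ> skip 0 = z \<circ> skip (2 * k)" by (simp add: fun_eq_iff)
  then have "alternant (Suc m) e ?z = (\<Sum>i<Suc m. (-1) ^ (i + 0) * pw (z (2 * k)) (e i) * alternant m (e \<circ> skip i) (z \<circ> skip (2 * k)))"
    by (subst alternant_column[of 0]) (simp_all del: sum.lessThan_Suc)
  also have "\<dots> = alternant (Suc m) e z"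
    by (subst alternant_column[OF assms]) (simp add: power_add del: sum.lessThan_Suc)
  finally show ?thesis ..
qed

text \<open>Laplace expansion along the row of the smallest exponent. The two members of a pair sit
  in neighbouring columns, hence the opposite signs; the partner that remains is in column
  \<open>2 * k\<close> and moves to the front without a sign.\<close>

lemma alternant_pairs_expand:
  "alternant (2 * Suc n) e (pairs v) = (\<Sum>k<Suc n.
      pw (v k) (- e 0) * alternant (Suc (2 * n)) (e \<circ> Suc) (case_nat (v k) (pairs (v \<circ> skip k))) -
      pw (v k) (e 0) * alternant (Suc (2 * n)) (e \<circ> Suc) (case_nat (- v k) (pairs (v \<circ> skip k))))"
proof -
  have "alternant (2 * Suc n) e (pairs v) = (\<Sum>j<2 * Suc n. (-1) ^ (0 + j) * pw (pairs v j) (e 0) *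
      alternant (Suc (2 * n)) (e \<circ> skip 0) (pairs v \<circ> skip j))"
    using alternant_row[of 0 "Suc (2 * n)" e "pairs v"] by simp
  also have "\<dots> = (\<Sum>k<Suc n. pw (v k) (- e 0) * alternant (Suc (2 * n)) (e \<circ> Suc) (pairs v \<circ> skip (2 * k)) -
      pw (v k) (e 0) * alternant (Suc (2 * n)) (e \<circ> Suc) (pairs v \<circ> skip (Suc (2 * k))))"
  proof -
    have "e \<circ> skip 0 = e \<circ> Suc" by (simp add: fun_eq_iff)
    then show ?thesis by (subst sum_lessThan_double) (simp add: pw_uminus del: sum.lessThan_Suc)
  qed
  also have "\<dots> = (\<Sum>k<Suc n.
      pw (v k) (- e 0) * alternant (Suc (2 * n)) (e \<circ> Suc) (case_nat (v k) (pairs (v \<circ> skip k))) -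
      pw (v k) (e 0) * alternant (Suc (2 * n)) (e \<circ> Suc) (case_nat (- v k) (pairs (v \<circ> skip k))))"
  proof (rule sum.cong)
    fix k assume "k \<in> {..<Suc n}"
    then have k: "2 * k < Suc (2 * n)" by auto
    have "(pairs v \<circ> skip (2 * k)) (2 * k) = v k" "(pairs v \<circ> skip (Suc (2 * k))) (2 * k) = - v k"
      by (auto simp: insert_index_def)
    then show "pw (v k) (- e 0) * alternant (Suc (2 * n)) (e \<circ> Suc) (pairs v \<circ> skip (2 * k)) -
      pw (v k) (e 0) * alternant (Suc (2 * n)) (e \<circ> Suc) (pairs v \<circ> skip (Suc (2 * k))) =
      pw (v k) (- e 0) * alternant (Suc (2 * n)) (e \<circ> Suc) (case_nat (v k) (pairs (v \<circ> skip k))) -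
      pw (v k) (e 0) * alternant (Suc (2 * n)) (e \<circ> Suc) (case_nat (- v k) (pairs (v \<circ> skip k)))"
      using alternant_even_column_to_front[OF k, of "e \<circ> Suc" "pairs v \<circ> skip (2 * k)"]
        alternant_even_column_to_front[OF k, of "e \<circ> Suc" "pairs v \<circ> skip (Suc (2 * k))"]
      by (simp only: pairs_skip_even pairs_skip_odd)
  qed simp
  finally show ?thesis .
qed

definition pw_sym :: "(nat \<Rightarrow> real) \<Rightarrow> laurent" where
  "pw_sym x = pw x 1 + pw x (- 1)"

definition pw_anti :: "(nat \<Rightarrow> real) \<Rightarrow> int \<Rightarrow> laurent" where
  "pw_anti x m = pw x m - pw x (- m)"

definition sym_vandermonde :: "nat \<Rightarrow> (nat \<Rightarrow> nat \<Rightarrow> real) \<Rightarrow> laurent" where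
  "sym_vandermonde n v = (\<Prod>j<n. \<Prod>i<j. pw_sym (v i) - pw_sym (v j))"

text \<open>The variable \<open>v k\<close> stands second in exactly the \<open>k\<close> factors
  with \<open>i < k\<close>; turning these around gives the sign, which is the one needed for a
  Laplace expansion along the first row.\<close>

lemma sym_vandermonde_skip:
  assumes "k < Suc n"
  shows "sym_vandermonde (Suc n) v =
    (-1) ^ k * (\<Prod>l<n. pw_sym (v k) - pw_sym (v (skip k l))) * sym_vandermonde n (v \<circ> skip k)"
  using assms
proof (induction n)
  case 0
  then show ?case by (simp add: sym_vandermonde_def)
next
  case (Suc n)
  have step: "sym_vandermonde (Suc N) w = sym_vandermonde N w * (\<Prod>i<N. pw_sym (w i) - pw_sym (w N))" for N w
    by (simp add: sym_vandermonde_def)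
  show ?case
  proof (cases "k = Suc n")
    case True
    have "(\<Prod>i<Suc n. pw_sym (v i) - pw_sym (v (Suc n))) = (\<Prod>i<Suc n. (-1) * (pw_sym (v (Suc n)) - pw_sym (v i)))"
      by (rule prod.cong) auto
    also have "\<dots> = (-1) ^ Suc n * (\<Prod>i<Suc n. pw_sym (v (Suc n)) - pw_sym (v i))"
      unfolding prod.distrib by (simp only: prod_constant card_lessThan)
    also have "(\<Prod>i<Suc n. pw_sym (v (Suc n)) - pw_sym (v i)) =
        (\<Prod>i<Suc n. pw_sym (v (Suc n)) - pw_sym (v (skip (Suc n) i)))"
      by (rule prod.cong) (auto simp: insert_index_def)
    moreover have "sym_vandermonde (Suc n) (v \<circ> skip (Suc n)) = sym_vandermonde (Suc n) v"
      unfolding sym_vandermonde_def by (intro prod.cong) (auto simp: insert_index_def)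
    ultimately show ?thesis unfolding True step[of "Suc n" v] by (simp only: mult_ac)
  next
    case False
    then have k: "k < Suc n" using Suc.prems by simp
    have "(\<Prod>i<Suc n. pw_sym (v i) - pw_sym (v (Suc n))) =
      (pw_sym (v k) - pw_sym (v (Suc n))) * (\<Prod>l<n. pw_sym (v (skip k l)) - pw_sym (v (Suc n)))"
    proof -
      have "{..<Suc n} = insert k (skip k ` {..<n})"
        using insert_index_image[of k n] k by (auto simp: atLeast0LessThan)
      moreover have "k \<notin> skip k ` {..<n}" by (auto simp: insert_index_def split: if_splits)
      moreover have "inj_on (skip k) {..<n}" by (rule insert_index_inj_on)
      ultimately show ?thesis by (simp add: prod.reindex comp_def)
    qed
    moreover have "skip k n = Suc n" using k by (simp add: insert_index_def)
    ultimately show ?thesis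
      unfolding step[of "Suc n" v] Suc.IH[OF k] step[of n "v \<circ> skip k"]
      by (simp add: mult_ac)
  qed
qed

definition incr :: "nat \<Rightarrow> (nat \<Rightarrow> int) \<Rightarrow> bool" where
  "incr m e \<longleftrightarrow> (\<forall>q. Suc q < m \<longrightarrow> e q < e (Suc q))"

lemma incrD: "incr m e \<Longrightarrow> Suc q < m \<Longrightarrow> e q < e (Suc q)"
  by (simp add: incr_def)

text \<open>The exponents that can remain after one pair is split off: \<open>e 0\<close> is
  consumed by the Laplace expansion, and the branching rule applied to the rest yields sequences
  interlacing with \<open>e \<circ> Suc\<close>.\<close>

definition box :: "nat \<Rightarrow> (nat \<Rightarrow> int) \<Rightarrow> (nat \<Rightarrow> int) set" where
  "box n e = (\<Pi>\<^sub>E q\<in>{..<2 * n}. {e (Suc q)<..e (Suc (Suc q))})"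

text \<open>The total amount by which the exponents decrease in one splitting; the part
  \<open>e 1 - e 0 - 1\<close> lowers the second exponent to just above the first.\<close>

definition box_size :: "nat \<Rightarrow> (nat \<Rightarrow> int) \<Rightarrow> (nat \<Rightarrow> int) \<Rightarrow> int" where
  "box_size n e g = e 1 - e 0 - 1 + (\<Sum>q<2 * n. e (Suc (Suc q)) - g q)"

lemma finite_box: "finite (box n e)"
  unfolding box_def by (intro finite_PiE) auto

text \<open>Each remaining pair contributes
  \<open>(1 - x y) (1 - x / y) = x (x + 1/x - y - 1/y)\<close> to the product in the branching rule.
  The \<open>n\<close> powers of \<open>x\<close>, and one more that makes up for the
  \<open>- 1\<close> in \<open>box_size\<close>, explain the shift by \<open>Suc n\<close>. What is
  left of the product is unchanged by inverting \<open>x\<close>, so the two terms for each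
  \<open>k\<close> combine into \<open>pw_anti\<close>.\<close>

lemma alternant_pairs_recursion:
  assumes mono: "incr (2 * Suc n) e"
  shows "alternant (2 * Suc n) e (pairs v) = (\<Sum>k<Suc n. \<Sum>g\<in>box n e.
     pw_anti (v k) (box_size n e g + int (Suc n)) * (\<Prod>l<n. pw_sym (v k) - pw_sym (v (skip k l))) *
       alternant (2 * n) g (pairs (v \<circ> skip k)))"
proof -
  have br: "pw x (- e 0) * alternant (Suc (2 * n)) (e \<circ> Suc) (case_nat x (pairs ys)) =
    (\<Sum>g\<in>box n e. pw x (box_size n e g + int (Suc n)) * (\<Prod>l<n. pw_sym x - pw_sym (ys l)) * alternant (2 * n) g (pairs ys))" for x ys
  proof -
    have f: "pw x 1 * (pw_sym x - pw_sym y) = (1 - pw x 1 * pw y 1) * (1 - pw x 1 * pw y (- 1))" for y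
    proof -
      have "pw x 1 * pw x (- 1) = 1" "pw y 1 * pw y (- 1) = 1" by (auto simp: pw_add [symmetric])
      then have 1: "pw x 1 * pw_sym x = pw x 1 * pw x 1 + 1" "(pw x 1 * pw y 1) * (pw x 1 * pw y (- 1)) = pw x 1 * pw x 1"
        by (simp_all add: pw_sym_def distrib_left mult_ac)
      have "(1 - pw x 1 * pw y 1) * (1 - pw x 1 * pw y (- 1)) =
          1 - pw x 1 * pw_sym y + (pw x 1 * pw y 1) * (pw x 1 * pw y (- 1))"
        by (simp add: pw_sym_def algebra_simps)
      then show ?thesis unfolding right_diff_distrib 1 by simp
    qed
    have "(\<Prod>j<2 * n. 1 - pw x 1 * pw (pairs ys j) (- 1)) = (\<Prod>l<n. (1 - pw x 1 * pw (ys l) 1) * (1 - pw x 1 * pw (ys l) (- 1)))"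
      by (subst prod_lessThan_double) (simp add: pw_uminus)
    also have "\<dots> = (\<Prod>l<n. pw x 1 * (pw_sym x - pw_sym (ys l)))" by (simp add: f)
    also have "\<dots> = pw x (int n) * (\<Prod>l<n. pw_sym x - pw_sym (ys l))"
      by (simp add: prod.distrib pw_power)
    finally have P: "(\<Prod>j<2 * n. 1 - pw x 1 * pw (pairs ys j) (- 1)) = pw x (int n) * (\<Prod>l<n. pw_sym x - pw_sym (ys l))" .
    have "alternant (Suc (2 * n)) (e \<circ> Suc) (case_nat x (pairs ys)) =
      pw x (e 1) * (pw x (int n) * (\<Prod>l<n. pw_sym x - pw_sym (ys l))) *
      (\<Sum>g\<in>box n e. pw x (\<Sum>q<2 * n. e (Suc (Suc q)) - g q) * alternant (2 * n) g (pairs ys))"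
      by (subst alternant_branching) (use incrD[OF mono] in \<open>auto simp: P box_def\<close>)
    moreover have "pw x (- e 0) * (pw x (e 1) * (pw x (int n) * C) * (pw x s * D)) =
       pw x (e 1 - e 0 - 1 + s + int (Suc n)) * C * D" for C D s
    proof -
      have "e 1 - e 0 - 1 + s + int (Suc n) = - e 0 + (e 1 + (int n + s))" by simp
      then show ?thesis by (simp only: pw_add mult_ac)
    qed
    ultimately show ?thesis by (simp add: sum_distrib_left box_size_def)
  qed
  have neg: "pw_sym (- x) = pw_sym x" for x by (simp add: pw_sym_def pw_uminus)
  show ?thesis
    unfolding alternant_pairs_expand
  proof (rule sum.cong)
    fix k
    have 1: "pw (v k) (e 0) = pw (- v k) (- e 0)" by (simp add: pw_uminus)
    show "pw (v k) (- e 0) * alternant (Suc (2 * n)) (e \<circ> Suc) (case_nat (v k) (pairs (v \<circ> skip k))) -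
      pw (v k) (e 0) * alternant (Suc (2 * n)) (e \<circ> Suc) (case_nat (- v k) (pairs (v \<circ> skip k))) = 
      (\<Sum>g\<in>box n e. pw_anti (v k) (box_size n e g + int (Suc n)) * (\<Prod>l<n. pw_sym (v k) - pw_sym (v (skip k l))) *
       alternant (2 * n) g (pairs (v \<circ> skip k)))"
      unfolding 1 br neg unfolding pw_uminus pw_anti_def
      by (simp add: sum_subtractf [symmetric] algebra_simps)
  qed simp
qed

section \<open>Iterated splitting: Weyl alternants of type C summed over arrays\<close>

definition weyl_alternant :: "nat \<Rightarrow> (nat \<Rightarrow> int) \<Rightarrow> (nat \<Rightarrow> nat \<Rightarrow> real) \<Rightarrow> laurent" where
  "weyl_alternant n l v = det (mat n n (\<lambda>(i, j). pw_anti (v j) (l i)))"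

lemma weyl_alternant_row:
  "weyl_alternant (Suc n) l v = (\<Sum>k<Suc n. (-1) ^ k * pw_anti (v k) (l 0) * weyl_alternant n (l \<circ> Suc) (v \<circ> skip k))"
  unfolding weyl_alternant_def by (subst det_mat_row[of 0]) (simp_all del: sum.lessThan_Suc)

lemma weyl_alternant_cong:
  assumes "\<And>i. i < n \<Longrightarrow> l i = l' i"
  shows "weyl_alternant n l v = weyl_alternant n l' v"
  unfolding weyl_alternant_def by (rule det_mat_cong) (use assms in auto)

definition colsum :: "(nat \<Rightarrow> nat \<Rightarrow> nat) \<Rightarrow> nat \<Rightarrow> nat \<Rightarrow> int" where
  "colsum a i j = (\<Sum>r<i. int (a r j))"

text \<open>The number \<open>a i j\<close> records by how much the \<open>j\<close>-th exponent decreases when the \<open>i\<close>-th pair of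
  variables is split off, so that \<open>e j - colsum a i j\<close> is the exponent that remains before this step.\<close>

definition sp_chains :: "nat \<Rightarrow> (nat \<Rightarrow> int) \<Rightarrow> (nat \<Rightarrow> nat \<Rightarrow> nat) set" where
  "sp_chains n e = {a.
     (\<forall>i j. a i j \<noteq> 0 \<longrightarrow> i < n \<and> 2 * i \<le> j \<and> j < 2 * n) \<and>
     (\<forall>i j. i < n \<longrightarrow> Suc j < 2 * n \<longrightarrow> e j - colsum a i j < e (Suc j) - colsum a (Suc i) (Suc j)) \<and>
     (\<forall>j<n. e (2 * j) - colsum a n (2 * j) + 1 = e (Suc (2 * j)) - colsum a n (Suc (2 * j)))}"

text \<open>The row sum shifted by the coordinate \<open>n - i\<close> of \<rho>, as in the
  numerator of a Weyl character.\<close>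

definition chain_exponent :: "nat \<Rightarrow> (nat \<Rightarrow> nat \<Rightarrow> nat) \<Rightarrow> nat \<Rightarrow> int" where
  "chain_exponent n a i = int (\<Sum>j<2 * n. a i j) + int n - int i"

definition chain_sum :: "nat \<Rightarrow> (nat \<Rightarrow> int) \<Rightarrow> (nat \<Rightarrow> nat \<Rightarrow> real) \<Rightarrow> laurent" where
  "chain_sum n e v = (\<Sum>a\<in>sp_chains n e. weyl_alternant n (chain_exponent n a) v)"

lemma colsum_Suc: "colsum a (Suc i) j = int (a 0 j) + colsum (\<lambda>r. a (Suc r)) i j"
  unfolding colsum_def by (subst sum.lessThan_Suc_shift) simp

text \<open>Only row 0 is supported in the columns 0 and 1, so the interlacing inequality and the
  final condition there involve \<open>a 0 0\<close> and \<open>a 0 1\<close> alone. Together they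
  leave no choice.\<close>

lemma sp_chains_first:
  assumes "a \<in> sp_chains (Suc n) e"
  shows "a 0 0 = 0" "int (a 0 1) = e 1 - e 0 - 1"
proof -
  have z: "a (Suc i) 0 = 0" "a (Suc i) 1 = 0" for i
    using assms unfolding sp_chains_def by force+
  have "e 0 - colsum a (Suc n) 0 + 1 = e 1 - colsum a (Suc n) 1"
    using assms unfolding sp_chains_def by force
  moreover have "e 0 - colsum a 0 0 < e 1 - colsum a (Suc 0) 1"
    using assms unfolding sp_chains_def by force
  ultimately show "a 0 0 = 0" "int (a 0 1) = e 1 - e 0 - 1"
    unfolding colsum_Suc by (auto simp: z z[unfolded One_nat_def] colsum_def)
qed

definition chain_cons :: "nat \<Rightarrow> (nat \<Rightarrow> int) \<Rightarrow> (nat \<Rightarrow> int) \<Rightarrow> (nat \<Rightarrow> nat \<Rightarrow> nat) \<Rightarrow> nat \<Rightarrow> nat \<Rightarrow> nat" where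
  "chain_cons n e g a i j = (case i of
      0 \<Rightarrow> (if j = 1 then nat (e 1 - e 0 - 1) else if 2 \<le> j \<and> j < 2 * Suc n then nat (e j - g (j - 2)) else 0)
    | Suc i \<Rightarrow> (if 2 \<le> j then a i (j - 2) else 0))"

text \<open>Row 0 of the array records the passage from \<open>e\<close> to \<open>g\<close>; the
  other rows, shifted by one row and two columns, form a chain starting at \<open>g\<close>. The
  inequalities for \<open>i = 0\<close> amount to membership of \<open>g\<close> in the box, those
  for larger \<open>i\<close> to the inequalities of the shorter chain.\<close>

lemma sp_chains_Suc:
  assumes mono: "incr (2 * Suc n) e"
  shows "bij_betw (\<lambda>(g, a). chain_cons n e g a) (SIGMA g:box n e. sp_chains n g) (sp_chains (Suc n) e)"
proof (rule bij_betw_byWitness[where f' =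
    "\<lambda>a. (restrict (\<lambda>q. e (Suc (Suc q)) - int (a 0 (Suc (Suc q)))) {..<2 * n}, \<lambda>i j. a (Suc i) (Suc (Suc j)))"])
  let ?f = "\<lambda>(g, a). chain_cons n e g a"
  let ?h = "\<lambda>a::nat \<Rightarrow> nat \<Rightarrow> nat. (restrict (\<lambda>q. e (Suc (Suc q)) - int (a 0 (Suc (Suc q)))) {..<2 * n}, \<lambda>i j. a (Suc i) (Suc (Suc j)))"
  show "\<forall>x\<in>SIGMA g:box n e. sp_chains n g. ?h (?f x) = x"
  proof
    fix x assume "x \<in> (SIGMA g:box n e. sp_chains n g)"
    then obtain g a where x: "x = (g, a)" and g: "g \<in> box n e" and a: "a \<in> sp_chains n g" by blast
    have "restrict (\<lambda>q. e (Suc (Suc q)) - int (chain_cons n e g a 0 (Suc (Suc q)))) {..<2 * n} = g"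
    proof
      fix q show "restrict (\<lambda>q. e (Suc (Suc q)) - int (chain_cons n e g a 0 (Suc (Suc q)))) {..<2 * n} q = g q"
        using g by (cases "q < 2 * n") (auto simp: chain_cons_def box_def PiE_iff extensional_def)
    qed
    then show "?h (?f x) = x" unfolding x by (simp add: chain_cons_def fun_eq_iff)
  qed
  show "\<forall>a\<in>sp_chains (Suc n) e. ?f (?h a) = a"
  proof
    fix a assume a: "a \<in> sp_chains (Suc n) e"
    have s: "a i j \<noteq> 0 \<longrightarrow> i < Suc n \<and> 2 * i \<le> j \<and> j < 2 * Suc n" for i j
      using a unfolding sp_chains_def by blast
    show "?f (?h a) = a"
    proof (intro ext)
      fix i j
      have s1: "a i j \<noteq> 0 \<longrightarrow> i < Suc n \<and> 2 * i \<le> j \<and> j < 2 * Suc n" by (rule s)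
      show "?f (?h a) i j = a i j"
      proof (cases i)
        case 0
        consider "j = 0" | "j = 1" | "2 \<le> j" "j < 2 * Suc n" | "j \<ge> 2 * Suc n" by linarith
        then show ?thesis
        proof cases
          case 1 then show ?thesis using 0 sp_chains_first[OF a] by (simp add: chain_cons_def)
        next
          case 2 then show ?thesis using 0 sp_chains_first(2)[OF a, symmetric] by (simp add: chain_cons_def)
        next
          case 3
          then obtain q where "j = Suc (Suc q)" "q < 2 * n" by (metis Suc_le_D add_2_eq_Suc le_add_diff_inverse mult_Suc_right nat_add_left_cancel_less)
          then show ?thesis using 0 by (simp add: chain_cons_def)
        next
          case 4 then show ?thesis using 0 s1 by (auto simp: chain_cons_def)
        qed
      next
        case (Suc i')
        show ?thesis
        proof (cases "2 \<le> j")
          case True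
          then show ?thesis using Suc by (simp add: chain_cons_def numeral_2_eq_2 Suc_diff_Suc)
        next
          case False
          then show ?thesis using Suc s1 by (auto simp: chain_cons_def)
        qed
      qed
    qed
  qed
  show "?f ` (SIGMA g:box n e. sp_chains n g) \<subseteq> sp_chains (Suc n) e"
  proof (rule image_subsetI)
    fix x assume "x \<in> (SIGMA g:box n e. sp_chains n g)"
    then obtain g a where x: "x = (g, a)" and g: "g \<in> box n e" and a: "a \<in> sp_chains n g" by blast
    let ?c = "chain_cons n e g a"
    have gq: "e (Suc q) < g q" "g q \<le> e (Suc (Suc q))" if "q < 2 * n" for q
      using g that by (auto simp: box_def PiE_iff)
    have as: "a i j \<noteq> 0 \<longrightarrow> i < n \<and> 2 * i \<le> j \<and> j < 2 * n" for i j
      using a unfolding sp_chains_def by blast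
    have am: "g j - colsum a i j < g (Suc j) - colsum a (Suc i) (Suc j)" if "i < n" "Suc j < 2 * n" for i j
      using a that unfolding sp_chains_def by blast
    have ae: "g (2 * j) - colsum a n (2 * j) + 1 = g (Suc (2 * j)) - colsum a n (Suc (2 * j))" if "j < n" for j
      using a that unfolding sp_chains_def by blast
    have e01: "e 0 < e 1" using incrD[OF mono, of 0] by simp
    have c0: "colsum ?c i 0 = 0" for i
      by (auto simp: colsum_def chain_cons_def intro!: sum.neutral split: nat.splits)
    have c1: "colsum ?c (Suc i) 1 = e 1 - e 0 - 1" for i
      unfolding colsum_Suc using e01 by (auto simp: colsum_def chain_cons_def)
    have c2: "colsum ?c (Suc i) (Suc (Suc j)) = e (Suc (Suc j)) - g j + colsum a i j" if "j < 2 * n" for i j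
      unfolding colsum_Suc using gq[OF that] that by (auto simp: colsum_def chain_cons_def)
    \<comment> \<open>Column 0 of \<open>a\<close> becomes column 2 of the new array. As it never
      moves, its level stays at \<open>g 0\<close>, above the level of column 1 at every
      stage.\<close>
    have a0: "colsum a i 0 = 0" for i
    proof (cases n)
      case 0 then show ?thesis using as by (auto simp: colsum_def)
    next
      case (Suc n')
      have "a i 0 = 0" for i
      proof (cases i)
        case 0 show ?thesis unfolding 0 by (rule sp_chains_first(1)[of a n' g]) (use a Suc in simp)
      next
        case (Suc i') then show ?thesis using as[of i 0] by auto
      qed
      then show ?thesis by (simp add: colsum_def)
    qed
    have "?c \<in> sp_chains (Suc n) e"
      unfolding sp_chains_def
    proof (intro CollectI conjI allI impI)
      fix i j assume nz: "?c i j \<noteq> 0"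
      then show "i < Suc n" "2 * i \<le> j" "j < 2 * Suc n"
        using as[of "i - 1" "j - 2"] by (auto simp: chain_cons_def split: nat.splits if_splits)
    next
      fix i j assume i: "i < Suc n" and j: "Suc j < 2 * Suc n"
      consider "j = 0" | "j = 1" | q where "j = Suc (Suc q)"
        by (metis One_nat_def not0_implies_Suc)
      then show "e j - colsum ?c i j < e (Suc j) - colsum ?c (Suc i) (Suc j)"
      proof cases
        case 1 then show ?thesis using c0[of i] c1[of i] by simp
      next
        case 2
        have n: "0 < 2 * n" using 2 j by auto
        have "e 1 - colsum ?c i 1 < g 0 - colsum a i 0"
        proof (cases i)
          case 0 then show ?thesis using gq(1)[OF n] by (simp add: colsum_def)
        next
          case (Suc i')
          show ?thesis unfolding Suc c1 using gq(1)[OF n] a0[of "Suc i'"] e01 by simp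
        qed
        then show ?thesis using 2 c2[OF n, of i] by (simp add: numeral_2_eq_2)
      next
        case 3
        then have q: "q < 2 * n" "Suc q < 2 * n" using j by auto
        show ?thesis
        proof (cases i)
          case 0
          have "colsum a 0 (Suc q) = 0" by (simp add: colsum_def)
          then show ?thesis using 3 0 gq[OF q(2)] c2[OF q(2), of 0] by (simp add: colsum_def[of _ 0])
        next
          case (Suc i')
          then show ?thesis using i 3 am[of i' q] q c2[OF q(2), of i] c2[OF q(1), of i'] by simp
        qed
      qed
    next
      fix j assume j: "j < Suc n"
      show "e (2 * j) - colsum ?c (Suc n) (2 * j) + 1 = e (Suc (2 * j)) - colsum ?c (Suc n) (Suc (2 * j))"
      proof (cases j)
        case 0 then show ?thesis using c0[of "Suc n"] c1[of n] by simp
      next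
        case (Suc j')
        then show ?thesis using j ae[of j'] c2[of "2 * j'" n] c2[of "Suc (2 * j')" n] by simp
      qed
    qed
    then show "?f x \<in> sp_chains (Suc n) e" unfolding x by simp
  qed
  show "?h ` sp_chains (Suc n) e \<subseteq> (SIGMA g:box n e. sp_chains n g)"
  proof (rule image_subsetI)
    fix a assume a: "a \<in> sp_chains (Suc n) e"
    let ?g = "restrict (\<lambda>q. e (Suc (Suc q)) - int (a 0 (Suc (Suc q)))) {..<2 * n}" and ?a = "\<lambda>i j. a (Suc i) (Suc (Suc j))"
    have as: "a i j \<noteq> 0 \<longrightarrow> i < Suc n \<and> 2 * i \<le> j \<and> j < 2 * Suc n" for i j
      using a unfolding sp_chains_def by blast
    have am: "e j - colsum a i j < e (Suc j) - colsum a (Suc i) (Suc j)" if "i < Suc n" "Suc j < 2 * Suc n" for i j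
      using a that unfolding sp_chains_def by blast
    have ae: "e (2 * j) - colsum a (Suc n) (2 * j) + 1 = e (Suc (2 * j)) - colsum a (Suc n) (Suc (2 * j))" if "j < Suc n" for j
      using a that unfolding sp_chains_def by blast
    have c: "colsum a (Suc i) (Suc (Suc j)) = int (a 0 (Suc (Suc j))) + colsum ?a i j" for i j
      unfolding colsum_Suc by (simp add: colsum_def)
    have "?g \<in> box n e"
      unfolding box_def
    proof (rule restrict_PiE_iff[THEN iffD2], rule ballI)
      fix q assume "q \<in> {..<2 * n}"
      then show "e (Suc (Suc q)) - int (a 0 (Suc (Suc q))) \<in> {e (Suc q)<..e (Suc (Suc q))}"
        using am[of 0 "Suc q"] by (simp add: colsum_def)
    qed
    moreover have "?a \<in> sp_chains n ?g"
      unfolding sp_chains_def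
    proof (intro CollectI conjI allI impI)
      fix i j assume "?a i j \<noteq> 0"
      then show "i < n" "2 * i \<le> j" "j < 2 * n" using as[of "Suc i" "Suc (Suc j)"] by auto
    next
      fix i j assume "i < n" "Suc j < 2 * n"
      then show "?g j - colsum ?a i j < ?g (Suc j) - colsum ?a (Suc i) (Suc j)"
        using am[of "Suc i" "Suc (Suc j)"] unfolding c by simp
    next
      fix j assume "j < n"
      then show "?g (2 * j) - colsum ?a n (2 * j) + 1 = ?g (Suc (2 * j)) - colsum ?a n (Suc (2 * j))"
        using ae[of "Suc j"] c[of n "2 * j"] c[of n "Suc (2 * j)"] by simp
    qed
    ultimately show "?h a \<in> (SIGMA g:box n e. sp_chains n g)" by blast
  qed
qed

lemma sp_chains_0: "sp_chains 0 e = {\<lambda>_ _. 0}"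
  by (auto simp: sp_chains_def fun_eq_iff)

lemma incr_box:
  assumes "g \<in> box n e"
  shows "incr (2 * n) g"
  unfolding incr_def
proof (intro allI impI)
  fix q assume "Suc q < 2 * n"
  then have "g q \<le> e (Suc (Suc q))" "e (Suc (Suc q)) < g (Suc q)" using assms by (auto simp: box_def PiE_iff)
  then show "g q < g (Suc q)" by simp
qed

lemma finite_sp_chains:
  assumes "incr (2 * n) e"
  shows "finite (sp_chains n e)"
  using assms
proof (induction n arbitrary: e)
  case 0 then show ?case by (simp add: sp_chains_0)
next
  case (Suc n)
  have "finite (SIGMA g:box n e. sp_chains n g)"
    by (intro finite_SigmaI finite_box Suc.IH incr_box)
  then show ?case using bij_betw_finite[OF sp_chains_Suc[OF Suc.prems]] by blast
qed

lemma chain_sum_Suc: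
  assumes mono: "incr (2 * Suc n) e"
  shows "chain_sum (Suc n) e v = (\<Sum>k<Suc n. \<Sum>g\<in>box n e.
     (-1) ^ k * pw_anti (v k) (box_size n e g + int (Suc n)) * chain_sum n g (v \<circ> skip k))"
proof -
  have "chain_sum (Suc n) e v = (\<Sum>(g, a)\<in>(SIGMA g:box n e. sp_chains n g). weyl_alternant (Suc n) (chain_exponent (Suc n) (chain_cons n e g a)) v)"
    unfolding chain_sum_def sum.reindex_bij_betw[OF sp_chains_Suc[OF mono], symmetric] by (simp add: case_prod_unfold)
  also have "\<dots> = (\<Sum>g\<in>box n e. \<Sum>a\<in>sp_chains n g. weyl_alternant (Suc n) (chain_exponent (Suc n) (chain_cons n e g a)) v)"
    by (rule sum.Sigma [symmetric]) (auto intro!: finite_box finite_sp_chains incr_box)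
  also have "\<dots> = (\<Sum>g\<in>box n e. \<Sum>a\<in>sp_chains n g. \<Sum>k<Suc n.
     (-1) ^ k * pw_anti (v k) (box_size n e g + int (Suc n)) * weyl_alternant n (chain_exponent n a) (v \<circ> skip k))"
  proof (intro sum.cong refl)
    fix g a assume g: "g \<in> box n e" and a: "a \<in> sp_chains n g"
    let ?c = "chain_cons n e g a"
    have e01: "e 0 < e 1" using incrD[OF mono, of 0] by simp
    have gq: "g q \<le> e (Suc (Suc q))" if "q < 2 * n" for q
      using g that by (auto simp: box_def PiE_iff)
    have sp: "(\<Sum>j<2 * Suc n. ?c i j) = ?c i 0 + ?c i 1 + (\<Sum>j<2 * n. ?c i (Suc (Suc j)))" for i
    proof -
      have "2 * Suc n = Suc (Suc (2 * n))" by simp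
      then show ?thesis by (simp only: sum.lessThan_Suc_shift) simp
    qed
    have 0: "chain_exponent (Suc n) ?c 0 = box_size n e g + int (Suc n)"
    proof -
      have "int (\<Sum>j<2 * n. ?c 0 (Suc (Suc j))) = (\<Sum>q<2 * n. e (Suc (Suc q)) - g q)"
        unfolding of_nat_sum by (rule sum.cong) (use gq in \<open>auto simp: chain_cons_def\<close>)
      moreover have "int (?c 0 0) = 0" "int (?c 0 1) = e 1 - e 0 - 1" using e01 by (auto simp: chain_cons_def)
      ultimately show ?thesis unfolding chain_exponent_def sp box_size_def by simp
    qed
    have S: "(chain_exponent (Suc n) ?c \<circ> Suc) i = chain_exponent n a i" for i
    proof -
      have "(\<Sum>j<2 * n. ?c (Suc i) (Suc (Suc j))) = (\<Sum>j<2 * n. a i j)" "?c (Suc i) 0 = 0" "?c (Suc i) 1 = 0"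
        by (auto simp: chain_cons_def)
      then show ?thesis unfolding chain_exponent_def comp_def sp by simp
    qed
    have "weyl_alternant n (chain_exponent (Suc n) ?c \<circ> Suc) w = weyl_alternant n (chain_exponent n a) w" for w
      by (rule weyl_alternant_cong) (rule S)
    then show "weyl_alternant (Suc n) (chain_exponent (Suc n) ?c) v = (\<Sum>k<Suc n.
     (-1) ^ k * pw_anti (v k) (box_size n e g + int (Suc n)) * weyl_alternant n (chain_exponent n a) (v \<circ> skip k))"
      unfolding weyl_alternant_row 0 by simp
  qed
  also have "\<dots> = (\<Sum>g\<in>box n e. \<Sum>k<Suc n.
     (-1) ^ k * pw_anti (v k) (box_size n e g + int (Suc n)) * chain_sum n g (v \<circ> skip k))"
    by (intro sum.cong refl) (simp add: sum.swap[of _ "sp_chains n _"] chain_sum_def sum_distrib_left del: sum.lessThan_Suc)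
  also have "\<dots> = (\<Sum>k<Suc n. \<Sum>g\<in>box n e.
     (-1) ^ k * pw_anti (v k) (box_size n e g + int (Suc n)) * chain_sum n g (v \<circ> skip k))"
    by (rule sum.swap)
  finally show ?thesis .
qed

text \<open>Both sides obey the same recursion: the Weyl alternant is expanded along its first row,
  and the signs and factors of this expansion are those of
  \<open>sym_vandermonde_skip\<close>.\<close>

theorem alternant_pairs_chain_sum:
  assumes "incr (2 * n) e"
  shows "alternant (2 * n) e (pairs v) = sym_vandermonde n v * chain_sum n e v"
  using assms
proof (induction n arbitrary: e v)
  case 0
  then show ?case by (simp add: alternant_def sym_vandermonde_def chain_sum_def sp_chains_0 weyl_alternant_def)
next
  case (Suc n)
  have "sym_vandermonde (Suc n) v * chain_sum (Suc n) e v =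
     (\<Sum>k<Suc n. \<Sum>g\<in>box n e. sym_vandermonde (Suc n) v *
       ((-1) ^ k * pw_anti (v k) (box_size n e g + int (Suc n)) * chain_sum n g (v \<circ> skip k)))"
    unfolding chain_sum_Suc[OF Suc.prems] by (simp only: sum_distrib_left)
  also have "\<dots> = (\<Sum>k<Suc n. \<Sum>g\<in>box n e.
     pw_anti (v k) (box_size n e g + int (Suc n)) * (\<Prod>l<n. pw_sym (v k) - pw_sym (v (skip k l))) *
       alternant (2 * n) g (pairs (v \<circ> skip k)))"
  proof (intro sum.cong refl)
    fix k g assume k: "k \<in> {..<Suc n}" and g: "g \<in> box n e"
    have A: "alternant (2 * n) g (pairs (v \<circ> skip k)) = sym_vandermonde n (v \<circ> skip k) * chain_sum n g (v \<circ> skip k)"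
      by (rule Suc.IH) (rule incr_box[OF g])
    have "((-1) ^ k * P * V) * ((-1) ^ k * f * C) = f * P * (V * C)" for f P V C :: laurent
    proof -
      have "((-1) ^ k * P * V) * ((-1) ^ k * f * C) = ((-1) ^ k * (-1) ^ k) * (f * P * (V * C))"
        by (simp only: ac_simps)
      then show ?thesis by (simp add: power_add [symmetric])
    qed
    then show "sym_vandermonde (Suc n) v *
       ((-1) ^ k * pw_anti (v k) (box_size n e g + int (Suc n)) * chain_sum n g (v \<circ> skip k)) =
      pw_anti (v k) (box_size n e g + int (Suc n)) * (\<Prod>l<n. pw_sym (v k) - pw_sym (v (skip k l))) *
       alternant (2 * n) g (pairs (v \<circ> skip k))"
      using k unfolding A by (subst sym_vandermonde_skip[of k]) auto
  qed
  also have "\<dots> = alternant (2 * Suc n) e (pairs v)"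
    by (rule alternant_pairs_recursion[OF Suc.prems, symmetric])
  finally show ?case by simp
qed

section \<open>Littlewood's identity\<close>

text \<open>The exponents \<open>2 * \<mu> i + i\<close> of a partition \<mu> whose parts are listed
  in increasing order: strict increase together with the parity condition says that \<mu> increases
  weakly.\<close>

definition even_exp :: "nat \<Rightarrow> (nat \<Rightarrow> int) \<Rightarrow> bool" where
  "even_exp N e \<longleftrightarrow> incr N e \<and> (\<forall>i<N. 0 \<le> e i \<and> even (e i - int i))"

definition ins :: "nat \<Rightarrow> (nat \<Rightarrow> int) \<Rightarrow> int \<Rightarrow> nat \<Rightarrow> int" where
  "ins i h m = (\<lambda>j. if j < i then h j else if j = i then m else h (j - 1))"

definition drop_set :: "(nat \<Rightarrow> int) \<Rightarrow> nat set \<Rightarrow> nat \<Rightarrow> int" where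
  "drop_set g S = (\<lambda>k. g k - of_bool (k \<in> S))"

lemma incr_less:
  assumes "incr m e" "i < j" "j < m"
  shows "e i < e j"
  using assms(2,3)
proof (induction j)
  case (Suc j)
  have "e j < e (Suc j)" using incrD[OF assms(1)] Suc.prems by auto
  then show ?case using Suc by (cases "i = j") auto
qed simp

text \<open>Parity forces \<open>S\<close>: an entry left of the inserted one keeps its index, an
  entry to the right has its index raised by one, and 1 has to be subtracted exactly where the
  parity is wrong. Once \<open>S\<close> is fixed, \<open>m\<close> is restricted only by its own
  parity, its sign and its two neighbours; the other strict inequalities follow from those of
  \<open>g\<close>, since neighbouring entries differ in parity.\<close>

lemma even_exp_ins:
  assumes g: "incr M g" "\<And>k. k < M \<Longrightarrow> 0 \<le> g k" and S: "S \<subseteq> {..<M}" and i: "i \<le> M"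
  shows "even_exp (Suc M) (ins i (drop_set g S) m) \<longleftrightarrow>
    S = {k. k < M \<and> (k < i \<longleftrightarrow> odd (g k - int k))} \<and> even (m - int i) \<and> 0 \<le> m \<and>
    (0 < i \<longrightarrow> g (i - 1) - of_bool (odd (g (i - 1) - int (i - 1))) < m) \<and>
    (i < M \<longrightarrow> m < g i - of_bool (even (g i - int i)))" (is "?L = ?R")
proof
  assume L: ?L
  then have inc: "incr (Suc M) (ins i (drop_set g S) m)"
    and ev: "\<And>j. j < Suc M \<Longrightarrow> 0 \<le> ins i (drop_set g S) m j \<and> even (ins i (drop_set g S) m j - int j)"
    by (auto simp: even_exp_def)
  have 1: "k \<in> S \<longleftrightarrow> odd (g k - int k)" if "k < i" "k < M" for k
    using ev[of k] that by (auto simp: ins_def drop_set_def)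
  have 2: "k \<in> S \<longleftrightarrow> even (g k - int k)" if "\<not> k < i" "k < M" for k
    using ev[of "Suc k"] that by (auto simp: ins_def drop_set_def)
  have SS: "S = {k. k < M \<and> (k < i \<longleftrightarrow> odd (g k - int k))}"
    using 1 2 S by auto
  have "g (i - 1) - of_bool (odd (g (i - 1) - int (i - 1))) < m" if "0 < i"
    using incrD[OF inc, of "i - 1"] 1[of "i - 1"] that i by (auto simp: ins_def drop_set_def)
  moreover have "m < g i - of_bool (even (g i - int i))" if "i < M"
    using incrD[OF inc, of i] 2[of i] that by (auto simp: ins_def drop_set_def)
  moreover have "even (m - int i)" "0 \<le> m" using ev[of i] i by (auto simp: ins_def)
  ultimately show ?R using SS by blast
next
  assume R: ?R
  let ?e = "ins i (drop_set g S) m"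
  have S1: "k \<in> S \<longleftrightarrow> odd (g k - int k)" if "k < i" "k < M" for k using R that by auto
  have S2: "k \<in> S \<longleftrightarrow> even (g k - int k)" if "i \<le> k" "k < M" for k using R that by auto
  have par: "even (?e j - int j)" if "j < Suc M" for j
  proof -
    consider "j < i" | "j = i" | k where "j = Suc k" "i \<le> k" by (metis Suc_le_D linorder_less_linear less_Suc_eq_le not_less_eq_eq Suc_leI)
    then show ?thesis
    proof cases
      case 1 then show ?thesis using S1[of j] i by (auto simp: ins_def drop_set_def)
    next
      case 2 then show ?thesis using R by (auto simp: ins_def)
    next
      case 3 then show ?thesis using S2[of k] that by (auto simp: ins_def drop_set_def)
    qed
  qed
  have nn: "0 \<le> drop_set g S k" if "k < M" "k < i \<or> i \<le> k" for k
  proof (cases "g k = 0")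
    case True
    have "k = 0" proof (rule ccontr)
      assume "k \<noteq> 0" then have "g 0 < g k" using incr_less[OF g(1), of 0 k] that by auto
      then show False using g(2)[of 0] True that by auto
    qed
    then show ?thesis
    proof (cases "k < i")
      case False
      then have "i = 0" "i < M" using \<open>k = 0\<close> that by auto
      then have "m < g 0 - of_bool (even (g 0))" "0 \<le> m" using R by auto
      then show ?thesis using True \<open>k = 0\<close> by simp
    qed (use S1[of k] that True in \<open>auto simp: drop_set_def\<close>)
  next
    case False
    then show ?thesis using g(2)[OF that(1)] by (auto simp: drop_set_def)
  qed
  have "incr (Suc M) ?e"
    unfolding incr_def
  proof (intro allI impI)
    fix q assume q: "Suc q < Suc M"
    consider "Suc q < i" | "Suc q = i" | "q = i" | "i < q" by linarith
    then show "?e q < ?e (Suc q)"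
    proof cases
      case 1
      then have "g q < g (Suc q)" using incrD[OF g(1), of q] i by auto
      moreover have "even (?e q - int q)" "even (?e (Suc q) - int (Suc q))" using par q by auto
      then have "?e q \<noteq> ?e (Suc q)" by auto
      ultimately show ?thesis using 1 by (auto simp: ins_def drop_set_def of_bool_def split: if_splits)
    next
      case 2 then show ?thesis using R S1[of q] q by (auto simp: ins_def drop_set_def)
    next
      case 3 then show ?thesis using R S2[of q] q by (auto simp: ins_def drop_set_def)
    next
      case 4
      then have "g (q - 1) < g q" using incrD[OF g(1), of "q - 1"] q by auto
      moreover have "even (?e q - int q)" "even (?e (Suc q) - int (Suc q))" using par q by auto
      then have "?e q \<noteq> ?e (Suc q)" by auto
      ultimately show ?thesis using 4 by (auto simp: ins_def drop_set_def of_bool_def split: if_splits)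
    qed
  qed
  moreover have "0 \<le> ?e j" if "j < Suc M" for j
  proof -
    consider "j < i" | "j = i" | "i < j" by linarith
    then show ?thesis
    proof cases
      case 1 then show ?thesis using nn[of j] i by (simp add: ins_def)
    next
      case 2 then show ?thesis using R by (simp add: ins_def)
    next
      case 3
      then have "0 \<le> drop_set g S (j - 1)" using that by (intro nn) auto
      then show ?thesis using 3 by (simp add: ins_def)
    qed
  qed
  ultimately show ?L using par by (auto simp: even_exp_def)
qed

lemma even_exp_drop_set:
  assumes g: "incr M g" "\<And>k. k < M \<Longrightarrow> 0 \<le> g k" and S: "S \<subseteq> {..<M}"
  shows "even_exp M (drop_set g S) \<longleftrightarrow> S = {k. k < M \<and> odd (g k - int k)}" (is "?L = ?R")
proof
  assume ?L
  then have ev: "\<And>j. j < M \<Longrightarrow> even (drop_set g S j - int j)" by (auto simp: even_exp_def)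
  have "k \<in> S \<longleftrightarrow> odd (g k - int k)" if "k < M" for k
    using ev[OF that] by (auto simp: drop_set_def)
  then show ?R using S by auto
next
  assume R: ?R
  let ?e = "drop_set g S"
  have par: "even (?e j - int j)" if "j < M" for j
    using R that by (auto simp: drop_set_def)
  have "incr M ?e"
    unfolding incr_def
  proof (intro allI impI)
    fix q assume q: "Suc q < M"
    then have "g q < g (Suc q)" using incrD[OF g(1), of q] by auto
    moreover have "even (?e q - int q)" "even (?e (Suc q) - int (Suc q))" using par q by auto
    then have "?e q \<noteq> ?e (Suc q)" by auto
    ultimately show "?e q < ?e (Suc q)" by (auto simp: drop_set_def of_bool_def split: if_splits)
  qed
  moreover have "0 \<le> ?e j" if "j < M" for j
  proof (cases "g j = 0")
    case True
    have "j = 0" proof (rule ccontr)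
      assume "j \<noteq> 0" then have "g 0 < g j" using incr_less[OF g(1), of 0 j] that by auto
      then show False using g(2)[of 0] True that by auto
    qed
    then show ?thesis using R True by (auto simp: drop_set_def)
  next
    case False
    then show ?thesis using g(2)[OF that] by (auto simp: drop_set_def)
  qed
  ultimately show ?L using par by (auto simp: even_exp_def)
qed

text \<open>For a given position \<open>i\<close> the parities determine \<open>S\<close>. The remaining sum over \<open>i\<close> telescopes, and
  only the boundary term at \<open>i = 0\<close> survives.\<close>

lemma even_exp_signed_count:
  fixes w :: int
  assumes g: "incr M g" "\<And>k. k < M \<Longrightarrow> 0 \<le> g k"
  shows "(\<Sum>i\<le>M. \<Sum>S\<in>Pow {..<M}. \<Sum>\<epsilon><2. (-1) ^ (i + card S + \<epsilon>) *
      of_bool (even_exp (Suc M) (ins i (drop_set g S) (w - int (card S) - 2 * int \<epsilon>)))) =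
    (\<Sum>S\<in>Pow {..<M}. (-1) ^ (M - card S) * of_bool (even_exp M (drop_set g S) \<and> w = int (M - card S)) :: int)"
    (is "?L = ?R")
proof -
  define T where "T i = {k. k < M \<and> (k < i \<longleftrightarrow> odd (g k - int k))}" for i
  \<comment> \<open>\<open>lo i\<close> and \<open>hi i\<close> are the exclusive bounds for the
    inserted entry. For \<open>i = 0\<close> the value \<open>- 1\<close> encodes nonnegativity, and
    for \<open>i = M\<close> there is no upper bound.\<close>
  define lo where "lo i = (if i = 0 then - 1 else g (i - 1) - of_bool (odd (g (i - 1) - int (i - 1))))" for i
  define hi where "hi i = g i - of_bool (even (g i - int i))" for i
  define \<alpha> where "\<alpha> i = (-1) ^ (i + card (T i)) * (of_bool (w = int (card (T i)) + lo i + 1) :: int)" for i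
  have T: "T i \<subseteq> {..<M}" "finite (T i)" for i by (auto simp: T_def)
  have pt: "even_exp (Suc M) (ins i (drop_set g S) m) \<longleftrightarrow> S = T i \<and> even (m - int i) \<and> lo i < m \<and> (i < M \<longrightarrow> m < hi i)"
    if "i \<le> M" "S \<subseteq> {..<M}" for i S m
  proof -
    have "0 \<le> m \<and> (0 < i \<longrightarrow> g (i - 1) - of_bool (odd (g (i - 1) - int (i - 1))) < m) \<longleftrightarrow> lo i < m"
    proof (cases "i = 0")
      case False
      have "0 \<le> g (i - 1)" using g(2) that False by auto
      moreover have "0 \<le> g (i - 1) - of_bool (odd (g (i - 1) - int (i - 1)))"
      proof (cases "g (i - 1) = 0")
        case True
        have "i - 1 = 0" proof (rule ccontr)
          assume "i - 1 \<noteq> 0" then have "g 0 < g (i - 1)" using incr_less[OF g(1), of 0 "i - 1"] that False by auto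
          then show False using g(2)[of 0] True that False by auto
        qed
        then show ?thesis using True by simp
      qed (use \<open>0 \<le> g (i - 1)\<close> in \<open>auto simp: of_bool_def\<close>)
      ultimately show ?thesis using False by (auto simp: lo_def)
    qed (auto simp: lo_def)
    moreover have "even_exp (Suc M) (ins i (drop_set g S) m) \<longleftrightarrow> S = T i \<and> even (m - int i) \<and> 0 \<le> m \<and>
       (0 < i \<longrightarrow> g (i - 1) - of_bool (odd (g (i - 1) - int (i - 1))) < m) \<and> (i < M \<longrightarrow> m < hi i)"
      unfolding T_def hi_def by (rule even_exp_ins[OF g that(2,1)])
    ultimately show ?thesis by blast
  qed
  have lohi: "lo i \<le> hi i" "even (lo i + 1 - int i)" "even (hi i + 1 - int i)" if "i < M" for i
  proof -
    show ev: "even (lo i + 1 - int i)" by (auto simp: lo_def)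
    show ev': "even (hi i + 1 - int i)" by (auto simp: hi_def)
    show "lo i \<le> hi i"
    proof (cases i)
      case 0 then show ?thesis using g(2)[of 0] that by (auto simp: lo_def hi_def)
    next
      case (Suc i')
      then have "g i' < g i" using incrD[OF g(1), of i'] that by simp
      then show ?thesis using Suc by (auto simp: lo_def hi_def)
    qed
  qed
  have ev: "even (lo i + 1 - int i)" for i by (auto simp: lo_def)
  have inner: "(\<Sum>S\<in>Pow {..<M}. \<Sum>\<epsilon><2. (-1) ^ (i + card S + \<epsilon>) *
      (of_bool (even_exp (Suc M) (ins i (drop_set g S) (w - int (card S) - 2 * int \<epsilon>))) :: int)) =
      \<alpha> i - (if i < M then \<alpha> (Suc i) else 0)" if i: "i \<le> M" for i
  proof -
    have "(\<Sum>S\<in>Pow {..<M}. \<Sum>\<epsilon><2. (-1) ^ (i + card S + \<epsilon>) *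
      (of_bool (even_exp (Suc M) (ins i (drop_set g S) (w - int (card S) - 2 * int \<epsilon>))) :: int)) =
      (\<Sum>S\<in>Pow {..<M}. if S = T i then \<Sum>\<epsilon><2. (-1) ^ (i + card (T i) + \<epsilon>) *
      of_bool (let m = w - int (card (T i)) - 2 * int \<epsilon> in even (m - int i) \<and> lo i < m \<and> (i < M \<longrightarrow> m < hi i)) else 0)"
      by (rule sum.cong) (auto simp: pt i Let_def)
    also have "\<dots> = (\<Sum>\<epsilon><2. (-1) ^ (i + card (T i) + \<epsilon>) *
      of_bool (let m = w - int (card (T i)) - 2 * int \<epsilon> in even (m - int i) \<and> lo i < m \<and> (i < M \<longrightarrow> m < hi i)))"
      using T by (subst sum.delta) auto
    \<comment> \<open>Admissible values of the inserted entry advance in steps of 2, and \<epsilon>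
      shifts by 2 with opposite sign. Only the first admissible value and the first one past the
      upper end are left.\<close>
    also have "\<dots> = (-1) ^ (i + card (T i)) * (of_bool (w - int (card (T i)) = lo i + 1) -
       of_bool (i < M \<and> w - int (card (T i)) = hi i + 1))"
    proof -
      define m where "m = w - int (card (T i))"
      have "of_bool (even (m - int i) \<and> lo i < m \<and> (i < M \<longrightarrow> m < hi i)) -
          of_bool (even (m - 2 - int i) \<and> lo i < m - 2 \<and> (i < M \<longrightarrow> m - 2 < hi i)) =
          (of_bool (m = lo i + 1) - of_bool (i < M \<and> m = hi i + 1) :: int)"
      proof (cases "even (m - int i)")
        case True
        then have p: "even (m - 2 - int i)" by simp
        have e1: "m \<noteq> lo i + 2" "m \<noteq> lo i" using True ev[of i] by auto
        show ?thesis
        proof (cases "i < M")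
          case True
          have e2: "m \<noteq> hi i" "m \<noteq> hi i + 2" using \<open>even (m - int i)\<close> lohi(3)[OF True] by auto
          show ?thesis using True \<open>even (m - int i)\<close> p e1 e2 lohi(1)[OF True] by (auto simp: of_bool_def)
        next
          case False
          show ?thesis using False \<open>even (m - int i)\<close> p e1 by (auto simp: of_bool_def)
        qed
      next
        case False
        then have "odd (m - 2 - int i)" by simp
        moreover have "m \<noteq> lo i + 1" using False ev[of i] by auto
        moreover have "\<not> (i < M \<and> m = hi i + 1)" using False lohi(3)[of i] by auto
        ultimately show ?thesis using False by auto
      qed
      moreover have two: "(\<Sum>\<epsilon><2. f \<epsilon>) = f 0 + f 1" for f :: "nat \<Rightarrow> int"
        by (simp add: numeral_2_eq_2)
      have "(\<Sum>\<epsilon><2. (-1) ^ (i + card (T i) + \<epsilon>) *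
          of_bool (let m = w - int (card (T i)) - 2 * int \<epsilon> in even (m - int i) \<and> lo i < m \<and> (i < M \<longrightarrow> m < hi i))) =
        (-1) ^ (i + card (T i)) * (of_bool (even (m - int i) \<and> lo i < m \<and> (i < M \<longrightarrow> m < hi i)) -
          of_bool (even (m - 2 - int i) \<and> lo i < m - 2 \<and> (i < M \<longrightarrow> m - 2 < hi i)) :: int)"
        unfolding two Let_def m_def right_diff_distrib by simp
      ultimately show ?thesis by (simp only: m_def)
    qed
    also have "\<dots> = \<alpha> i - (if i < M then \<alpha> (Suc i) else 0)"
    proof (cases "i < M")
      case True
      \<comment> \<open>\<open>T i\<close> and \<open>T (Suc i)\<close> differ exactly in the
        element \<open>i\<close>. This offsets the change of the sign and, at the same time, the
        difference between \<open>hi i\<close> and \<open>lo (Suc i)\<close>.\<close>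
      have "(-1) ^ (i + card (T i)) * (of_bool (w - int (card (T i)) = hi i + 1) :: int) = \<alpha> (Suc i)"
      proof (cases "odd (g i - int i)")
        case True
        then have "T (Suc i) = insert i (T i)" "i \<notin> T i" using \<open>i < M\<close> by (auto simp: T_def less_Suc_eq)
        then have "card (T (Suc i)) = Suc (card (T i))" using T by simp
        then show ?thesis using True by (auto simp: \<alpha>_def hi_def lo_def of_bool_def)
      next
        case False
        then have "T i = insert i (T (Suc i))" "i \<notin> T (Suc i)" using \<open>i < M\<close> by (auto simp: T_def less_Suc_eq)
        then have "card (T i) = Suc (card (T (Suc i)))" using T by simp
        then show ?thesis using False by (auto simp: \<alpha>_def hi_def lo_def of_bool_def)
      qed
      then show ?thesis using True by (simp add: \<alpha>_def algebra_simps)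
    next
      case False
      then show ?thesis by (simp add: \<alpha>_def algebra_simps)
    qed
    finally show ?thesis .
  qed
  have "?L = (\<Sum>i\<le>M. \<alpha> i - (if i < M then \<alpha> (Suc i) else 0))"
    by (rule sum.cong) (use inner in auto)
  also have "\<dots> = (\<Sum>i\<le>M. \<alpha> i) - (\<Sum>i<M. \<alpha> (Suc i))"
    by (simp add: sum_subtractf lessThan_Suc_atMost[symmetric])
  also have "\<dots> = \<alpha> 0"
    by (simp add: lessThan_Suc_atMost[symmetric] sum.lessThan_Suc_shift del: sum.lessThan_Suc)
  also have "\<alpha> 0 = ?R"
  proof -
    let ?U = "{k. k < M \<and> odd (g k - int k)}"
    have "?R = (\<Sum>S\<in>Pow {..<M}. if S = ?U then (-1) ^ (M - card ?U) * of_bool (w = int (M - card ?U)) else 0)"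
      by (rule sum.cong) (auto simp: even_exp_drop_set[OF g])
    also have "\<dots> = (-1) ^ (M - card ?U) * of_bool (w = int (M - card ?U))"
      by (subst sum.delta) auto
    also have "M - card ?U = card (T 0)"
    proof -
      have "T 0 = {..<M} - ?U" by (auto simp: T_def)
      then show ?thesis by (simp add: card_Diff_subset subset_iff)
    qed
    finally show ?thesis by (simp add: \<alpha>_def lo_def)
  qed
  finally show ?thesis .
qed

text \<open>Here \<open>k\<close> is the size of \<mu>. Fixing the values beyond \<open>N\<close>
  makes the sequence unique and the set finite.\<close>

definition even_exps :: "nat \<Rightarrow> int \<Rightarrow> (nat \<Rightarrow> int) set" where
  "even_exps N k = {e. even_exp N e \<and> (\<forall>i\<ge>N. e i = 0) \<and> (\<Sum>i<N. e i - int i) = 2 * k}"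

lemma even_exp_ge:
  assumes "even_exp N e" "i < N"
  shows "int i \<le> e i"
  using assms(2)
proof (induction i)
  case 0 then show ?case using assms(1) by (simp add: even_exp_def)
next
  case (Suc i)
  then have "e i < e (Suc i)" using assms(1) incrD by (auto simp: even_exp_def)
  then show ?case using Suc by simp
qed

lemma even_exps_le:
  assumes "e \<in> even_exps N k" "i < N"
  shows "0 \<le> e i" "e i \<le> 2 * k + (\<Sum>i<N. int i)"
proof -
  have ge: "0 \<le> e j" if "j < N" for j using assms(1) that by (auto simp: even_exps_def even_exp_def)
  then show "0 \<le> e i" using assms by simp
  have "e i \<le> (\<Sum>i<N. e i)" by (rule member_le_sum) (use assms(2) ge in auto)
  then show "e i \<le> 2 * k + (\<Sum>i<N. int i)"
    using assms(1) by (simp add: even_exps_def sum_subtractf)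
qed

lemma finite_bounded_funs: "finite {g :: nat \<Rightarrow> int. (\<forall>i\<ge>M. g i = 0) \<and> (\<forall>i<M. g i \<in> {0..B})}"
proof -
  have "finite {g. \<forall>i. (i \<in> {..<M} \<longrightarrow> g i \<in> {0..B}) \<and> (i \<notin> {..<M} \<longrightarrow> g i = 0)}"
    by (rule finite_set_of_finite_funs) auto
  then show ?thesis by (rule rev_finite_subset) auto
qed

lemma finite_even_exps: "finite (even_exps N k)"
proof -
  have "even_exps N k \<subseteq> {g. (\<forall>i\<ge>N. g i = 0) \<and> (\<forall>i<N. g i \<in> {0..2 * k + (\<Sum>i<N. int i)})}"
    using even_exps_le[of _ N k] by (auto simp: even_exps_def)
  then show ?thesis by (rule finite_subset) (rule finite_bounded_funs)
qed

lemma even_exps_negative: "k < 0 \<Longrightarrow> even_exps N k = {}"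
proof (rule ccontr)
  assume k: "k < 0" and "even_exps N k \<noteq> {}"
  then obtain e where e: "even_exp N e" "(\<Sum>i<N. e i - int i) = 2 * k" by (auto simp: even_exps_def)
  have "0 \<le> (\<Sum>i<N. e i - int i)" by (rule sum_nonneg) (use even_exp_ge[OF e(1)] in auto)
  then show False using e k by simp
qed

definition even_alternants :: "nat \<Rightarrow> (nat \<Rightarrow> nat \<Rightarrow> real) \<Rightarrow> laurent fps" where
  "even_alternants N z = Abs_fps (\<lambda>k. \<Sum>e\<in>even_exps N (int k). alternant N e z)"

lemma fps_const_prod: "(\<Prod>i\<in>A. fps_const (f i)) = fps_const (\<Prod>i\<in>A. f i)"
  for f :: "'b \<Rightarrow> 'a :: comm_ring_1"
  by (induction A rule: infinite_finite_induct) auto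

text \<open>Pieri rule for the elementary symmetric polynomials. The weight \<phi> depends on the
  cardinality only, so the multiplier is symmetric, and in each term of the determinant its subsets
  may be permuted along with the variables.\<close>

lemma alternant_mult_elementary:
  "(\<Sum>S\<in>Pow {..<M}. \<phi> (card S) * (\<Prod>b\<in>S. pw (y b) 1)) * alternant M g y =
   (\<Sum>S\<in>Pow {..<M}. \<phi> (card S) * alternant M (\<lambda>i. g i + of_bool (i \<in> S)) y)"
proof -
  have *: "(\<Sum>S\<in>Pow {..<M}. \<phi> (card S) * (\<Prod>b\<in>S. pw (y b) 1)) * (\<Prod>i<M. pw (y (p i)) (g i)) =
    (\<Sum>S\<in>Pow {..<M}. \<phi> (card S) * (\<Prod>i<M. pw (y (p i)) (g i + of_bool (i \<in> S))))" if p: "p permutes {0..<M}" for p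
  proof -
    have p': "bij_betw p {..<M} {..<M}" using permutes_imp_bij[OF p] by (simp add: atLeast0LessThan)
    have inj: "inj_on p S" if "S \<subseteq> {..<M}" for S using p' that by (auto simp: bij_betw_def intro: inj_on_subset)
    have "(\<Sum>S\<in>Pow {..<M}. \<phi> (card S) * (\<Prod>b\<in>S. pw (y b) 1)) =
       (\<Sum>S\<in>Pow {..<M}. \<phi> (card (p ` S)) * (\<Prod>b\<in>p ` S. pw (y b) 1))"
      by (rule sum.reindex_bij_betw[symmetric]) (rule bij_betw_Pow[OF p'])
    also have "\<dots> = (\<Sum>S\<in>Pow {..<M}. \<phi> (card S) * (\<Prod>i\<in>S. pw (y (p i)) 1))"
      by (rule sum.cong) (use inj in \<open>auto simp: card_image prod.reindex\<close>)
    finally have 1: "(\<Sum>S\<in>Pow {..<M}. \<phi> (card S) * (\<Prod>b\<in>S. pw (y b) 1)) = \<dots>" .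
    have 2: "(\<Prod>i\<in>S. pw (y (p i)) 1) * (\<Prod>i<M. pw (y (p i)) (g i)) = (\<Prod>i<M. pw (y (p i)) (g i + of_bool (i \<in> S)))"
      if "S \<subseteq> {..<M}" for S
    proof -
      have "(\<Prod>i\<in>S. pw (y (p i)) 1) = (\<Prod>i<M. pw (y (p i)) (of_bool (i \<in> S)))"
        by (rule prod.mono_neutral_cong_left) (use that in auto)
      then show ?thesis by (simp add: pw_add prod.distrib mult.commute)
    qed
    show ?thesis unfolding 1 sum_distrib_right
      by (rule sum.cong) (use 2 in \<open>auto simp: mult.assoc\<close>)
  qed
  have "(\<Sum>S\<in>Pow {..<M}. \<phi> (card S) * (\<Prod>b\<in>S. pw (y b) 1)) * alternant M g y =
     (\<Sum>p | p permutes {0..<M}. of_int (sign p) * ((\<Sum>S\<in>Pow {..<M}. \<phi> (card S) * (\<Prod>b\<in>S. pw (y b) 1)) * (\<Prod>i<M. pw (y (p i)) (g i))))"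
    unfolding alternant_def det_mat_sum by (simp add: sum_distrib_left mult_ac)
  also have "\<dots> = (\<Sum>p | p permutes {0..<M}. of_int (sign p) * (\<Sum>S\<in>Pow {..<M}. \<phi> (card S) * (\<Prod>i<M. pw (y (p i)) (g i + of_bool (i \<in> S)))))"
    by (rule sum.cong) (use * in auto)
  also have "\<dots> = (\<Sum>p | p permutes {0..<M}. \<Sum>S\<in>Pow {..<M}. \<phi> (card S) * (of_int (sign p) * (\<Prod>i<M. pw (y (p i)) (g i + of_bool (i \<in> S)))))"
    by (simp only: sum_distrib_left mult_ac)
  also have "\<dots> = (\<Sum>S\<in>Pow {..<M}. \<Sum>p | p permutes {0..<M}. \<phi> (card S) * (of_int (sign p) * (\<Prod>i<M. pw (y (p i)) (g i + of_bool (i \<in> S)))))"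
    by (rule sum.swap)
  also have "\<dots> = (\<Sum>S\<in>Pow {..<M}. \<phi> (card S) * alternant M (\<lambda>i. g i + of_bool (i \<in> S)) y)"
    unfolding alternant_def det_mat_sum by (simp add: sum_distrib_left)
  finally show ?thesis .
qed

lemma sum_skip:
  fixes f :: "nat \<Rightarrow> 'a :: comm_monoid_add"
  assumes "i \<le> M"
  shows "(\<Sum>j<Suc M. f j) = f i + (\<Sum>q<M. f (skip i q))"
proof -
  have "{..<Suc M} = insert i (skip i ` {..<M})"
    using insert_index_image[of i M] assms by (auto simp: atLeast0LessThan)
  moreover have "i \<notin> skip i ` {..<M}" by (auto simp: insert_index_def split: if_splits)
  moreover have "inj_on (skip i) {..<M}" by (rule insert_index_inj_on)
  ultimately show ?thesis by (simp add: sum.reindex comp_def)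
qed

lemma ins_skip: "ins i h m (skip i q) = h q"
  by (auto simp: ins_def insert_index_def)

lemma card_of_bool_sum:
  fixes M :: nat
  assumes "S \<subseteq> {..<M}"
  shows "(\<Sum>q<M. of_bool (q \<in> S)) = int (card S)"
proof -
  have "{..<M} \<inter> {q. q \<in> S} = S" using assms by auto
  then show ?thesis by simp
qed

text \<open>The total degree is fixed, so the exponent \<open>w\<close> of the split-off variable is
  determined by the remaining exponents \<open>g\<close>, and \<open>e\<close> is recovered from
  \<open>g\<close>, \<open>S\<close> and \<epsilon> by dropping and inserting. The finite box
  \<open>G\<close> contains every \<open>g\<close> that occurs and no longer depends on
  \<open>S\<close>, \<open>i\<close> and \<epsilon>, which allows the sums to be exchanged.\<close>

lemma even_exps_reindex:
  fixes k M :: nat and H :: "int \<Rightarrow> (nat \<Rightarrow> int) \<Rightarrow> 'a :: comm_ring_1"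
  defines "C \<equiv> (\<Sum>i<Suc M. int i)"
  defines "G \<equiv> {g. (\<forall>i\<ge>M. g i = 0) \<and> (\<forall>i<M. g i \<in> {0..2 * int k + C})}"
  defines "w \<equiv> \<lambda>g. 2 * int k + C - (\<Sum>i<M. g i)"
  assumes S: "S \<subseteq> {..<M}" and i: "i \<le> M"
  shows "(\<Sum>e\<in>even_exps (Suc M) (int k - int (card S) - int \<epsilon>).
      H (e i + int (card S) + 2 * int \<epsilon>) (\<lambda>q. e (skip i q) + of_bool (q \<in> S))) =
    (\<Sum>g\<in>G. of_bool (even_exp (Suc M) (ins i (drop_set g S) (w g - int (card S) - 2 * int \<epsilon>))) * H (w g) g)"
proof -
  let ?m = "\<lambda>g. w g - int (card S) - 2 * int \<epsilon>"
  let ?G = "{g\<in>G. even_exp (Suc M) (ins i (drop_set g S) (?m g))}"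
  have fG: "finite G" unfolding G_def by (rule finite_bounded_funs)
  have sumw: "w (\<lambda>q. e (skip i q) + of_bool (q \<in> S)) = e i + int (card S) + 2 * int \<epsilon>"
    if "e \<in> even_exps (Suc M) (int k - int (card S) - int \<epsilon>)" for e
  proof -
    have "(\<Sum>i<Suc M. e i) = C + 2 * (int k - int (card S) - int \<epsilon>)"
      using that by (simp add: even_exps_def C_def sum_subtractf del: sum.lessThan_Suc)
    then show ?thesis unfolding w_def sum.distrib card_of_bool_sum[OF S] using sum_skip[OF i, of e] by simp
  qed
  have inse: "ins i (drop_set (\<lambda>q. e (skip i q) + of_bool (q \<in> S)) S) (e i) = e" for e
  proof
    fix j show "ins i (drop_set (\<lambda>q. e (skip i q) + of_bool (q \<in> S)) S) (e i) j = e j"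
      by (auto simp: ins_def drop_set_def insert_index_def)
  qed
  have "(\<Sum>e\<in>even_exps (Suc M) (int k - int (card S) - int \<epsilon>).
      H (e i + int (card S) + 2 * int \<epsilon>) (\<lambda>q. e (skip i q) + of_bool (q \<in> S))) = (\<Sum>g\<in>?G. H (w g) g)"
  proof (rule sum.reindex_bij_witness[where j = "\<lambda>e q. e (skip i q) + of_bool (q \<in> S)" and i = "\<lambda>g. ins i (drop_set g S) (?m g)"])
    fix e assume e: "e \<in> even_exps (Suc M) (int k - int (card S) - int \<epsilon>)"
    let ?g = "\<lambda>q. e (skip i q) + of_bool (q \<in> S)"
    have m: "?m ?g = e i" using sumw[OF e] by simp
    show "ins i (drop_set ?g S) (?m ?g) = e" unfolding m by (rule inse)
    have "?g \<in> G"
      unfolding G_def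
    proof (intro CollectI conjI allI impI)
      fix q assume "M \<le> q"
      then show "?g q = 0" using e S i by (auto simp: even_exps_def insert_index_def)
    next
      fix q assume "q < M"
      then have "skip i q < Suc M" by (auto simp: insert_index_def)
      from even_exps_le[OF e this] have b: "0 \<le> e (skip i q)" "e (skip i q) \<le> 2 * (int k - int (card S) - int \<epsilon>) + C"
        by (auto simp: C_def)
      moreover have "q \<in> S \<Longrightarrow> 1 \<le> card S"
        using S finite_subset[OF S] by (metis One_nat_def Suc_leI card_gt_0_iff empty_iff finite_lessThan)
      ultimately show "?g q \<in> {0..2 * int k + C}" by (cases "q \<in> S") auto
    qed
    moreover have "even_exp (Suc M) (ins i (drop_set ?g S) (?m ?g))"
      unfolding m inse using e by (simp add: even_exps_def)
    ultimately show "?g \<in> ?G" by blast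
    show "H (w ?g) ?g = H (e i + int (card S) + 2 * int \<epsilon>) ?g" unfolding sumw[OF e] ..
  next
    fix g assume g: "g \<in> ?G"
    let ?e = "ins i (drop_set g S) (?m g)"
    show "(\<lambda>q. ?e (skip i q) + of_bool (q \<in> S)) = g"
      by (simp add: ins_skip drop_set_def)
    show "?e \<in> even_exps (Suc M) (int k - int (card S) - int \<epsilon>)"
      unfolding even_exps_def
    proof (intro CollectI conjI allI impI)
      show "even_exp (Suc M) ?e" using g by simp
      fix j assume "Suc M \<le> j"
      then show "?e j = 0" using g S i by (auto simp: ins_def drop_set_def G_def)
    next
      have "(\<Sum>j<Suc M. ?e j) = ?m g + (\<Sum>q<M. drop_set g S q)"
        unfolding sum_skip[OF i, of ?e] ins_skip by (simp add: ins_def)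
      also have "(\<Sum>q<M. drop_set g S q) = (\<Sum>q<M. g q) - int (card S)"
        unfolding drop_set_def sum_subtractf card_of_bool_sum[OF S] ..
      finally show "(\<Sum>i<Suc M. ?e i - int i) = 2 * (int k - int (card S) - int \<epsilon>)"
        unfolding sum_subtractf by (simp add: w_def C_def)
    qed
  qed
  also have "\<dots> = (\<Sum>g\<in>G. of_bool (even_exp (Suc M) (ins i (drop_set g S) (?m g))) * H (w g) g)"
    using fG by (intro sum.mono_neutral_cong_left) auto
  finally show ?thesis .
qed

lemma even_exps_reindex':
  fixes k M :: nat and H :: "int \<Rightarrow> (nat \<Rightarrow> int) \<Rightarrow> 'a :: comm_ring_1"
  defines "C \<equiv> (\<Sum>i<Suc M. int i)"
  defines "G \<equiv> {g. (\<forall>i\<ge>M. g i = 0) \<and> (\<forall>i<M. g i \<in> {0..2 * int k + C})}"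
  defines "w \<equiv> \<lambda>g. 2 * int k + C - (\<Sum>i<M. g i)"
  assumes S: "S \<subseteq> {..<M}"
  shows "(\<Sum>e\<in>even_exps M (int k). H (int (M - card S)) (\<lambda>q. e q + of_bool (q \<in> S))) =
    (\<Sum>g\<in>G. of_bool (even_exp M (drop_set g S) \<and> w g = int (M - card S)) * H (w g) g)"
proof -
  let ?G = "{g\<in>G. even_exp M (drop_set g S) \<and> w g = int (M - card S)}"
  have fG: "finite G" unfolding G_def by (rule finite_bounded_funs)
  have cS: "card S \<le> M" using card_mono[OF _ S] by simp
  have C: "C = (\<Sum>i<M. int i) + int M" by (simp add: C_def)
  have dr: "drop_set (\<lambda>q. e q + of_bool (q \<in> S)) S = e" for e
    by (auto simp: drop_set_def)
  have sumw: "w (\<lambda>q. e q + of_bool (q \<in> S)) = int (M - card S)" if "e \<in> even_exps M (int k)" for e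
  proof -
    have "(\<Sum>i<M. e i) = (\<Sum>i<M. int i) + 2 * int k"
      using that by (simp add: even_exps_def sum_subtractf)
    then show ?thesis unfolding w_def sum.distrib card_of_bool_sum[OF S] using C cS by simp
  qed
  have "(\<Sum>e\<in>even_exps M (int k). H (int (M - card S)) (\<lambda>q. e q + of_bool (q \<in> S))) = (\<Sum>g\<in>?G. H (w g) g)"
  proof (rule sum.reindex_bij_witness[where j = "\<lambda>e q. e q + of_bool (q \<in> S)" and i = "\<lambda>g. drop_set g S"])
    fix e assume e: "e \<in> even_exps M (int k)"
    let ?g = "\<lambda>q. e q + of_bool (q \<in> S)"
    show "drop_set ?g S = e" by (rule dr)
    have "?g \<in> G"
      unfolding G_def
    proof (intro CollectI conjI allI impI)
      fix q assume "M \<le> q"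
      then show "?g q = 0" using e S by (auto simp: even_exps_def)
    next
      fix q assume q: "q < M"
      from even_exps_le[OF e this] show "?g q \<in> {0..2 * int k + C}" using C q by (cases "q \<in> S") auto
    qed
    then show "?g \<in> ?G" using e sumw[OF e] by (simp add: dr even_exps_def)
    show "H (w ?g) ?g = H (int (M - card S)) ?g" unfolding sumw[OF e] ..
  next
    fix g assume g: "g \<in> ?G"
    show "(\<lambda>q. drop_set g S q + of_bool (q \<in> S)) = g"
      by (simp add: drop_set_def)
    show "drop_set g S \<in> even_exps M (int k)"
      unfolding even_exps_def
    proof (intro CollectI conjI allI impI)
      show "even_exp M (drop_set g S)" using g by simp
      fix j assume "M \<le> j"
      then show "drop_set g S j = 0" using g S by (auto simp: drop_set_def G_def)
    next
      have "(\<Sum>q<M. drop_set g S q) = (\<Sum>q<M. g q) - int (card S)"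
        unfolding drop_set_def sum_subtractf card_of_bool_sum[OF S] ..
      moreover have "w g = int (M - card S)" using g by simp
      ultimately show "(\<Sum>i<M. drop_set g S i - int i) = 2 * int k"
        unfolding sum_subtractf using C cS by (simp add: w_def)
    qed
  qed
  also have "\<dots> = (\<Sum>g\<in>G. of_bool (even_exp M (drop_set g S) \<and> w g = int (M - card S)) * H (w g) g)"
    using fG by (intro sum.mono_neutral_cong_left) auto
  finally show ?thesis .
qed

lemma even_exp_ins_imp_le:
  assumes "even_exp (Suc M) (ins i (drop_set g S) m)" "i \<le> M" "Suc q < M"
  shows "g q \<le> g (Suc q)"
proof -
  have "ins i (drop_set g S) m (skip i q) < ins i (drop_set g S) m (skip i (Suc q))"
    by (rule incr_less) (use assms in \<open>auto simp: even_exp_def insert_index_def\<close>)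
  then show ?thesis unfolding ins_skip by (auto simp: drop_set_def of_bool_def split: if_splits)
qed

text \<open>With \<open>x = z 0\<close> and \<open>y\<close> the other variables, both sides are
  expanded in the products \<open>x^w a_g(y)\<close>. On the left, \<epsilon> comes from the factor
  with the square of \<open>x\<close>, \<open>S\<close> from the product over \<open>b\<close>, and
  \<open>i\<close> from expanding the alternant along its first column; on the right,
  \<open>S\<close> comes from the product of the differences. The Pieri rule absorbs the monomials
  in \<open>y\<close> into \<open>g\<close>, and \<open>even_exp_signed_count\<close> equates the
  integer coefficients.\<close>

lemma even_alternants_step:
  "(1 - fps_X * fps_const (pw (z 0) 2)) * (\<Prod>b<M. 1 - fps_X * fps_const (pw (z 0) 1 * pw (z (Suc b)) 1)) *
     even_alternants (Suc M) z =
   fps_const (\<Prod>b<M. pw (z (Suc b)) 1 - pw (z 0) 1) * even_alternants M (z \<circ> Suc)"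
proof (rule fps_ext)
  fix k
  let ?x = "z 0" and ?y = "z \<circ> Suc"
  define C where "C = (\<Sum>i<Suc M. int i)"
  define G where "G = {g. (\<forall>i\<ge>M. g i = 0) \<and> (\<forall>i<M. g i \<in> {0..2 * int k + C})}"
  define w where "w = (\<lambda>g. 2 * int k + C - (\<Sum>i<M. g i))"
  define P where "P S = (\<Prod>b\<in>S. pw (?y b) 1)" for S
  define E where "E j = (\<Sum>e\<in>even_exps (Suc M) j. alternant (Suc M) e z)" for j
  have "(\<Prod>b<M. 1 - fps_X * fps_const (pw ?x 1 * pw (z (Suc b)) 1)) =
      (\<Prod>b<M. - fps_X * fps_const (pw ?x 1 * pw (?y b) 1) + 1)"
    by simp
  also have "\<dots> = (\<Sum>S\<in>Pow {..<M}. \<Prod>b\<in>S. - fps_X * fps_const (pw ?x 1 * pw (?y b) 1))"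
    by (subst prod_add) auto
  also have "\<dots> = (\<Sum>S\<in>Pow {..<M}. fps_const ((-1) ^ card S * pw ?x (int (card S)) * P S) * fps_X ^ card S)"
  proof (rule sum.cong)
    fix S assume "S \<in> Pow {..<M}"
    have "(\<Prod>b\<in>S. - fps_X * fps_const (pw ?x 1 * pw (?y b) 1)) = (\<Prod>b\<in>S. (fps_const (- pw ?x 1) * fps_X) * fps_const (pw (?y b) 1))"
      by (rule prod.cong) (auto simp: fps_const_mult[symmetric] fps_const_neg[symmetric] mult_ac simp del: fps_const_mult fps_const_neg)
    also have "\<dots> = fps_const ((- pw ?x 1) ^ card S) * fps_X ^ card S * fps_const (P S)"
      by (simp add: prod.distrib power_mult_distrib fps_const_power P_def fps_const_prod)
    also have "(- pw ?x 1) ^ card S = (-1) ^ card S * pw ?x (int (card S))"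
      by (subst power_minus) (simp add: pw_power)
    finally show "(\<Prod>b\<in>S. - fps_X * fps_const (pw ?x 1 * pw (?y b) 1)) =
        fps_const ((-1) ^ card S * pw ?x (int (card S)) * P S) * fps_X ^ card S"
      by (simp only: fps_const_mult[symmetric] mult_ac)
  qed simp
  finally have prod1: "(\<Prod>b<M. 1 - fps_X * fps_const (pw ?x 1 * pw (z (Suc b)) 1)) = \<dots>" .
  have prod2: "(1 - fps_X * fps_const (pw ?x 2)) * (fps_const (a * pw ?x c * p) * fps_X ^ s) =
      (\<Sum>\<epsilon><2. fps_const ((-1) ^ \<epsilon> * a * pw ?x (c + 2 * int \<epsilon>) * p) * fps_X ^ (s + \<epsilon>))" for a c p s
  proof -
    have "fps_const (pw ?x 2) * fps_const (a * pw ?x c * p) = fps_const (a * pw ?x (c + 2) * p)"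
      by (simp add: pw_add mult_ac)
    then have "(1 - fps_X * fps_const (pw ?x 2)) * (fps_const (a * pw ?x c * p) * fps_X ^ s) =
        fps_const (a * pw ?x c * p) * fps_X ^ s - fps_X * fps_const (a * pw ?x (c + 2) * p) * fps_X ^ s"
      by (simp only: left_diff_distrib mult_1 mult.assoc) (simp only: mult.assoc[symmetric])
    also have "\<dots> = fps_const (a * pw ?x c * p) * fps_X ^ s + fps_const (- (a * pw ?x (c + 2) * p)) * fps_X ^ Suc s"
      by (simp add: fps_const_neg[symmetric] mult_ac del: fps_const_neg)
    also have "\<dots> = (\<Sum>\<epsilon><2. fps_const ((-1) ^ \<epsilon> * a * pw ?x (c + 2 * int \<epsilon>) * p) * fps_X ^ (s + \<epsilon>))"
      by (simp add: numeral_2_eq_2)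
    finally show ?thesis .
  qed
  have coef: "fps_nth (fps_const c * fps_X ^ s * even_alternants (Suc M) z) k = c * E (int k - int s)" for c s
  proof (cases "k < s")
    case True
    then have "E (int k - int s) = 0" by (simp add: E_def even_exps_negative)
    then show ?thesis using True by (simp add: mult.assoc fps_X_power_mult_nth)
  next
    case False
    then have "int k - int s = int (k - s)" by simp
    then show ?thesis using False by (simp add: mult.assoc fps_X_power_mult_nth even_alternants_def E_def)
  qed
  have "fps_nth ((1 - fps_X * fps_const (pw ?x 2)) * (\<Prod>b<M. 1 - fps_X * fps_const (pw ?x 1 * pw (z (Suc b)) 1)) *
     even_alternants (Suc M) z) k =
     (\<Sum>S\<in>Pow {..<M}. \<Sum>\<epsilon><2. (-1) ^ \<epsilon> * (-1) ^ card S * pw ?x (int (card S) + 2 * int \<epsilon>) * P S * E (int k - int (card S + \<epsilon>)))"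
    unfolding prod1 sum_distrib_left prod2 sum_distrib_right fps_sum_nth coef by (simp add: mult_ac)
  also have "\<dots> = (\<Sum>S\<in>Pow {..<M}. \<Sum>\<epsilon><2. \<Sum>e\<in>even_exps (Suc M) (int k - int (card S) - int \<epsilon>). \<Sum>i\<le>M.
      (-1) ^ (i + card S + \<epsilon>) * pw ?x (e i + int (card S) + 2 * int \<epsilon>) * (P S * alternant M (e \<circ> skip i) ?y))"
  proof (intro sum.cong refl)
    fix S \<epsilon>
    have alt: "alternant (Suc M) e z = (\<Sum>i\<le>M. (-1) ^ i * pw ?x (e i) * alternant M (e \<circ> skip i) ?y)" for e
    proof -
      have "z \<circ> skip 0 = ?y" by (simp add: fun_eq_iff)
      then show ?thesis by (subst alternant_column[of 0]) (simp_all add: lessThan_Suc_atMost)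
    qed
    show "(-1) ^ \<epsilon> * (-1) ^ card S * pw ?x (int (card S) + 2 * int \<epsilon>) * P S * E (int k - int (card S + \<epsilon>)) =
     (\<Sum>e\<in>even_exps (Suc M) (int k - int (card S) - int \<epsilon>). \<Sum>i\<le>M.
      (-1) ^ (i + card S + \<epsilon>) * pw ?x (e i + int (card S) + 2 * int \<epsilon>) * (P S * alternant M (e \<circ> skip i) ?y))"
      unfolding E_def alt sum_distrib_left of_nat_add diff_diff_eq
      by (intro sum.cong refl) (simp add: pw_add power_add mult_ac)
  qed
  also have "\<dots> = (\<Sum>\<epsilon><2. \<Sum>i\<le>M. \<Sum>S\<in>Pow {..<M}. \<Sum>e\<in>even_exps (Suc M) (int k - int (card S) - int \<epsilon>).
      (-1) ^ (i + card S + \<epsilon>) * pw ?x (e i + int (card S) + 2 * int \<epsilon>) * (P S * alternant M (e \<circ> skip i) ?y))"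
  proof -
    have "(\<Sum>S\<in>A. \<Sum>\<epsilon>\<in>B. \<Sum>e\<in>D S \<epsilon>. \<Sum>i\<in>I. f S \<epsilon> e i) = (\<Sum>\<epsilon>\<in>B. \<Sum>i\<in>I. \<Sum>S\<in>A. \<Sum>e\<in>D S \<epsilon>. f S \<epsilon> e i)"
      for A :: "nat set set" and B :: "nat set" and D :: "nat set \<Rightarrow> nat \<Rightarrow> (nat \<Rightarrow> int) set" and I :: "nat set" and f :: "_ \<Rightarrow> _ \<Rightarrow> _ \<Rightarrow> _ \<Rightarrow> laurent"
    proof -
      have "(\<Sum>S\<in>A. \<Sum>\<epsilon>\<in>B. \<Sum>e\<in>D S \<epsilon>. \<Sum>i\<in>I. f S \<epsilon> e i) = (\<Sum>\<epsilon>\<in>B. \<Sum>S\<in>A. \<Sum>e\<in>D S \<epsilon>. \<Sum>i\<in>I. f S \<epsilon> e i)"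
        by (rule sum.swap)
      also have "\<dots> = (\<Sum>\<epsilon>\<in>B. \<Sum>S\<in>A. \<Sum>i\<in>I. \<Sum>e\<in>D S \<epsilon>. f S \<epsilon> e i)"
        by (intro sum.cong refl) (rule sum.swap)
      also have "\<dots> = (\<Sum>\<epsilon>\<in>B. \<Sum>i\<in>I. \<Sum>S\<in>A. \<Sum>e\<in>D S \<epsilon>. f S \<epsilon> e i)"
        by (intro sum.cong refl) (rule sum.swap)
      finally show ?thesis .
    qed
    then show ?thesis .
  qed
  also have "\<dots> = (\<Sum>\<epsilon><2. \<Sum>i\<le>M. \<Sum>S\<in>Pow {..<M}. \<Sum>e\<in>even_exps (Suc M) (int k - int (card S) - int \<epsilon>).
      (-1) ^ (i + card S + \<epsilon>) * (pw ?x (e i + int (card S) + 2 * int \<epsilon>) * alternant M (\<lambda>q. e (skip i q) + of_bool (q \<in> S)) ?y))"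
  proof (rule sum.cong[OF refl], rule sum.cong[OF refl])
    fix \<epsilon> i :: nat
    \<comment> \<open>The range of \<open>e\<close> depends on \<open>S\<close>, but only through
      its cardinality. Taking the union of these ranges and moving membership into the weight \<phi>
      makes the Pieri rule applicable for each fixed \<open>e\<close>.\<close>
    define EE where "EE = (\<Union>s\<le>M. even_exps (Suc M) (int k - int s - int \<epsilon>))"
    have fEE: "finite EE" unfolding EE_def by (intro finite_UN_I finite_even_exps) auto
    define \<phi> where "\<phi> e s = of_bool (e \<in> even_exps (Suc M) (int k - int s - int \<epsilon>)) *
       ((-1) ^ (i + s + \<epsilon>) * pw ?x (e i + int s + 2 * int \<epsilon>))" for e s
    have cl: "(\<Sum>e\<in>even_exps (Suc M) (int k - int (card S) - int \<epsilon>). (-1) ^ (i + card S + \<epsilon>) * pw ?x (e i + int (card S) + 2 * int \<epsilon>) * F e) =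
        (\<Sum>e\<in>EE. \<phi> e (card S) * F e)" if "S \<in> Pow {..<M}" for S F
    proof -
      have "card S \<le> M" using that card_mono[of "{..<M}" S] by auto
      then show ?thesis using fEE by (intro sum.mono_neutral_cong_left) (auto simp: \<phi>_def EE_def)
    qed
    have "(\<Sum>S\<in>Pow {..<M}. \<Sum>e\<in>even_exps (Suc M) (int k - int (card S) - int \<epsilon>).
      (-1) ^ (i + card S + \<epsilon>) * pw ?x (e i + int (card S) + 2 * int \<epsilon>) * (P S * alternant M (e \<circ> skip i) ?y)) =
      (\<Sum>S\<in>Pow {..<M}. \<Sum>e\<in>EE. \<phi> e (card S) * (P S * alternant M (e \<circ> skip i) ?y))"
      by (rule sum.cong) (use cl in auto)
    also have "\<dots> = (\<Sum>e\<in>EE. (\<Sum>S\<in>Pow {..<M}. \<phi> e (card S) * P S) * alternant M (e \<circ> skip i) ?y)"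
      by (subst sum.swap) (simp add: sum_distrib_right mult.assoc)
    also have "\<dots> = (\<Sum>e\<in>EE. \<Sum>S\<in>Pow {..<M}. \<phi> e (card S) * alternant M (\<lambda>q. (e \<circ> skip i) q + of_bool (q \<in> S)) ?y)"
      unfolding P_def alternant_mult_elementary ..
    also have "\<dots> = (\<Sum>S\<in>Pow {..<M}. \<Sum>e\<in>EE. \<phi> e (card S) * alternant M (\<lambda>q. e (skip i q) + of_bool (q \<in> S)) ?y)"
      by (subst sum.swap) simp
    also have "\<dots> = (\<Sum>S\<in>Pow {..<M}. \<Sum>e\<in>even_exps (Suc M) (int k - int (card S) - int \<epsilon>).
      (-1) ^ (i + card S + \<epsilon>) * pw ?x (e i + int (card S) + 2 * int \<epsilon>) * alternant M (\<lambda>q. e (skip i q) + of_bool (q \<in> S)) ?y)"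
      by (rule sum.cong) (use cl in auto)
    finally show "(\<Sum>S\<in>Pow {..<M}. \<Sum>e\<in>even_exps (Suc M) (int k - int (card S) - int \<epsilon>).
      (-1) ^ (i + card S + \<epsilon>) * pw ?x (e i + int (card S) + 2 * int \<epsilon>) * (P S * alternant M (e \<circ> skip i) ?y)) =
      (\<Sum>S\<in>Pow {..<M}. \<Sum>e\<in>even_exps (Suc M) (int k - int (card S) - int \<epsilon>).
      (-1) ^ (i + card S + \<epsilon>) * (pw ?x (e i + int (card S) + 2 * int \<epsilon>) * alternant M (\<lambda>q. e (skip i q) + of_bool (q \<in> S)) ?y))"
      by (simp only: mult.assoc)
  qed
  also have "\<dots> = (\<Sum>\<epsilon><2. \<Sum>i\<le>M. \<Sum>S\<in>Pow {..<M}. \<Sum>g\<in>G.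
      of_bool (even_exp (Suc M) (ins i (drop_set g S) (w g - int (card S) - 2 * int \<epsilon>))) *
      ((-1) ^ (i + card S + \<epsilon>) * (pw ?x (w g) * alternant M g ?y)))"
    unfolding G_def w_def C_def
    by (rule sum.cong[OF refl], rule sum.cong[OF refl], rule sum.cong[OF refl], rule even_exps_reindex[where H = "\<lambda>w g. (-1) ^ _ * (pw ?x w * alternant M g ?y)"]) auto
  also have "\<dots> = (\<Sum>g\<in>G. of_int (\<Sum>i\<le>M. \<Sum>S\<in>Pow {..<M}. \<Sum>\<epsilon><2. (-1) ^ (i + card S + \<epsilon>) *
      of_bool (even_exp (Suc M) (ins i (drop_set g S) (w g - int (card S) - 2 * int \<epsilon>)))) * (pw ?x (w g) * alternant M g ?y))"
  proof -
    have "(\<Sum>\<epsilon>\<in>B. \<Sum>i\<in>I. \<Sum>S\<in>A. \<Sum>g\<in>G. c g S \<epsilon> i * (d i S \<epsilon> * F g)) =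
       (\<Sum>g\<in>G. (\<Sum>i\<in>I. \<Sum>S\<in>A. \<Sum>\<epsilon>\<in>B. d i S \<epsilon> * c g S \<epsilon> i) * F g)"
      for A :: "nat set set" and B I :: "nat set" and c d and F :: "_ \<Rightarrow> laurent"
    proof -
      have "(\<Sum>\<epsilon>\<in>B. \<Sum>i\<in>I. \<Sum>S\<in>A. \<Sum>g\<in>G. c g S \<epsilon> i * (d i S \<epsilon> * F g)) = (\<Sum>i\<in>I. \<Sum>\<epsilon>\<in>B. \<Sum>S\<in>A. \<Sum>g\<in>G. c g S \<epsilon> i * (d i S \<epsilon> * F g))"
        by (rule sum.swap)
      also have "\<dots> = (\<Sum>i\<in>I. \<Sum>S\<in>A. \<Sum>\<epsilon>\<in>B. \<Sum>g\<in>G. c g S \<epsilon> i * (d i S \<epsilon> * F g))"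
        by (intro sum.cong refl) (rule sum.swap)
      also have "\<dots> = (\<Sum>i\<in>I. \<Sum>S\<in>A. \<Sum>g\<in>G. \<Sum>\<epsilon>\<in>B. c g S \<epsilon> i * (d i S \<epsilon> * F g))"
        by (intro sum.cong refl) (rule sum.swap)
      also have "\<dots> = (\<Sum>i\<in>I. \<Sum>g\<in>G. \<Sum>S\<in>A. \<Sum>\<epsilon>\<in>B. c g S \<epsilon> i * (d i S \<epsilon> * F g))"
        by (intro sum.cong refl) (rule sum.swap)
      also have "\<dots> = (\<Sum>g\<in>G. \<Sum>i\<in>I. \<Sum>S\<in>A. \<Sum>\<epsilon>\<in>B. c g S \<epsilon> i * (d i S \<epsilon> * F g))"
        by (rule sum.swap)
      finally have "(\<Sum>\<epsilon>\<in>B. \<Sum>i\<in>I. \<Sum>S\<in>A. \<Sum>g\<in>G. c g S \<epsilon> i * (d i S \<epsilon> * F g)) = \<dots>" .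
      then show ?thesis unfolding sum_distrib_right by (simp only: mult_ac)
    qed
    then show ?thesis by (simp only: of_int_sum of_int_mult of_int_power of_int_minus of_int_1 of_int_of_bool)
  qed
  also have "\<dots> = (\<Sum>g\<in>G. of_int (\<Sum>S\<in>Pow {..<M}. (-1) ^ (M - card S) * of_bool (even_exp M (drop_set g S) \<and> w g = int (M - card S))) *
      (pw ?x (w g) * alternant M g ?y))"
  proof (rule sum.cong)
    fix g assume g: "g \<in> G"
    show "of_int (\<Sum>i\<le>M. \<Sum>S\<in>Pow {..<M}. \<Sum>\<epsilon><2. (-1) ^ (i + card S + \<epsilon>) *
      of_bool (even_exp (Suc M) (ins i (drop_set g S) (w g - int (card S) - 2 * int \<epsilon>)))) * (pw ?x (w g) * alternant M g ?y) =
      of_int (\<Sum>S\<in>Pow {..<M}. (-1) ^ (M - card S) * of_bool (even_exp M (drop_set g S) \<and> w g = int (M - card S))) *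
      (pw ?x (w g) * alternant M g ?y)"
    proof (cases "incr M g")
      case True
      show ?thesis by (subst even_exp_signed_count[OF True]) (use g in \<open>auto simp: G_def\<close>)
    next
      case False
      \<comment> \<open>Equal neighbours annihilate the alternant. At a descent both signed counts
        are empty, because lowering entries by at most 1 cannot turn a descent into a strict
        ascent.\<close>
      then obtain q where q: "Suc q < M" "g (Suc q) \<le> g q" by (auto simp: incr_def not_less)
      show ?thesis
      proof (cases "g (Suc q) = g q")
        case True
        then have "alternant M g ?y = 0" using q by (intro alternant_equal[of q _ "Suc q"]) auto
        then show ?thesis by simp
      next
        case False
        then have lt: "g (Suc q) < g q" using q by simp
        have "\<not> even_exp (Suc M) (ins i (drop_set g S) m)" if "i \<le> M" for i S m
          using even_exp_ins_imp_le[OF _ that q(1), of g S m] lt by auto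
        moreover have "\<not> even_exp M (drop_set g S)" for S
        proof
          assume "even_exp M (drop_set g S)"
          then have "drop_set g S q < drop_set g S (Suc q)" using q by (auto simp: even_exp_def incr_def)
          then show False using lt by (auto simp: drop_set_def of_bool_def split: if_splits)
        qed
        ultimately show ?thesis by simp
      qed
    qed
  qed simp
  also have "\<dots> = (\<Sum>S\<in>Pow {..<M}. \<Sum>g\<in>G. of_bool (even_exp M (drop_set g S) \<and> w g = int (M - card S)) *
      ((-1) ^ (M - card S) * (pw ?x (w g) * alternant M g ?y)))"
    by (subst sum.swap) (simp only: of_int_sum of_int_mult of_int_power of_int_minus of_int_1 of_int_of_bool sum_distrib_left sum_distrib_right mult_ac)
  also have "\<dots> = (\<Sum>S\<in>Pow {..<M}. \<Sum>e\<in>even_exps M (int k). (-1) ^ (M - card S) *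
      (pw ?x (int (M - card S)) * alternant M (\<lambda>q. e q + of_bool (q \<in> S)) ?y))"
    unfolding G_def w_def C_def
    by (rule sum.cong[OF refl], rule even_exps_reindex'[where H = "\<lambda>w g. (-1) ^ _ * (pw ?x w * alternant M g ?y)", symmetric]) auto
  also have "\<dots> = (\<Sum>e\<in>even_exps M (int k). (\<Sum>S\<in>Pow {..<M}. ((-1) ^ (M - card S) * pw ?x (int (M - card S))) * P S) * alternant M e ?y)"
    unfolding P_def by (subst alternant_mult_elementary) (simp add: sum.swap[of _ "Pow _"] mult.assoc)
  also have "(\<Sum>S\<in>Pow {..<M}. ((-1) ^ (M - card S) * pw ?x (int (M - card S))) * P S) = (\<Prod>b<M. pw (?y b) 1 - pw ?x 1)"
  proof -
    have "(\<Prod>b<M. pw (?y b) 1 - pw ?x 1) = (\<Prod>b<M. pw (?y b) 1 + (- pw ?x 1))" by simp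
    also have "\<dots> = (\<Sum>S\<in>Pow {..<M}. P S * (\<Prod>b\<in>{..<M} - S. - pw ?x 1))"
      by (subst prod_add) (auto simp: P_def)
    also have "\<dots> = (\<Sum>S\<in>Pow {..<M}. ((-1) ^ (M - card S) * pw ?x (int (M - card S))) * P S)"
    proof (rule sum.cong)
      fix S assume "S \<in> Pow {..<M}"
      then have "card ({..<M} - S) = M - card S" by (subst card_Diff_subset) (auto intro: finite_subset)
      then have "(\<Prod>b\<in>{..<M} - S. - pw ?x 1) = (- pw ?x 1) ^ (M - card S)" by simp
      also have "\<dots> = (-1) ^ (M - card S) * pw ?x (int (M - card S))"
        by (subst power_minus) (simp add: pw_power)
      finally show "P S * (\<Prod>b\<in>{..<M} - S. - pw ?x 1) = ((-1) ^ (M - card S) * pw ?x (int (M - card S))) * P S"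
        by simp
    qed simp
    finally show ?thesis ..
  qed
  also have "(\<Sum>e\<in>even_exps M (int k). (\<Prod>b<M. pw (?y b) 1 - pw ?x 1) * alternant M e ?y) =
      fps_nth (fps_const (\<Prod>b<M. pw (z (Suc b)) 1 - pw ?x 1) * even_alternants M ?y) k"
    by (simp add: even_alternants_def sum_distrib_left)
  finally show "fps_nth ((1 - fps_X * fps_const (pw ?x 2)) * (\<Prod>b<M. 1 - fps_X * fps_const (pw ?x 1 * pw (z (Suc b)) 1)) *
     even_alternants (Suc M) z) k = fps_nth (fps_const (\<Prod>b<M. pw (z (Suc b)) 1 - pw ?x 1) * even_alternants M ?y) k" .
qed

definition littlewood_prod :: "nat \<Rightarrow> (nat \<Rightarrow> nat \<Rightarrow> real) \<Rightarrow> laurent fps" where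
  "littlewood_prod N z = (\<Prod>b<N. \<Prod>a\<le>b. 1 - fps_X * fps_const (pw (z a) 1 * pw (z b) 1))"

lemma littlewood_prod_Suc:
  "littlewood_prod (Suc N) z = (1 - fps_X * fps_const (pw (z 0) 2)) *
     (\<Prod>b<N. 1 - fps_X * fps_const (pw (z 0) 1 * pw (z (Suc b)) 1)) * littlewood_prod N (z \<circ> Suc)"
proof -
  have "pw (z 0) 2 = pw (z 0) 1 * pw (z 0) 1" by (simp add: pw_add [symmetric])
  then show ?thesis
    unfolding littlewood_prod_def prod.lessThan_Suc_shift prod.atMost_Suc_shift
    by (simp add: prod.distrib mult_ac)
qed

lemma even_exps_0: "even_exps 0 k = (if k = 0 then {\<lambda>_. 0} else {})"
  by (auto simp: even_exps_def even_exp_def incr_def)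

theorem littlewood:
  "littlewood_prod N z * even_alternants N z = fps_const (\<Prod>b<N. \<Prod>a<b. pw (z b) 1 - pw (z a) 1)"
proof (induction N arbitrary: z)
  case 0
  have "even_alternants 0 z = 1"
    by (rule fps_ext) (auto simp: even_alternants_def even_exps_0 alternant_def)
  then show ?case by (simp add: littlewood_prod_def)
next
  case (Suc N)
  let ?A = "(1 - fps_X * fps_const (pw (z 0) 2)) * (\<Prod>b<N. 1 - fps_X * fps_const (pw (z 0) 1 * pw (z (Suc b)) 1))"
  let ?c = "\<Prod>b<N. pw (z (Suc b)) 1 - pw (z 0) 1"
  have "littlewood_prod (Suc N) z * even_alternants (Suc N) z = littlewood_prod N (z \<circ> Suc) * (?A * even_alternants (Suc N) z)"
    unfolding littlewood_prod_Suc by (simp only: mult_ac)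
  also have "\<dots> = fps_const ?c * (littlewood_prod N (z \<circ> Suc) * even_alternants N (z \<circ> Suc))"
    unfolding even_alternants_step by (simp only: mult_ac)
  also have "\<dots> = fps_const (?c * (\<Prod>b<N. \<Prod>a<b. pw (z (Suc b)) 1 - pw (z (Suc a)) 1))"
    unfolding Suc.IH by simp
  also have "?c * (\<Prod>b<N. \<Prod>a<b. pw (z (Suc b)) 1 - pw (z (Suc a)) 1) = (\<Prod>b<Suc N. \<Prod>a<b. pw (z b) 1 - pw (z a) 1)"
    unfolding prod.lessThan_Suc_shift by (simp add: prod.distrib)
  finally show ?case .
qed

section \<open>Constant term in t and cancellation of the Vandermonde factor\<close>

definition min_exps :: "nat \<Rightarrow> nat \<Rightarrow> int" where
  "min_exps N i = (if i < N then int i else 0)"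

lemma even_exps_zero: "even_exps N 0 = {min_exps N}"
proof
  show "even_exps N 0 \<subseteq> {min_exps N}"
  proof
    fix e assume e: "e \<in> even_exps N 0"
    then have ee: "even_exp N e" by (simp add: even_exps_def)
    have "e i - int i = 0" if "i < N" for i
    proof -
      have "(\<Sum>i<N. e i - int i) = 0" using e by (simp add: even_exps_def)
      then have "\<forall>i\<in>{..<N}. e i - int i = 0"
        by (subst sum_nonneg_eq_0_iff[symmetric]) (use even_exp_ge[OF ee] in auto)
      then show ?thesis using that by simp
    qed
    then show "e \<in> {min_exps N}" using e by (auto simp: even_exps_def min_exps_def fun_eq_iff)
  qed
  show "{min_exps N} \<subseteq> even_exps N 0"
    by (auto simp: even_exps_def even_exp_def incr_def min_exps_def)
qed

lemma colsum_mono_zero: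
  assumes "colsum a n j = 0" "i \<le> n"
  shows "colsum a i j = 0"
proof -
  have "\<forall>r\<in>{..<n}. int (a r j) = 0"
    using assms(1) unfolding colsum_def by (subst sum_nonneg_eq_0_iff[symmetric]) auto
  then show ?thesis using assms(2) by (simp add: colsum_def)
qed

lemma colsum_truncate:
  assumes "a \<in> sp_chains n e" "i \<le> n" "j < 2 * i"
  shows "colsum a i j = colsum a n j"
proof -
  have "a r j = 0" if "i \<le> r" for r
  proof (rule ccontr)
    assume "a r j \<noteq> 0"
    then have "2 * r \<le> j" using assms(1) by (auto simp: sp_chains_def)
    then show False using that assms(3) by simp
  qed
  then show ?thesis unfolding colsum_def by (intro sum.mono_neutral_left) (use assms(2) in auto)
qed

text \<open>Consecutive exponents leave no room. Going through the pairs of columns from the left,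
  an unmoved column keeps the next one from moving by the interlacing inequality, and the final
  condition passes this on to its partner.\<close>

lemma sp_chains_min_exps: "sp_chains n (min_exps (2 * n)) = {\<lambda>_ _. 0}"
proof
  show "{\<lambda>_ _. 0} \<subseteq> sp_chains n (min_exps (2 * n))"
    by (auto simp: sp_chains_def min_exps_def colsum_def)
  show "sp_chains n (min_exps (2 * n)) \<subseteq> {\<lambda>_ _. 0}"
  proof
    fix a assume a: "a \<in> sp_chains n (min_exps (2 * n))"
    have supp: "a i j \<noteq> 0 \<longrightarrow> i < n \<and> 2 * i \<le> j \<and> j < 2 * n" for i j
      using a unfolding sp_chains_def by blast
    have st: "int j - colsum a i j < int (Suc j) - colsum a (Suc i) (Suc j)" if "i < n" "Suc j < 2 * n" for i j
      using a that unfolding sp_chains_def min_exps_def by force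
    have ev: "int (2 * j) - colsum a n (2 * j) + 1 = int (Suc (2 * j)) - colsum a n (Suc (2 * j))" if "j < n" for j
      using a that unfolding sp_chains_def min_exps_def by force
    have "colsum a n (2 * i) = 0 \<and> colsum a n (Suc (2 * i)) = 0" if "i < n" for i
      using that
    proof (induction i)
      case 0
      then obtain m where n: "n = Suc m" by (metis gr0_implies_Suc)
      have "a i 0 = 0" for i
      proof (cases i)
        case 0 then show ?thesis using sp_chains_first(1)[of a m] a n by simp
      next
        case (Suc i') then show ?thesis using supp[of i 0] by auto
      qed
      then have "colsum a n 0 = 0" by (simp add: colsum_def)
      then show ?case using ev[of 0] 0 by simp
    next
      case (Suc i)
      then have "colsum a n (Suc (2 * i)) = 0" by simp
      then have "colsum a (Suc i) (Suc (2 * i)) = 0" by (rule colsum_mono_zero) (use Suc.prems in simp)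
      then have "colsum a (Suc (Suc i)) (2 * Suc i) \<le> 0"
        using st[of "Suc i" "Suc (2 * i)"] Suc.prems by simp
      moreover have "colsum a (Suc (Suc i)) (2 * Suc i) = colsum a n (2 * Suc i)"
        by (rule colsum_truncate[OF a]) (use Suc.prems in auto)
      moreover have "0 \<le> colsum a n (2 * Suc i)" by (simp add: colsum_def sum_nonneg)
      ultimately have "colsum a n (2 * Suc i) = 0" by simp
      then show ?case using ev[of "Suc i"] Suc.prems by simp
    qed
    then have z: "colsum a n j = 0" if "j < 2 * n" for j
      using that by (cases "even j") (auto elim!: evenE oddE)
    have "a i j = 0" for i j
    proof (rule ccontr)
      assume nz: "a i j \<noteq> 0"
      then have ij: "i < n" "j < 2 * n" using supp by auto
      have "\<forall>r\<in>{..<n}. int (a r j) = 0"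
        using z[OF ij(2)] unfolding colsum_def by (subst sum_nonneg_eq_0_iff[symmetric]) auto
      then show False using ij nz by simp
    qed
    then show "a \<in> {\<lambda>_ _. 0}" by (auto simp: fun_eq_iff)
  qed
qed

definition chain_series :: "nat \<Rightarrow> (nat \<Rightarrow> nat \<Rightarrow> real) \<Rightarrow> laurent fps" where
  "chain_series n v = Abs_fps (\<lambda>k. \<Sum>e\<in>even_exps (2 * n) (int k). chain_sum n e v)"

lemma even_alternants_chain_series:
  "even_alternants (2 * n) (pairs v) = fps_const (sym_vandermonde n v) * chain_series n v"
  by (rule fps_ext)
    (auto simp: even_alternants_def chain_series_def sum_distrib_left even_exps_def even_exp_def
      intro!: sum.cong alternant_pairs_chain_sum)

text \<open>The Vandermonde determinant in the paired variables is read off from Littlewood's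
  identity itself: in degree 0 only the minimal exponents and the zero array occur, which gives its
  factorization into \<open>sym_vandermonde\<close> and the Weyl denominator.\<close>

lemma littlewood_chain_series:
  "fps_const (sym_vandermonde n v) * (littlewood_prod (2 * n) (pairs v) * chain_series n v) =
   fps_const (sym_vandermonde n v) * fps_const (weyl_alternant n (\<lambda>i. int n - int i) v)"
proof -
  let ?P = "littlewood_prod (2 * n) (pairs v)" and ?V = "\<Prod>b<2 * n. \<Prod>a<b. pw (pairs v b) 1 - pw (pairs v a) 1"
  have L: "?P * even_alternants (2 * n) (pairs v) = fps_const ?V" by (rule littlewood)
  have "fps_nth ?P 0 = 1"
  proof -
    have "fps_nth (\<Prod>i\<in>A. f i) 0 = (\<Prod>i\<in>A. fps_nth (f i) 0)" for A :: "nat set" and f :: "nat \<Rightarrow> laurent fps"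
      by (induction A rule: infinite_finite_induct) auto
    then show ?thesis by (simp add: littlewood_prod_def)
  qed
  then have "?V = fps_nth (even_alternants (2 * n) (pairs v)) 0"
    using arg_cong[OF L, of "\<lambda>f. fps_nth f 0"] by simp
  also have "\<dots> = sym_vandermonde n v * weyl_alternant n (\<lambda>i. int n - int i) v"
  proof -
    have "chain_exponent n (\<lambda>_ _. 0) = (\<lambda>i. int n - int i)" by (simp add: chain_exponent_def fun_eq_iff)
    then show ?thesis
      by (simp add: even_alternants_chain_series chain_series_def even_exps_zero chain_sum_def sp_chains_min_exps)
  qed
  finally have V: "?V = sym_vandermonde n v * weyl_alternant n (\<lambda>i. int n - int i) v" .
  show ?thesis using L unfolding even_alternants_chain_series V by (simp add: mult_ac)
qed

lemma lookup_mon_mult: "Poly_Mapping.lookup (mon v * f) u = Poly_Mapping.lookup f (u - v)"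
proof -
  have "Poly_Mapping.lookup (mon v * f) u = (\<Sum>l. Poly_Mapping.lookup (mon v) l * (\<Sum>q. Poly_Mapping.lookup f q when u = l + q))"
    by (rule lookup_mult)
  also have "\<dots> = (\<Sum>l. ((\<Sum>q. Poly_Mapping.lookup f q when u = v + q) when l = v))"
    by (rule Sum_any.cong) (auto simp: lookup_mon when_def)
  also have "\<dots> = (\<Sum>q. Poly_Mapping.lookup f q when u = v + q)" by simp
  also have "\<dots> = (\<Sum>q. Poly_Mapping.lookup f (u - v) when q = u - v)"
    by (rule Sum_any.cong) (auto simp: when_def)
  finally show ?thesis by simp
qed

text \<open>A nonzero coefficient of \<open>f\<close> would repeat along the infinite progression
  \<open>u + k v\<close>, contrary to finite support.\<close>

lemma one_minus_mon_cancel: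
  assumes "(1 - mon v) * f = 0" "v \<noteq> 0"
  shows "f = 0"
proof (rule ccontr)
  assume "f \<noteq> 0"
  then obtain u where u: "Poly_Mapping.lookup f u \<noteq> 0" by (metis lookup_zero poly_mapping_eqI)
  have "f = mon v * f" using assms(1) by (simp add: left_diff_distrib)
  then have step: "Poly_Mapping.lookup f w = Poly_Mapping.lookup f (w - v)" for w
    using lookup_mon_mult[of v f w] by simp
  have "Poly_Mapping.lookup f (\<lambda>x. u x + real k * v x) = Poly_Mapping.lookup f u" for k
  proof (induction k)
    case (Suc k)
    have "(\<lambda>x. u x + real (Suc k) * v x) - v = (\<lambda>x. u x + real k * v x)"
      by (simp add: fun_eq_iff algebra_simps)
    then show ?case using step[of "\<lambda>x. u x + real (Suc k) * v x"] Suc by simp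
  qed simp
  then have "range (\<lambda>k x. u x + real k * v x) \<subseteq> Poly_Mapping.keys f"
    using u by (auto simp: in_keys_iff)
  moreover have "inj (\<lambda>k x. u x + real k * v x)"
  proof (rule injI)
    fix k l assume eq: "(\<lambda>x. u x + real k * v x) = (\<lambda>x. u x + real l * v x)"
    obtain x where "v x \<noteq> 0" using assms(2) by (auto simp: fun_eq_iff)
    then show "k = l" using fun_cong[OF eq, of x] by simp
  qed
  ultimately have "finite (UNIV :: nat set)"
    using finite_imageD[OF finite_subset[OF _ finite_keys]] by blast
  then show False by simp
qed

text \<open>\<open>x + 1/x - y - 1/y = x (1 - y/x) (1 - 1/(x y))\<close>: a unit times two factors
  that \<open>one_minus_mon_cancel\<close> removes.\<close>

lemma pw_sym_diff_cancel:
  assumes "(pw_sym x - pw_sym y) * f = 0" "x \<noteq> y" "x + y \<noteq> 0"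
  shows "f = 0"
proof -
  have m: "mon u = pw u 1" for u by (simp add: pw_def)
  have eq: "pw x 1 * ((1 - mon (y - x)) * (1 - mon (- (x + y)))) = pw_sym x - pw_sym y"
  proof -
    have a: "mon (y - x) = pw y 1 * pw x (- 1)" "mon (- (x + y)) = pw x (- 1) * pw y (- 1)"
    proof -
      have "y - x = (\<lambda>k. of_int 1 * y k) + (\<lambda>k. of_int (- 1) * x k)" by (rule ext) simp
      then show "mon (y - x) = pw y 1 * pw x (- 1)" unfolding pw_def mon_add[symmetric] by (rule arg_cong)
      have "- (x + y) = (\<lambda>k. of_int (- 1) * x k) + (\<lambda>k. of_int (- 1) * y k)" by (rule ext) simp
      then show "mon (- (x + y)) = pw x (- 1) * pw y (- 1)" unfolding pw_def mon_add[symmetric] by (rule arg_cong)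
    qed
    have gen: "c * ((1 - y * d) * (1 - d * y')) = c + d - (y + y')" if "c * d = 1" "y * y' = 1" for c d y y' :: laurent
    proof -
      have "c * ((1 - y * d) * (1 - d * y')) = c - (c * d) * y' - (c * d) * y + (c * d) * (y * y') * d"
        by (simp add: algebra_simps)
      also have "\<dots> = c + d - (y + y')"
        by (simp only: that mult_1 diff_conv_add_uminus minus_add_distrib add_ac)
      finally show ?thesis .
    qed
    have "pw x 1 * ((1 - pw y 1 * pw x (- 1)) * (1 - pw x (- 1) * pw y (- 1))) =
       pw x 1 + pw x (- 1) - (pw y 1 + pw y (- 1))"
      by (rule gen[OF pw_cancel pw_cancel])
    then show ?thesis unfolding a pw_sym_def .
  qed
  have "pw x 1 * ((1 - mon (y - x)) * ((1 - mon (- (x + y))) * f)) = 0"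
    using assms(1) unfolding eq[symmetric] by (simp only: mult.assoc)
  then have "(pw x 1 * pw x (- 1)) * ((1 - mon (y - x)) * ((1 - mon (- (x + y))) * f)) = 0"
    by (simp only: mult.left_commute[of _ "pw x (- 1)"] mult.assoc mult_zero_right)
  then have "(1 - mon (y - x)) * ((1 - mon (- (x + y))) * f) = 0"
    by (simp only: pw_cancel mult_1)
  then have "(1 - mon (- (x + y))) * f = 0"
    by (rule one_minus_mon_cancel) (use assms(2) in \<open>metis right_minus_eq\<close>)
  then show ?thesis
    by (rule one_minus_mon_cancel) (use assms(3) in \<open>metis neg_equal_0_iff_equal\<close>)
qed

lemma prod_cancel:
  fixes g :: "'i \<Rightarrow> 'a :: comm_ring_1"
  assumes "finite A" "\<And>i f. i \<in> A \<Longrightarrow> g i * f = 0 \<Longrightarrow> f = 0" "(\<Prod>i\<in>A. g i) * f = 0"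
  shows "f = 0"
  using assms
proof (induction A arbitrary: f rule: finite_induct)
  case (insert i A)
  have "g i * ((\<Prod>i\<in>A. g i) * f) = 0" using insert by (simp add: mult.assoc)
  then have "(\<Prod>i\<in>A. g i) * f = 0" using insert.prems(1)[of i] by blast
  then show ?case using insert by blast
qed simp

definition generic_vars :: "nat \<Rightarrow> (nat \<Rightarrow> nat \<Rightarrow> real) \<Rightarrow> bool" where
  "generic_vars n v \<longleftrightarrow> (\<forall>i<n. \<forall>j<n. i \<noteq> j \<longrightarrow> v i \<noteq> v j \<and> v i + v j \<noteq> 0)"

lemma sym_vandermonde_cancel:
  assumes "generic_vars n v"
    and "sym_vandermonde n v * f = 0"
  shows "f = 0"
proof (rule prod_cancel[of "{..<n}" "\<lambda>j. \<Prod>i<j. pw_sym (v i) - pw_sym (v j)"])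
  show "(\<Prod>j<n. \<Prod>i<j. pw_sym (v i) - pw_sym (v j)) * f = 0" using assms(2) by (simp add: sym_vandermonde_def)
  fix j f assume j: "j \<in> {..<n}" and 0: "(\<Prod>i<j. pw_sym (v i) - pw_sym (v j)) * f = 0"
  show "f = 0"
  proof (rule prod_cancel[of "{..<j}" "\<lambda>i. pw_sym (v i) - pw_sym (v j)"])
    fix i f assume i: "i \<in> {..<j}" and e: "(pw_sym (v i) - pw_sym (v j)) * f = 0"
    have "v i \<noteq> v j" "v i + v j \<noteq> 0" using assms(1) i j by (auto simp: generic_vars_def)
    then show "f = 0" by (rule pw_sym_diff_cancel[OF e])
  qed (simp_all only: finite_lessThan 0)
qed (simp only: finite_lessThan)

theorem littlewood_prod_chain_series:
  assumes "generic_vars n v"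
  shows "littlewood_prod (2 * n) (pairs v) * chain_series n v = fps_const (weyl_alternant n (\<lambda>i. int n - int i) v)"
proof (rule fps_ext)
  fix k
  define L where "L = littlewood_prod (2 * n) (pairs v) * chain_series n v"
  define W where "W = fps_const (weyl_alternant n (\<lambda>i. int n - int i) v)"
  have "fps_const (sym_vandermonde n v) * L = fps_const (sym_vandermonde n v) * W"
    unfolding L_def W_def by (rule littlewood_chain_series)
  then have "fps_nth (fps_const (sym_vandermonde n v) * L) k = fps_nth (fps_const (sym_vandermonde n v) * W) k"
    by (rule arg_cong)
  then have "sym_vandermonde n v * (fps_nth L k - fps_nth W k) = 0"
    by (simp only: fps_mult_left_const_nth right_diff_distrib diff_self)
  from sym_vandermonde_cancel[OF assms this] have "fps_nth L k = fps_nth W k"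
    by (simp only: right_minus_eq)
  then show "fps_nth (littlewood_prod (2 * n) (pairs v) * chain_series n v) k =
     fps_nth (fps_const (weyl_alternant n (\<lambda>i. int n - int i) v)) k"
    by (simp only: L_def W_def)
qed

section \<open>The Weyl group as signed permutations\<close>

definition signed_perms :: "nat \<Rightarrow> ((nat \<Rightarrow> nat) \<times> (nat \<Rightarrow> int)) set" where
  "signed_perms n = {p. p permutes {0..<n}} \<times> ({..<n} \<rightarrow>\<^sub>E {-1, 1})"

text \<open>Permutations live on \<open>0..n - 1\<close> while coordinates are numbered from 1,
  hence the shifts. Coordinates outside \<open>1..n\<close> are fixed, as they are by the
  reflections, so that equality of transformations can be shown on all vectors.\<close>

definition sp_act :: "nat \<Rightarrow> (nat \<Rightarrow> nat) \<times> (nat \<Rightarrow> int) \<Rightarrow> (nat \<Rightarrow> real) \<Rightarrow> nat \<Rightarrow> real" where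
  "sp_act n w v k = (if 1 \<le> k \<and> k \<le> n then of_int (snd w (k - 1)) * v (Suc (fst w (k - 1))) else v k)"

definition sp_sign :: "nat \<Rightarrow> (nat \<Rightarrow> nat) \<times> (nat \<Rightarrow> int) \<Rightarrow> int" where
  "sp_sign n w = sign (fst w) * (\<Prod>i<n. snd w i)"

lemma finite_signed_perms: "finite (signed_perms n)"
  unfolding signed_perms_def by (intro finite_cartesian_product finite_permutations finite_PiE) auto

lemma signed_permsD:
  assumes "w \<in> signed_perms n"
  shows "fst w permutes {0..<n}" "i < n \<Longrightarrow> snd w i = -1 \<or> snd w i = 1" "i < n \<Longrightarrow> snd w i * snd w i = 1"
    "snd w \<in> extensional {..<n}"
proof -
  obtain p c where w: "w = (p, c)" by (cases w)
  have p: "p permutes {0..<n}" and c: "c \<in> {..<n} \<rightarrow>\<^sub>E {-1, 1}"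
    using assms unfolding w signed_perms_def by blast+
  have i: "c i = -1 \<or> c i = 1" if "i < n" for i using PiE_mem[OF c, of i] that by simp
  show "fst w permutes {0..<n}" using p by (simp add: w)
  show "snd w \<in> extensional {..<n}" using c by (simp add: w PiE_iff)
  show "snd w i = -1 \<or> snd w i = 1" if "i < n" using i[OF that] by (simp add: w)
  show "snd w i * snd w i = 1" if "i < n" using i[OF that] unfolding w snd_conv by (rule disjE) simp_all
qed

lemma sp_act_Suc: "i < n \<Longrightarrow> sp_act n w v (Suc i) = of_int (snd w i) * v (Suc (fst w i))"
  by (simp add: sp_act_def)

lemma sp_act_outside: "\<not> (1 \<le> k \<and> k \<le> n) \<Longrightarrow> sp_act n w v k = v k"
  unfolding sp_act_def by (rule if_not_P)

lemma sp_act_ext: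
  assumes "\<And>i. i < n \<Longrightarrow> f (Suc i) = g (Suc i)" "\<And>k. \<not> (1 \<le> k \<and> k \<le> n) \<Longrightarrow> f k = g k"
  shows "f = (g :: nat \<Rightarrow> real)"
proof
  fix k show "f k = g k"
  proof (cases "1 \<le> k \<and> k \<le> n")
    case True then show ?thesis using assms(1)[of "k - 1"] by auto
  qed (rule assms(2))
qed

text \<open>The vector \<open>real\<close>, with coordinates 1, 2, and so on, separates signed
  permutations: absolute values of the image reveal the permutation, signs the sign
  function.\<close>

lemma inj_on_sp_act: "inj_on (sp_act n) (signed_perms n)"
proof (rule inj_onI)
  fix w w' assume w: "w \<in> signed_perms n" "w' \<in> signed_perms n" and eq: "sp_act n w = sp_act n w'"
  have *: "fst w i = fst w' i \<and> snd w i = snd w' i" if i: "i < n" for i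
  proof -
    have "sp_act n w real (Suc i) = sp_act n w' real (Suc i)" by (simp add: eq)
    then have "real_of_int (snd w i * int (Suc (fst w i))) = real_of_int (snd w' i * int (Suc (fst w' i)))"
      unfolding sp_act_Suc[OF i] by simp
    then have e: "snd w i * int (Suc (fst w i)) = snd w' i * int (Suc (fst w' i))" by (simp only: of_int_eq_iff)
    have "\<bar>snd w i\<bar> = 1" "\<bar>snd w' i\<bar> = 1"
      using signed_permsD(2)[OF w(1) i] signed_permsD(2)[OF w(2) i] by linarith+
    then have "int (Suc (fst w i)) = int (Suc (fst w' i))"
      using arg_cong[OF e, of abs] by (simp only: abs_mult abs_of_nat mult_1)
    then have f: "fst w i = fst w' i" by simp
    then show ?thesis using e by (simp del: of_nat_Suc)
  qed
  have "fst w = fst w'"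
  proof
    fix i show "fst w i = fst w' i"
    proof (cases "i < n")
      case False
      then show ?thesis using permutes_not_in[OF signed_permsD(1)[OF w(1)], of i] permutes_not_in[OF signed_permsD(1)[OF w(2)], of i] by simp
    qed (use * in auto)
  qed
  moreover have "snd w = snd w'"
    by (rule extensionalityI[of _ "{..<n}"]) (use * signed_permsD(4) w in auto)
  ultimately show "w = w'" by (rule prod_eqI)
qed

text \<open>The signed permutation of the product of the \<open>j\<close>-th simple reflection with
  \<open>w\<close>, the reflection being applied last.\<close>

definition sp_gen :: "nat \<Rightarrow> nat \<Rightarrow> (nat \<Rightarrow> nat) \<times> (nat \<Rightarrow> int) \<Rightarrow> (nat \<Rightarrow> nat) \<times> (nat \<Rightarrow> int)" where
  "sp_gen n j w = (if j = n then (fst w, (snd w)(n - 1 := - snd w (n - 1)))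
     else (fst w \<circ> Transposition.transpose (j - 1) j, snd w \<circ> Transposition.transpose (j - 1) j))"

lemma sp_gen_last:
  assumes w: "w \<in> signed_perms n" and n: "1 \<le> n"
  shows "sp_gen n n w \<in> signed_perms n" "sp_sign n (sp_gen n n w) = - sp_sign n w"
    "sp_act n (sp_gen n n w) v = (sp_act n w v)(n := - sp_act n w v n)"
proof -
  obtain p c where pc: "w = (p, c)" by (cases w)
  have p: "p permutes {0..<n}" and c: "c \<in> {..<n} \<rightarrow>\<^sub>E {-1, 1}"
    using w unfolding pc signed_perms_def by blast+
  let ?c = "c(n - 1 := - c (n - 1))"
  have g: "sp_gen n n w = (p, ?c)" by (simp add: sp_gen_def pc)
  have n1: "n - 1 < n" using n by simp
  have "?c \<in> {..<n} \<rightarrow>\<^sub>E {-1, 1}"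
  proof (rule PiE_I)
    fix i assume "i \<in> {..<n}"
    then have "c i \<in> {-1, 1}" by (rule PiE_mem[OF c])
    then show "?c i \<in> {-1, 1}" by (cases "i = n - 1") auto
  next
    fix i assume "i \<notin> {..<n}"
    then show "?c i = undefined" using PiE_arb[OF c, of i] n1 by auto
  qed
  then show "sp_gen n n w \<in> signed_perms n" using p by (simp add: g signed_perms_def)
  have "(\<Prod>i<n. ?c i) = ?c (n - 1) * (\<Prod>i\<in>{..<n} - {n - 1}. ?c i)"
    by (rule prod.remove) (use n1 in auto)
  also have "(\<Prod>i\<in>{..<n} - {n - 1}. ?c i) = (\<Prod>i\<in>{..<n} - {n - 1}. c i)" by (rule prod.cong) auto
  also have "?c (n - 1) * (\<Prod>i\<in>{..<n} - {n - 1}. c i) = - (c (n - 1) * (\<Prod>i\<in>{..<n} - {n - 1}. c i))" by simp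
  also have "c (n - 1) * (\<Prod>i\<in>{..<n} - {n - 1}. c i) = (\<Prod>i<n. c i)"
    by (rule prod.remove[symmetric]) (use n1 in auto)
  finally show "sp_sign n (sp_gen n n w) = - sp_sign n w" unfolding g unfolding sp_sign_def pc by simp
  show "sp_act n (sp_gen n n w) v = (sp_act n w v)(n := - sp_act n w v n)"
  proof
    fix k show "sp_act n (sp_gen n n w) v k = ((sp_act n w v)(n := - sp_act n w v n)) k"
      unfolding g unfolding pc sp_act_def fst_conv snd_conv using n by (cases "k = n") auto
  qed
qed

lemma sp_gen_swap:
  assumes w: "w \<in> signed_perms n" and j: "1 \<le> j" "j < n"
  shows "sp_gen n j w \<in> signed_perms n" "sp_sign n (sp_gen n j w) = - sp_sign n w"
    "sp_act n (sp_gen n j w) v = (sp_act n w v)(j := sp_act n w v (Suc j), Suc j := sp_act n w v j)"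
proof -
  obtain p c where pc: "w = (p, c)" by (cases w)
  have p: "p permutes {0..<n}" and c: "c \<in> {..<n} \<rightarrow>\<^sub>E {-1, 1}"
    using w unfolding pc signed_perms_def by blast+
  let ?t = "Transposition.transpose (j - 1) j"
  have g: "sp_gen n j w = (p \<circ> ?t, c \<circ> ?t)" using j by (simp add: sp_gen_def pc)
  have t: "?t permutes {0..<n}" by (rule permutes_swap_id) (use j in auto)
  have tn: "?t i < n \<longleftrightarrow> i < n" for i using permutes_in_image[OF t, of i] by simp
  have "c \<circ> ?t \<in> {..<n} \<rightarrow>\<^sub>E {-1, 1}"
  proof (rule PiE_I)
    fix i assume "i \<in> {..<n}"
    then have "?t i \<in> {..<n}" using tn by simp
    then show "(c \<circ> ?t) i \<in> {-1, 1}" using PiE_mem[OF c, of "?t i"] by simp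
  next
    fix i assume "i \<notin> {..<n}"
    then show "(c \<circ> ?t) i = undefined" using PiE_arb[OF c, of "?t i"] tn[of i] by simp
  qed
  then show "sp_gen n j w \<in> signed_perms n" using permutes_compose[OF t p] by (simp add: g signed_perms_def)
  have "permutation p" "permutation ?t" using p t permutation_permutes by blast+
  then have "sign (p \<circ> ?t) = sign p * sign ?t" by (rule sign_compose)
  moreover have "sign ?t = -1" using j by (simp add: sign_swap_id)
  moreover have "(\<Prod>i<n. (c \<circ> ?t) i) = (\<Prod>i<n. c i)"
    using prod.permute[OF t, of c] by (simp add: atLeast0LessThan)
  ultimately show "sp_sign n (sp_gen n j w) = - sp_sign n w" unfolding g unfolding sp_sign_def pc by simp
  show "sp_act n (sp_gen n j w) v = (sp_act n w v)(j := sp_act n w v (Suc j), Suc j := sp_act n w v j)"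
  proof
    fix k
    have t1: "?t (j - 1) = j" "?t j = j - 1" "i \<noteq> j \<Longrightarrow> i \<noteq> j - 1 \<Longrightarrow> ?t i = i" for i by auto
    show "sp_act n (sp_gen n j w) v k = ((sp_act n w v)(j := sp_act n w v (Suc j), Suc j := sp_act n w v j)) k"
    proof (cases "k = j \<or> k = Suc j")
      case True
      then show ?thesis unfolding g unfolding pc sp_act_def fst_conv snd_conv comp_def using j t1 by auto
    next
      case False
      then have "k \<noteq> 0 \<Longrightarrow> ?t (k - 1) = k - 1" using j by (intro t1) auto
      then show ?thesis using False unfolding g unfolding pc sp_act_def fst_conv snd_conv comp_def by auto
    qed
  qed
qed

lemma sp_gen:
  assumes w: "w \<in> signed_perms n" and j: "j \<in> {1..n}"
  shows "sp_gen n j w \<in> signed_perms n" "sp_sign n (sp_gen n j w) = - sp_sign n w"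
    "sp_act n (sp_gen n j w) = reflection n (simple_root n j) \<circ> sp_act n w"
proof -
  have *: "sp_gen n j w \<in> signed_perms n \<and> sp_sign n (sp_gen n j w) = - sp_sign n w \<and>
    sp_act n (sp_gen n j w) v = reflection n (simple_root n j) (sp_act n w v)" for v
  proof (cases "j = n")
    case True
    then show ?thesis using sp_gen_last(1,2)[OF w] sp_gen_last(3)[OF w, of v] j unfolding reflection_simple_root[OF j] by simp
  next
    case False
    then show ?thesis using sp_gen_swap(1,2)[OF w, of j] sp_gen_swap(3)[OF w, of j v] j unfolding reflection_simple_root[OF j] by simp
  qed
  show "sp_gen n j w \<in> signed_perms n" "sp_sign n (sp_gen n j w) = - sp_sign n w" using * by blast+
  show "sp_act n (sp_gen n j w) = reflection n (simple_root n j) \<circ> sp_act n w"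
    by (rule ext) (simp only: comp_apply *)
qed

definition sp_id :: "nat \<Rightarrow> (nat \<Rightarrow> nat) \<times> (nat \<Rightarrow> int)" where
  "sp_id n = (id, restrict (\<lambda>_. 1) {..<n})"

lemma sp_id: "sp_id n \<in> signed_perms n" "sp_act n (sp_id n) = id" "sp_sign n (sp_id n) = 1"
  by (auto simp: sp_id_def signed_perms_def permutes_id sp_act_def fun_eq_iff sp_sign_def)

lemma word_action_Cons: "word_action n (j # js) = reflection n (simple_root n j) \<circ> word_action n js"
  by (simp add: word_action_def)

lemma word_action_signed_perm:
  assumes "js \<in> lists {1..n}"
  shows "\<exists>w\<in>signed_perms n. word_action n js = sp_act n w \<and> sp_sign n w = (-1) ^ length js"
  using assms
proof (induction js)
  case Nil
  then show ?case using sp_id[of n] by (intro bexI[of _ "sp_id n"]) (auto simp: word_action_def)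
next
  case (Cons j js)
  then obtain w where w: "w \<in> signed_perms n" "word_action n js = sp_act n w" "sp_sign n w = (-1) ^ length js" by auto
  have j: "j \<in> {1..n}" using Cons by simp
  show ?case using sp_gen[OF w(1) j] w(2,3) by (intro bexI[of _ "sp_gen n j w"]) (auto simp: word_action_Cons)
qed

text \<open>Climbing into the dominant chamber: \<open>u w\<close> lists the coordinates of the
  image of \<rho> under \<open>w\<close>, and \<open>F w\<close> is the scalar product of this image
  with \<rho>. If the image is not dominant, some simple reflection raises \<open>F\<close>, which
  is bounded; if it is dominant, all signs are positive, the permutation is increasing, and
  \<open>w\<close> is the identity.\<close>

lemma signed_perm_is_word:
  assumes "w \<in> signed_perms n"
  shows "sp_act n w \<in> weyl_group n"
  using assms
proof (induction "nat (2 * (\<Sum>k<n. (int n)^2) - (\<Sum>k<n. (int n - int k) * (snd w k * (int n - int (fst w k)))))" arbitrary: w rule: less_induct)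
  case less
  define u where "u w k = snd w k * (int n - int (fst w k))" for w :: "(nat \<Rightarrow> nat) \<times> (nat \<Rightarrow> int)" and k
  define F where "F w = (\<Sum>k<n. (int n - int k) * u w k)" for w
  note D = signed_permsD[OF less.prems]
  have bound: "F x \<le> (\<Sum>k<n. (int n)^2)" if x: "x \<in> signed_perms n" for x
    unfolding F_def
  proof (rule sum_mono)
    fix k assume "k \<in> {..<n}"
    then have k: "k < n" by simp
    have f: "fst x k < n" using permutes_in_image[OF signed_permsD(1)[OF x], of k] k by simp
    have "u x k \<le> int n" using signed_permsD(2)[OF x k] f by (auto simp: u_def)
    then have "(int n - int k) * u x k \<le> (int n - int k) * int n" using k by (intro mult_left_mono) auto
    also have "\<dots> \<le> int n * int n" by (intro mult_right_mono) auto
    finally show "(int n - int k) * u x k \<le> (int n)^2" by (simp add: power2_eq_square)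
  qed
  have step: "sp_act n w \<in> weyl_group n" if j: "j \<in> {1..n}" and F: "F w < F (sp_gen n j w)" for j
  proof -
    note G = sp_gen[OF less.prems j]
    have "sp_act n (sp_gen n j w) \<in> weyl_group n"
    proof (rule less.hyps[OF _ G(1)])
      have "0 \<le> (\<Sum>k<n. (int n)^2)" by (simp add: sum_nonneg)
      then show "nat (2 * (\<Sum>k<n. (int n)^2) - (\<Sum>k<n. (int n - int k) * (snd (sp_gen n j w) k * (int n - int (fst (sp_gen n j w) k))))) <
        nat (2 * (\<Sum>k<n. (int n)^2) - (\<Sum>k<n. (int n - int k) * (snd w k * (int n - int (fst w k)))))"
        using F bound[OF less.prems] bound[OF G(1)] unfolding F_def u_def by linarith
    qed
    then obtain js where js': "sp_act n (sp_gen n j w) = word_action n js" and js: "js \<in> lists {1..n}"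
      unfolding weyl_group_def by (rule imageE)
    have inv: "reflection n (simple_root n j) (reflection n (simple_root n j) v) = v" for v
      unfolding reflection_simple_root[OF j] by (rule ext) (simp split: if_split)
    have "word_action n (j # js) = sp_act n w"
      unfolding word_action_Cons js'[symmetric] G(3) by (rule ext) (simp only: comp_apply inv)
    moreover have "j # js \<in> lists {1..n}" using js j by auto
    ultimately show ?thesis unfolding weyl_group_def by (intro image_eqI[where x = "j # js"]) simp_all
  qed
  show ?case
  proof (cases "n > 0 \<and> u w (n - 1) < 0")
    case True
    then have n: "n \<in> {1..n}" by auto
    have "F (sp_gen n n w) = F w - 2 * u w (n - 1)"
    proof -
      have *: "F x = (int n - int (n - 1)) * u x (n - 1) + (\<Sum>k\<in>{..<n} - {n - 1}. (int n - int k) * u x k)" for x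
        unfolding F_def by (rule sum.remove) (use True in auto)
      have "(\<Sum>k\<in>{..<n} - {n - 1}. (int n - int k) * u (sp_gen n n w) k) = (\<Sum>k\<in>{..<n} - {n - 1}. (int n - int k) * u w k)"
        by (rule sum.cong) (auto simp: u_def sp_gen_def)
      moreover have "u (sp_gen n n w) (n - 1) = - u w (n - 1)" by (simp add: u_def sp_gen_def)
      moreover have "int n - int (n - 1) = 1" using True by auto
      ultimately show ?thesis unfolding * by simp
    qed
    then show ?thesis using step[OF n] True by simp
  next
    case last: False
    show ?thesis
    proof (cases "\<exists>j. 1 \<le> j \<and> j < n \<and> u w (j - 1) < u w j")
      case True
      then obtain j where j: "1 \<le> j" "j < n" "u w (j - 1) < u w j" by blast
      then have jn: "j \<in> {1..n}" by auto
      have "F (sp_gen n j w) = F w + (u w j - u w (j - 1))"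
      proof -
        have *: "F x = (int n - int j) * u x j + ((int n - int (j - 1)) * u x (j - 1) + (\<Sum>k\<in>{..<n} - {j} - {j - 1}. (int n - int k) * u x k))" for x
        proof -
          have "F x = (int n - int j) * u x j + (\<Sum>k\<in>{..<n} - {j}. (int n - int k) * u x k)"
            unfolding F_def by (rule sum.remove) (use j in auto)
          also have "(\<Sum>k\<in>{..<n} - {j}. (int n - int k) * u x k) = (int n - int (j - 1)) * u x (j - 1) + (\<Sum>k\<in>{..<n} - {j} - {j - 1}. (int n - int k) * u x k)"
            by (rule sum.remove) (use j in auto)
          finally show ?thesis .
        qed
        have "(\<Sum>k\<in>{..<n} - {j} - {j - 1}. (int n - int k) * u (sp_gen n j w) k) = (\<Sum>k\<in>{..<n} - {j} - {j - 1}. (int n - int k) * u w k)"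
          using j by (intro sum.cong) (auto simp: u_def sp_gen_def Transposition.transpose_def)
        moreover have "u (sp_gen n j w) j = u w (j - 1)" "u (sp_gen n j w) (j - 1) = u w j" using j by (auto simp: u_def sp_gen_def)
        moreover have "int n - int (j - 1) = int n - int j + 1" using j by auto
        ultimately have 1: "F (sp_gen n j w) = (int n - int j) * u w (j - 1) + ((int n - int j + 1) * u w j + R)"
          and 2: "F w = (int n - int j) * u w j + ((int n - int j + 1) * u w (j - 1) + R)"
          if "R = (\<Sum>k\<in>{..<n} - {j} - {j - 1}. (int n - int k) * u w k)" for R
          unfolding *[of "sp_gen n j w"] *[of w] that by (simp_all only:)
        show ?thesis unfolding 1[OF refl] 2[OF refl] by (simp only: distrib_right mult_1)
      qed
      then have "F w < F (sp_gen n j w)" using j by linarith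
      then show ?thesis by (rule step[OF jn])
    next
      case False
      then have dec: "u w j \<le> u w (j - 1)" if "1 \<le> j" "j < n" for j using that by (meson not_less)
      have mono: "u w (n - 1) \<le> u w k" if "k < n" for k
        using that
      proof (induction "n - 1 - k" arbitrary: k)
        case 0
        then have "k = n - 1" by linarith
        then show ?case by simp
      next
        case (Suc d)
        then have "u w (n - 1) \<le> u w (Suc k)" by (intro Suc.hyps) auto
        also have "\<dots> \<le> u w k" using dec[of "Suc k"] Suc by auto
        finally show ?case .
      qed
      have f: "fst w k < n" if "k < n" for k using permutes_in_image[OF D(1), of k] that by simp
      have c1: "snd w k = 1" if "k < n" for k
      proof -
        have "0 \<le> u w (n - 1)" using last that by auto
        then have "0 \<le> u w k" using mono[OF that] by simp
        then show ?thesis using D(2)[OF that] f[OF that] by (auto simp: u_def)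
      qed
      have inc: "fst w (j - 1) \<le> fst w j" if "1 \<le> j" "j < n" for j
        using dec[OF that] c1[of j] c1[of "j - 1"] that by (auto simp: u_def)
      have "k \<le> fst w k" if "k < n" for k
        using that
      proof (induction k)
        case (Suc k)
        have "fst w k \<le> fst w (Suc k)" using inc[of "Suc k"] Suc.prems by simp
        moreover have "fst w k \<noteq> fst w (Suc k)" using inj_eq[OF permutes_inj[OF D(1)]] by simp
        ultimately show ?case using Suc by simp
      qed simp
      then have "\<forall>k\<in>{0..<n}. k \<le> fst w k" by simp
      then have "fst w = id" by (rule permutes_natset_ge[OF D(1)])
      moreover have "snd w = restrict (\<lambda>_. 1) {..<n}"
      proof (rule extensionalityI[of _ "{..<n}"])
        show "snd w \<in> extensional {..<n}" by (rule D(4))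
        fix i assume "i \<in> {..<n}"
        then show "snd w i = restrict (\<lambda>_. 1) {..<n} i" using c1[of i] by simp
      qed (rule restrict_extensional)
      ultimately have "w = sp_id n" unfolding sp_id_def by (intro prod_eqI) (simp_all only: fst_conv snd_conv)
      then have "sp_act n w = word_action n []" using sp_id(2)[of n] by (simp add: word_action_def)
      then show ?thesis unfolding weyl_group_def by auto
    qed
  qed
qed

lemma weyl_group_eq: "weyl_group n = sp_act n ` signed_perms n"
proof
  show "weyl_group n \<subseteq> sp_act n ` signed_perms n"
    unfolding weyl_group_def using word_action_signed_perm by blast
  show "sp_act n ` signed_perms n \<subseteq> weyl_group n" using signed_perm_is_word by blast
qed

text \<open>Each letter of a word changes \<open>sp_sign\<close>, so all words for one element have
  lengths of the same parity, in particular a shortest one.\<close>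

lemma weyl_length_sign:
  assumes "w \<in> signed_perms n"
  shows "(-1) ^ weyl_length n (sp_act n w) = sp_sign n w"
proof -
  obtain js0 where "sp_act n w = word_action n js0" "js0 \<in> lists {1..n}"
    using signed_perm_is_word[OF assms] unfolding weyl_group_def by (rule imageE)
  then have "\<exists>l. \<exists>js\<in>lists {1..n}. length js = l \<and> word_action n js = sp_act n w" by metis
  from LeastI_ex[OF this] obtain js where js: "js \<in> lists {1..n}" "length js = weyl_length n (sp_act n w)" "word_action n js = sp_act n w"
    unfolding weyl_length_def by blast
  from word_action_signed_perm[OF js(1)] obtain w' where w': "w' \<in> signed_perms n" "word_action n js = sp_act n w'" "sp_sign n w' = (-1) ^ length js"
    by blast
  have "w' = w" using inj_onD[OF inj_on_sp_act] w' js(3) assms by metis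
  then show ?thesis using w'(3) js(2) by simp
qed

lemma gen_exponent_signed_perms:
  "gen_exponent_C n \<Lambda> = (\<Sum>w\<in>signed_perms n. of_int (sp_sign n w) *
     kostant_partition n (\<lambda>k. sp_act n w (\<lambda>j. \<Lambda> j + rho n j) k - rho n k))"
proof -
  have "(-1) ^ weyl_length n (sp_act n w) = (of_int (sp_sign n w) :: int poly)" if "w \<in> signed_perms n" for w
    unfolding weyl_length_sign[OF that, symmetric] by simp
  then show ?thesis
    unfolding gen_exponent_C_def weyl_group_eq sum.reindex[OF inj_on_sp_act] by (intro sum.cong) auto
qed

section \<open>Alternating sums over the Weyl group\<close>

definition sp_inv :: "nat \<Rightarrow> (nat \<Rightarrow> nat) \<times> (nat \<Rightarrow> int) \<Rightarrow> (nat \<Rightarrow> nat) \<times> (nat \<Rightarrow> int)" where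
  "sp_inv n w = (inv_into UNIV (fst w), restrict (snd w \<circ> inv_into UNIV (fst w)) {..<n})"

lemma sp_inv:
  assumes w: "w \<in> signed_perms n"
  shows "sp_act n (sp_inv n w) (sp_act n w v) = v" "sp_act n w (sp_act n (sp_inv n w) v) = v"
proof -
  let ?p = "fst w"
  note D = signed_permsD[OF w]
  have p: "?p permutes {0..<n}" by (rule D(1))
  have ip: "inv_into UNIV ?p permutes {0..<n}" by (rule permutes_inv[OF p])
  have lt: "?p i < n" "inv_into UNIV ?p i < n" if "i < n" for i
    using permutes_in_image[OF p, of i] permutes_in_image[OF ip, of i] that by simp_all
  have pinv: "?p (inv_into UNIV ?p i) = i" "inv_into UNIV ?p (?p i) = i" for i using permutes_inverses[OF p] by simp_all
  have c2: "of_int (snd w i) * (of_int (snd w i) * r) = r" if "i < n" for i and r :: real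
    using D(3)[OF that] by (simp add: mult.assoc[symmetric] of_int_mult[symmetric] del: of_int_mult)
  show "sp_act n (sp_inv n w) (sp_act n w v) = v"
    by (rule sp_act_ext[of n]) (simp_all only: sp_act_Suc sp_act_outside sp_inv_def fst_conv snd_conv lt pinv restrict_apply' lessThan_iff comp_apply c2 not_False_eq_True)
  show "sp_act n w (sp_act n (sp_inv n w) v) = v"
    by (rule sp_act_ext[of n]) (simp_all only: sp_act_Suc sp_act_outside sp_inv_def fst_conv snd_conv lt pinv restrict_apply' lessThan_iff comp_apply c2 not_False_eq_True)
qed

lemma sp_act_diff: "sp_act n w (u - v) = sp_act n w u - sp_act n w v"
  by (rule sp_act_ext[of n]) (simp_all only: sp_act_Suc sp_act_outside minus_apply right_diff_distrib not_False_eq_True)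

lemma bij_sp_act: "w \<in> signed_perms n \<Longrightarrow> bij (sp_act n w)"
  by (rule bij_betw_byWitness[where f' = "sp_act n (sp_inv n w)"]) (simp_all add: sp_inv)

lemma inj_sp_act: "w \<in> signed_perms n \<Longrightarrow> inj (sp_act n w)"
  using bij_sp_act bij_is_inj by blast

text \<open>Pulling coefficients back along \<open>sp_act n w\<close> moves \<open>mon u\<close> to
  \<open>mon\<close> of the preimage of \<open>u\<close>. So the inverse of \<open>w\<close> acts on
  exponents, which in an alternating sum over the group only reorders the terms.\<close>

definition lact :: "nat \<Rightarrow> (nat \<Rightarrow> nat) \<times> (nat \<Rightarrow> int) \<Rightarrow> laurent \<Rightarrow> laurent" where
  "lact n w f = Poly_Mapping.map_key (sp_act n w) f"

lemma lookup_lact: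
  "w \<in> signed_perms n \<Longrightarrow> Poly_Mapping.lookup (lact n w f) u = Poly_Mapping.lookup f (sp_act n w u)"
  unfolding lact_def by (simp add: map_key.rep_eq[OF inj_sp_act])

lemma lookup_laurent_mult:
  "Poly_Mapping.lookup (f * g) u = (\<Sum>k\<in>Poly_Mapping.keys f. Poly_Mapping.lookup f k * Poly_Mapping.lookup g (u - k))"
  for f g :: laurent
proof -
  have inner: "(\<Sum>q. Poly_Mapping.lookup g q when u = l + q) = Poly_Mapping.lookup g (u - l)" for l
  proof -
    have "(\<Sum>q. Poly_Mapping.lookup g q when u = l + q) = (\<Sum>q. Poly_Mapping.lookup g (u - l) when q = u - l)"
      by (rule Sum_any.cong) (auto simp: when_def)
    then show ?thesis by simp
  qed
  have "Poly_Mapping.lookup (f * g) u = (\<Sum>l. Poly_Mapping.lookup f l * Poly_Mapping.lookup g (u - l))"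
    unfolding lookup_mult inner ..
  also have "\<dots> = (\<Sum>k\<in>Poly_Mapping.keys f. Poly_Mapping.lookup f k * Poly_Mapping.lookup g (u - k))"
    by (rule Sum_any.expand_superset) (auto simp: in_keys_iff)
  finally show ?thesis .
qed

lemma lact_mult:
  assumes w: "w \<in> signed_perms n"
  shows "lact n w (f * g) = lact n w f * lact n w g"
proof (rule poly_mapping_eqI)
  fix u
  have k: "Poly_Mapping.keys f = sp_act n w ` Poly_Mapping.keys (lact n w f)"
  proof -
    have "Poly_Mapping.keys (lact n w f) = sp_act n w -` Poly_Mapping.keys f"
      unfolding lact_def by (rule keys_map_key[OF inj_sp_act[OF w]])
    then show ?thesis using bij_is_surj[OF bij_sp_act[OF w]] by (simp add: surj_image_vimage_eq)
  qed
  have "Poly_Mapping.lookup (lact n w (f * g)) u =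
     (\<Sum>k\<in>Poly_Mapping.keys f. Poly_Mapping.lookup f k * Poly_Mapping.lookup g (sp_act n w u - k))"
    unfolding lookup_lact[OF w] by (rule lookup_laurent_mult)
  also have "\<dots> = (\<Sum>k\<in>Poly_Mapping.keys (lact n w f). Poly_Mapping.lookup f (sp_act n w k) * Poly_Mapping.lookup g (sp_act n w u - sp_act n w k))"
    by (subst k, subst sum.reindex) (auto intro: inj_on_subset[OF inj_sp_act[OF w]])
  also have "\<dots> = Poly_Mapping.lookup (lact n w f * lact n w g) u"
    unfolding lookup_laurent_mult lookup_lact[OF w] sp_act_diff ..
  finally show "Poly_Mapping.lookup (lact n w (f * g)) u = Poly_Mapping.lookup (lact n w f * lact n w g) u" .
qed

lemma lact_add: "w \<in> signed_perms n \<Longrightarrow> lact n w (f + g) = lact n w f + lact n w g"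
  by (rule poly_mapping_eqI) (simp only: lookup_lact lookup_add)

lemma lact_0: "w \<in> signed_perms n \<Longrightarrow> lact n w 0 = 0"
  by (rule poly_mapping_eqI) (simp only: lookup_lact lookup_zero)

lemma lact_sum: "w \<in> signed_perms n \<Longrightarrow> lact n w (sum f A) = (\<Sum>i\<in>A. lact n w (f i))"
  by (induction A rule: infinite_finite_induct) (simp_all add: lact_add lact_0)

lemma lact_mon_act:
  assumes "w \<in> signed_perms n"
  shows "lact n w (mon (sp_act n w u)) = mon u"
  unfolding lact_def mon_def by (rule map_key_single[OF inj_sp_act[OF assms]])

lemma lact_mon:
  assumes "w \<in> signed_perms n"
  shows "lact n w (mon u) = mon (sp_act n (sp_inv n w) u)"
  using lact_mon_act[OF assms, of "sp_act n (sp_inv n w) u"] by (simp only: sp_inv[OF assms])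

lemma lact_1: "w \<in> signed_perms n \<Longrightarrow> lact n w 1 = 1"
proof -
  assume w: "w \<in> signed_perms n"
  have "sp_act n (sp_inv n w) 0 = 0"
    by (rule sp_act_ext[of n]) (simp_all only: sp_act_Suc sp_act_outside zero_fun_apply mult_zero_right not_False_eq_True)
  then show ?thesis using lact_mon[OF w, of 0] by (simp only: mon_zero)
qed

definition fact_act :: "nat \<Rightarrow> (nat \<Rightarrow> nat) \<times> (nat \<Rightarrow> int) \<Rightarrow> laurent fps \<Rightarrow> laurent fps" where
  "fact_act n w F = Abs_fps (\<lambda>k. lact n w (fps_nth F k))"

lemma fact_act_mult:
  assumes "w \<in> signed_perms n"
  shows "fact_act n w (F * G) = fact_act n w F * fact_act n w G"
  by (rule fps_ext) (simp only: fact_act_def fps_mult_nth fps_nth_Abs_fps lact_sum[OF assms] lact_mult[OF assms])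

lemma fact_act_prod:
  assumes "w \<in> signed_perms n"
  shows "fact_act n w (\<Prod>i\<in>A. F i) = (\<Prod>i\<in>A. fact_act n w (F i))"
proof -
  have one: "fact_act n w 1 = 1"
    by (rule fps_ext) (simp only: fact_act_def fps_nth_Abs_fps fps_one_nth if_distrib[of "lact n w"] lact_1[OF assms] lact_0[OF assms])
  show ?thesis by (induction A rule: infinite_finite_induct) (simp_all only: prod.infinite prod.empty prod.insert one fact_act_mult[OF assms] not_False_eq_True)
qed

definition root_factor :: "(nat \<Rightarrow> real) \<Rightarrow> laurent fps" where
  "root_factor u = 1 - fps_X * fps_const (mon u)"

lemma root_factor_nth: "fps_nth (root_factor u) k = (if k = 0 then 1 else if k = 1 then - mon u else 0)"
  by (simp add: root_factor_def)

lemma fact_act_root_factor: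
  assumes "w \<in> signed_perms n"
  shows "fact_act n w (root_factor u) = root_factor (sp_act n (sp_inv n w) u)"
proof (rule fps_ext)
  fix k
  have "lact n w (- mon u) = - mon (sp_act n (sp_inv n w) u)"
  proof -
    have "lact n w (- mon u) + lact n w (mon u) = 0"
      unfolding lact_add[OF assms, symmetric] by (simp only: add.left_inverse lact_0[OF assms])
    then show ?thesis by (simp only: lact_mon[OF assms] eq_neg_iff_add_eq_0)
  qed
  then show "fps_nth (fact_act n w (root_factor u)) k = fps_nth (root_factor (sp_act n (sp_inv n w) u)) k"
    by (simp only: fact_act_def fps_nth_Abs_fps root_factor_nth if_distrib[of "lact n w"] lact_1[OF assms] lact_0[OF assms])
qed

definition alt :: "nat \<Rightarrow> laurent \<Rightarrow> laurent" where
  "alt n f = (\<Sum>w\<in>signed_perms n. of_int (sp_sign n w) * lact n w f)"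

definition alt_fps :: "nat \<Rightarrow> laurent fps \<Rightarrow> laurent fps" where
  "alt_fps n F = Abs_fps (\<lambda>k. alt n (fps_nth F k))"

lemma fps_sum_const_nth:
  fixes c :: "'b \<Rightarrow> 'a :: comm_ring_1"
  shows "fps_nth (\<Sum>w\<in>S. fps_const (c w) * F w) k = (\<Sum>w\<in>S. c w * fps_nth (F w) k)"
  by (simp add: fps_sum_nth)

lemma alt_fps_eq: "alt_fps n F = (\<Sum>w\<in>signed_perms n. fps_const (of_int (sp_sign n w)) * fact_act n w F)"
  by (rule fps_ext) (simp only: alt_fps_def alt_def fps_sum_const_nth fact_act_def fps_nth_Abs_fps)

lemma alt_fps_mult_invariant:
  assumes "\<And>w. w \<in> signed_perms n \<Longrightarrow> fact_act n w G = G"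
  shows "alt_fps n (F * G) = alt_fps n F * G"
  unfolding alt_fps_eq sum_distrib_right
  by (rule sum.cong) (simp_all only: fact_act_mult assms mult.assoc)

lemma alt_sum: "alt n (\<Sum>i\<in>A. f i) = (\<Sum>i\<in>A. alt n (f i))"
proof -
  have "alt n (\<Sum>i\<in>A. f i) = (\<Sum>w\<in>signed_perms n. \<Sum>i\<in>A. of_int (sp_sign n w) * lact n w (f i))"
    unfolding alt_def by (rule sum.cong) (simp_all only: lact_sum sum_distrib_left)
  also have "\<dots> = (\<Sum>i\<in>A. alt n (f i))" unfolding alt_def by (rule sum.swap)
  finally show ?thesis .
qed

lemma lact_of_int: "w \<in> signed_perms n \<Longrightarrow> lact n w (of_int c * f) = of_int c * lact n w f"
proof -
  assume w: "w \<in> signed_perms n"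
  have "lact n w (of_int c) = of_int c"
  proof (rule poly_mapping_eqI)
    fix u
    have "sp_act n w u = 0 \<longleftrightarrow> u = 0"
    proof -
      have "sp_act n w 0 = 0"
        by (rule sp_act_ext[of n]) (simp_all only: sp_act_Suc sp_act_outside zero_fun_apply mult_zero_right not_False_eq_True)
      then show ?thesis using injD[OF inj_sp_act[OF w]] by metis
    qed
    then show "Poly_Mapping.lookup (lact n w (of_int c)) u = Poly_Mapping.lookup (of_int c) u"
      unfolding lookup_lact[OF w] lookup_of_int by simp
  qed
  then show ?thesis by (simp only: lact_mult[OF w])
qed

lemma alt_of_int: "alt n (of_int c * f) = of_int c * alt n f"
  unfolding alt_def sum_distrib_left
  by (rule sum.cong) (simp_all only: lact_of_int mult.left_commute)

lemma lookup_of_int_mult: "Poly_Mapping.lookup (of_int c * f) u = c * Poly_Mapping.lookup f u" for f :: laurent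
proof -
  have "of_int c = (Poly_Mapping.single 0 c :: laurent)"
    by (rule poly_mapping_eqI) (simp add: lookup_of_int lookup_single when_def eq_commute)
  then have "of_int c * f = Poly_Mapping.map ((*) c) f"
    by (simp only: mult_map_scale_conv_mult)
  then show ?thesis by (simp add: map.rep_eq when_def)
qed

lemma lookup_alt: "Poly_Mapping.lookup (alt n f) u = (\<Sum>w\<in>signed_perms n. sp_sign n w * Poly_Mapping.lookup f (sp_act n w u))"
proof -
  have "Poly_Mapping.lookup (alt n f) u = (\<Sum>w\<in>signed_perms n. Poly_Mapping.lookup (of_int (sp_sign n w) * lact n w f) u)"
    unfolding alt_def by (simp add: lookup_sum)
  also have "\<dots> = (\<Sum>w\<in>signed_perms n. sp_sign n w * Poly_Mapping.lookup f (sp_act n w u))"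
    by (rule sum.cong) (simp_all only: lookup_of_int_mult lookup_lact)
  finally show ?thesis .
qed

section \<open>Weyl alternants as alternating sums of monomials\<close>

definition weight_vec :: "nat \<Rightarrow> (nat \<Rightarrow> int) \<Rightarrow> nat \<Rightarrow> real" where
  "weight_vec n l k = (if 1 \<le> k \<and> k \<le> n then of_int (l (k - 1)) else 0)"

definition eps_var :: "nat \<Rightarrow> nat \<Rightarrow> real" where
  "eps_var j = eps_vec (Suc j)"

lemma pw_pow_prod: "(\<Prod>i\<in>A. pw (z i) (f i)) = mon (\<Sum>i\<in>A. (\<lambda>k. of_int (f i) * z i k))"
proof (induction A rule: infinite_finite_induct)
  case (insert i A)
  show ?case by (simp only: prod.insert[OF insert(1,2)] sum.insert[OF insert(1,2)] mon_add insert(3)[unfolded pw_def] pw_def)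
qed (simp_all only: prod.infinite sum.infinite prod.empty sum.empty mon_zero not_False_eq_True)

lemma sum_fun_apply: "(\<Sum>i\<in>A. g i) k = (\<Sum>i\<in>A. g i k)" for g :: "'b \<Rightarrow> 'c \<Rightarrow> real"
  by (induction A rule: infinite_finite_induct) simp_all

text \<open>Leibniz expansion in which every factor \<open>x^l - x^(-l)\<close> selects a sign: a
  permutation together with the selected signs is a signed permutation.\<close>

lemma weyl_alternant_alt: "weyl_alternant n l eps_var = alt n (mon (weight_vec n l))"
proof -
  have "weyl_alternant n l eps_var = (\<Sum>p | p permutes {0..<n}. of_int (sign p) * (\<Prod>i<n. pw_anti (eps_var (p i)) (l i)))"
    unfolding weyl_alternant_def det_mat_sum by simp
  also have "\<dots> = (\<Sum>p | p permutes {0..<n}. \<Sum>c\<in>{..<n} \<rightarrow>\<^sub>E {-1, 1}. of_int (sp_sign n (p, c)) * lact n (p, c) (mon (weight_vec n l)))"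
  proof (rule sum.cong)
    fix p assume "p \<in> {p. p permutes {0..<n}}"
    then have p: "p permutes {0..<n}" by simp
    have "(\<Prod>i<n. pw_anti (eps_var (p i)) (l i)) = (\<Prod>i<n. \<Sum>s\<in>{-1, 1}. of_int s * pw (eps_var (p i)) (s * l i))"
      by (simp add: pw_anti_def)
    also have "\<dots> = (\<Sum>c\<in>{..<n} \<rightarrow>\<^sub>E {-1, 1}. \<Prod>i<n. of_int (c i) * pw (eps_var (p i)) (c i * l i))"
      by (rule prod_sum_PiE) auto
    also have "\<dots> = (\<Sum>c\<in>{..<n} \<rightarrow>\<^sub>E {-1, 1}. of_int (\<Prod>i<n. c i) * lact n (p, c) (mon (weight_vec n l)))"
    proof (rule sum.cong)
      fix c assume c: "c \<in> {..<n} \<rightarrow>\<^sub>E {-1, 1::int}"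
      then have w: "(p, c) \<in> signed_perms n" using p by (simp add: signed_perms_def)
      \<comment> \<open>The exponent selected by \<open>p\<close> and \<open>c\<close>. The signed
        permutation carries it to the original weight, so it is the exponent that
        \<open>lact\<close> produces.\<close>
      let ?b = "\<Sum>i<n. (\<lambda>k. of_int (c i * l i) * eps_var (p i) k)"
      have "sp_act n (p, c) ?b = weight_vec n l"
      proof (rule sp_act_ext[of n])
        fix i assume i: "i < n"
        have "?b (Suc (p i)) = (\<Sum>j<n. if j = i then of_int (c i * l i) else 0)"
          unfolding sum_fun_apply
          by (rule sum.cong) (auto simp: eps_var_def eps_vec_def inj_eq[OF permutes_inj[OF p]])
        also have "\<dots> = of_int (c i * l i)" using i by simp
        finally have "?b (Suc (p i)) = of_int (c i * l i)" .
        moreover have "c i * (c i * l i) = l i" using signed_permsD(3)[OF w i] by (simp add: mult.assoc[symmetric])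
        ultimately show "sp_act n (p, c) ?b (Suc i) = weight_vec n l (Suc i)"
          unfolding sp_act_Suc[OF i] fst_conv snd_conv weight_vec_def using i by (simp add: of_int_mult[symmetric] del: of_int_mult)
      next
        fix k assume k: "\<not> (1 \<le> k \<and> k \<le> n)"
        have "?b k = 0" unfolding sum_fun_apply
        proof (rule sum.neutral, rule ballI)
          fix i assume "i \<in> {..<n}"
          then have "p i < n" using permutes_in_image[OF p, of i] by simp
          then have "k \<noteq> Suc (p i)" using k by auto
          then show "of_int (c i * l i) * eps_var (p i) k = 0" by (simp add: eps_var_def eps_vec_def)
        qed
        then show "sp_act n (p, c) ?b k = weight_vec n l k"
          unfolding sp_act_outside[OF k] weight_vec_def if_not_P[OF k] .
      qed
      then have "lact n (p, c) (mon (weight_vec n l)) = mon ?b" using lact_mon_act[OF w, of ?b] by simp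
      then show "(\<Prod>i<n. of_int (c i) * pw (eps_var (p i)) (c i * l i)) = of_int (\<Prod>i<n. c i) * lact n (p, c) (mon (weight_vec n l))"
        unfolding prod.distrib pw_pow_prod by simp
    qed simp
    finally show "of_int (sign p) * (\<Prod>i<n. pw_anti (eps_var (p i)) (l i)) =
      (\<Sum>c\<in>{..<n} \<rightarrow>\<^sub>E {-1, 1}. of_int (sp_sign n (p, c)) * lact n (p, c) (mon (weight_vec n l)))"
      by (simp only: sp_sign_def fst_conv snd_conv sum_distrib_left of_int_mult mult.assoc)
  qed simp
  also have "\<dots> = alt n (mon (weight_vec n l))"
    unfolding alt_def signed_perms_def by (subst sum.cartesian_product) (simp add: case_prod_unfold)
  finally show ?thesis .
qed

text \<open>If some exponent is 0 or two agree in absolute value, the determinant vanishes.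
  Otherwise the absolute values are a rearrangement of \<open>1..n\<close>, and signs and
  rearrangement only contribute an integer factor.\<close>

lemma weyl_alternant_small:
  assumes small: "\<And>i. i < n \<Longrightarrow> \<bar>l i\<bar> \<le> int n"
  shows "\<exists>c. weyl_alternant n l v = of_int c * weyl_alternant n (\<lambda>i. int n - int i) v"
proof (cases "(\<exists>i<n. l i = 0) \<or> (\<exists>i<n. \<exists>j<n. i \<noteq> j \<and> \<bar>l i\<bar> = \<bar>l j\<bar>)")
  case True
  have anti: "pw_anti x (s * m) = of_int s * pw_anti x m" if "s = 1 \<or> s = -1" for x s m
    using that by (auto simp: pw_anti_def)
  have "weyl_alternant n l v = 0"
    using True
  proof
    assume "\<exists>i<n. l i = 0"
    then obtain i where i: "i < n" "l i = 0" by blast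
    then obtain m where m: "n = Suc m" by (metis gr0_conv_Suc not_gr_zero not_less_zero)
    show ?thesis unfolding weyl_alternant_def m
      by (subst det_mat_row[of i]) (use i m in \<open>simp_all add: pw_anti_def\<close>)
  next
    assume "\<exists>i<n. \<exists>j<n. i \<noteq> j \<and> \<bar>l i\<bar> = \<bar>l j\<bar>"
    then obtain i j where ij: "i < n" "j < n" "i \<noteq> j" "\<bar>l i\<bar> = \<bar>l j\<bar>" by blast
    have 0: "weyl_alternant n (\<lambda>i. \<bar>l i\<bar>) v = 0"
      unfolding weyl_alternant_def by (rule det_mat_equal_rows[of i _ j]) (use ij in simp_all)
    let ?s = "\<lambda>i. if l i < 0 then -1 else 1 :: int"
    have "weyl_alternant n l v = det (mat n n (\<lambda>(i, j). of_int (?s i) * (\<lambda>(i, j). pw_anti (v j) \<bar>l i\<bar>) (i, j)))"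
      unfolding weyl_alternant_def by (rule det_mat_cong) (auto simp: pw_anti_def)
    also have "\<dots> = (\<Prod>j<n. of_int (?s j)) * weyl_alternant n (\<lambda>i. \<bar>l i\<bar>) v"
      unfolding weyl_alternant_def by (rule det_mat_scale_rows)
    finally show ?thesis using 0 by simp
  qed
  then show ?thesis by (intro exI[of _ 0]) simp
next
  case False
  then have nz: "l i \<noteq> 0" if "i < n" for i using that by blast
  have dist: "\<bar>l i\<bar> \<noteq> \<bar>l j\<bar>" if "i < n" "j < n" "i \<noteq> j" for i j using False that by blast
  define q where "q i = (if i < n then n - nat \<bar>l i\<bar> else i)" for i
  have qi: "int n - int (q i) = \<bar>l i\<bar>" if "i < n" for i using small[OF that] that by (simp add: q_def)
  have qlt: "q i < n" if "i < n" for i using nz[OF that] that by (simp add: q_def)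
  have "inj_on q {0..<n}"
  proof (rule inj_onI, rule ccontr)
    fix i j assume "i \<in> {0..<n}" "j \<in> {0..<n}" "q i = q j" "i \<noteq> j"
    then show False using qi[of i] qi[of j] dist[of i j] by simp
  qed
  moreover have "q ` {0..<n} \<subseteq> {0..<n}" using qlt by auto
  ultimately have "bij_betw q {0..<n} {0..<n}"
    by (simp add: bij_betw_def endo_inj_surj)
  then have q: "q permutes {0..<n}" by (rule bij_imp_permutes) (simp add: q_def)
  let ?s = "\<lambda>i. if l i < 0 then -1 else 1 :: int"
  let ?A = "mat n n (\<lambda>(i, j). pw_anti (v j) (int n - int i))"
  have "weyl_alternant n l v = det (mat n n (\<lambda>(i, j). of_int (?s i) * (\<lambda>(i, j). pw_anti (v j) \<bar>l i\<bar>) (i, j)))"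
    unfolding weyl_alternant_def by (rule det_mat_cong) (auto simp: pw_anti_def)
  also have "\<dots> = (\<Prod>j<n. of_int (?s j)) * det (mat n n (\<lambda>(i, j). pw_anti (v j) \<bar>l i\<bar>))"
    by (rule det_mat_scale_rows)
  also have "mat n n (\<lambda>(i, j). pw_anti (v j) \<bar>l i\<bar>) = mat n n (\<lambda>(i, j). ?A $$ (q i, j))"
    by (rule eq_matI) (use qi qlt in auto)
  also have "det \<dots> = signof q * det ?A"
    by (rule det_permute_rows[OF _ q]) simp
  finally have "weyl_alternant n l v = of_int ((\<Prod>j<n. ?s j) * sign q) * weyl_alternant n (\<lambda>i. int n - int i) v"
    unfolding weyl_alternant_def by (simp add: mult.assoc)
  then show ?thesis by blast
qed

section \<open>Positive roots by induction on the rank\<close>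

lemma eps_var_Suc [simp]: "eps_var i (Suc j) = (if j = i then 1 else 0)"
  by (simp add: eps_var_def eps_vec_def)

lemma eps_var_0 [simp]: "eps_var i 0 = 0"
  by (simp add: eps_var_def eps_vec_def)

lemma pos_rootsI:
  "i < j \<Longrightarrow> j < n \<Longrightarrow> (\<lambda>k. eps_var i k - eps_var j k) \<in> pos_roots n"
  "i < j \<Longrightarrow> j < n \<Longrightarrow> (\<lambda>k. eps_var i k + eps_var j k) \<in> pos_roots n"
  "i < n \<Longrightarrow> (\<lambda>k. 2 * eps_var i k) \<in> pos_roots n"
proof -
  assume "i < n"
  then have "1 \<le> Suc i" "Suc i \<le> n" by auto
  then show "(\<lambda>k. 2 * eps_var i k) \<in> pos_roots n"
    unfolding pos_roots_def eps_var_def by blast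
next
  assume "i < j" "j < n"
  then have "1 \<le> Suc i" "Suc i < Suc j" "Suc j \<le> n" by auto
  then show "(\<lambda>k. eps_var i k - eps_var j k) \<in> pos_roots n" "(\<lambda>k. eps_var i k + eps_var j k) \<in> pos_roots n"
    unfolding pos_roots_def eps_var_def by blast+
qed

lemma pos_roots_cases:
  assumes "\<alpha> \<in> pos_roots n"
  obtains i j where "\<alpha> = (\<lambda>k. eps_var i k - eps_var j k)" "i < j" "j < n"
    | i j where "\<alpha> = (\<lambda>k. eps_var i k + eps_var j k)" "i < j" "j < n"
    | i where "\<alpha> = (\<lambda>k. 2 * eps_var i k)" "i < n"
proof -
  consider i j where "\<alpha> = (\<lambda>k. eps_vec i k - eps_vec j k)" "1 \<le> i" "i < j" "j \<le> n"
    | i j where "\<alpha> = (\<lambda>k. eps_vec i k + eps_vec j k)" "1 \<le> i" "i < j" "j \<le> n"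
    | i where "\<alpha> = (\<lambda>k. 2 * eps_vec i k)" "1 \<le> i" "i \<le> n"
    using assms unfolding pos_roots_def by blast
  then show thesis
  proof cases
    case (1 i j)
    show ?thesis by (rule that(1)[of "i - 1" "j - 1"]) (use 1 in \<open>simp_all add: eps_var_def\<close>)
  next
    case (2 i j)
    show ?thesis by (rule that(2)[of "i - 1" "j - 1"]) (use 2 in \<open>simp_all add: eps_var_def\<close>)
  next
    case (3 i)
    show ?thesis by (rule that(3)[of "i - 1"]) (use 3 in \<open>simp_all add: eps_var_def\<close>)
  qed
qed

lemma eps_var_outside: "i < n \<Longrightarrow> \<not> (1 \<le> k \<and> k \<le> n) \<Longrightarrow> eps_var i k = 0"
  by (cases k) auto

lemma pos_roots_outside:
  assumes "\<alpha> \<in> pos_roots n" and k: "\<not> (1 \<le> k \<and> k \<le> n)"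
  shows "\<alpha> k = 0"
  using assms(1)
proof (cases rule: pos_roots_cases)
  case (1 i j)
  then show ?thesis using eps_var_outside[OF _ k, of i] eps_var_outside[OF _ k, of j] by simp
next
  case (2 i j)
  then show ?thesis using eps_var_outside[OF _ k, of i] eps_var_outside[OF _ k, of j] by simp
next
  case (3 i)
  then show ?thesis using eps_var_outside[OF _ k, of i] by simp
qed

lemma pos_roots_Suc:
  "pos_roots (Suc n) = pos_roots n \<union> ((\<lambda>i k. eps_var i k - eps_var n k) ` {..<n} \<union>
     (\<lambda>i k. eps_var i k + eps_var n k) ` {..<n} \<union> {\<lambda>k. 2 * eps_var n k})" (is "_ = ?R")
proof (intro equalityI subsetI)
  fix \<alpha> assume "\<alpha> \<in> pos_roots (Suc n)"
  then show "\<alpha> \<in> ?R"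
  proof (cases rule: pos_roots_cases)
    case (1 i j)
    show ?thesis
    proof (cases "j = n")
      case True then show ?thesis using 1 by blast
    next
      case False
      then have "\<alpha> \<in> pos_roots n" unfolding 1(1) using 1 by (intro pos_rootsI) auto
      then show ?thesis ..
    qed
  next
    case (2 i j)
    show ?thesis
    proof (cases "j = n")
      case True then show ?thesis using 2 by blast
    next
      case False
      then have "\<alpha> \<in> pos_roots n" unfolding 2(1) using 2 by (intro pos_rootsI) auto
      then show ?thesis ..
    qed
  next
    case (3 i)
    show ?thesis
    proof (cases "i = n")
      case True then show ?thesis using 3 by blast
    next
      case False
      then have "\<alpha> \<in> pos_roots n" unfolding 3(1) using 3 by (intro pos_rootsI) auto
      then show ?thesis ..
    qed
  qed
next
  fix \<alpha> assume "\<alpha> \<in> ?R"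
  then consider "\<alpha> \<in> pos_roots n" | i where "i < n" "\<alpha> = (\<lambda>k. eps_var i k - eps_var n k)"
    | i where "i < n" "\<alpha> = (\<lambda>k. eps_var i k + eps_var n k)" | "\<alpha> = (\<lambda>k. 2 * eps_var n k)"
    by blast
  then show "\<alpha> \<in> pos_roots (Suc n)"
  proof cases
    case 1
    then show ?thesis
    proof (cases rule: pos_roots_cases)
      case (1 i j) show ?thesis unfolding 1(1) by (rule pos_rootsI) (use 1 in simp_all)
    next
      case (2 i j) show ?thesis unfolding 2(1) by (rule pos_rootsI) (use 2 in simp_all)
    next
      case (3 i) show ?thesis unfolding 3(1) by (rule pos_rootsI) (use 3 in simp_all)
    qed
  next
    case (2 i) show ?thesis unfolding 2(2) by (rule pos_rootsI) (use 2 in simp_all)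
  next
    case (3 i) show ?thesis unfolding 3(2) by (rule pos_rootsI) (use 3 in simp_all)
  next
    case 4 show ?thesis unfolding 4 by (rule pos_rootsI) simp
  qed
qed

text \<open>Proved in the locale of set operations, so that one proof serves sums over roots (for
  \<rho> and its bounds) and products of root factors. The new coordinate tells the pieces apart: it
  is 0 on the old roots and -1, 1 and 2 on the three kinds of new ones.\<close>

lemma (in comm_monoid_set) pos_roots_Suc:
  "F g (pos_roots (Suc n)) = (F g (pos_roots n) \<^bold>*
     F (\<lambda>i. g (\<lambda>k. eps_var i k - eps_var n k) \<^bold>* g (\<lambda>k. eps_var i k + eps_var n k)) {..<n}) \<^bold>* g (\<lambda>k. 2 * eps_var n k)"
proof -
  let ?A = "(\<lambda>i k. eps_var i k - eps_var n k) ` {..<n}" and ?B = "(\<lambda>i k. eps_var i k + eps_var n k) ` {..<n}"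
    and ?c = "\<lambda>k. 2 * eps_var n k"
  have at: "\<alpha> (Suc n) = 0" if "\<alpha> \<in> pos_roots n" for \<alpha> using pos_roots_outside[OF that, of "Suc n"] by simp
  have a: "\<alpha> (Suc n) = -1" if "\<alpha> \<in> ?A" for \<alpha>
  proof -
    obtain i where "i < n" "\<alpha> = (\<lambda>k. eps_var i k - eps_var n k)" using \<open>\<alpha> \<in> ?A\<close> by blast
    then show ?thesis by simp
  qed
  have b: "\<alpha> (Suc n) = 1" if "\<alpha> \<in> ?B" for \<alpha>
  proof -
    obtain i where "i < n" "\<alpha> = (\<lambda>k. eps_var i k + eps_var n k)" using \<open>\<alpha> \<in> ?B\<close> by blast
    then show ?thesis by simp
  qed
  have c: "?c (Suc n) = 2" by simp
  have iA: "inj_on (\<lambda>i k. eps_var i k - eps_var n k) {..<n}"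
  proof (rule inj_onI)
    fix i j assume "i \<in> {..<n}" "j \<in> {..<n}" and eq: "(\<lambda>k. eps_var i k - eps_var n k) = (\<lambda>k. eps_var j k - eps_var n k)"
    then show "i = j" using fun_cong[OF eq, of "Suc i"] by (simp split: if_splits)
  qed
  have iB: "inj_on (\<lambda>i k. eps_var i k + eps_var n k) {..<n}"
  proof (rule inj_onI)
    fix i j assume "i \<in> {..<n}" "j \<in> {..<n}" and eq: "(\<lambda>k. eps_var i k + eps_var n k) = (\<lambda>k. eps_var j k + eps_var n k)"
    then show "i = j" using fun_cong[OF eq, of "Suc i"] by (simp split: if_splits)
  qed
  have d1: "?A \<inter> ?B = {}"
  proof (rule equals0I)
    fix \<alpha> assume "\<alpha> \<in> ?A \<inter> ?B"
    then have "\<alpha> (Suc n) = -1" "\<alpha> (Suc n) = 1" using a b by blast+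
    then show False by simp
  qed
  have d2: "(?A \<union> ?B) \<inter> {?c} = {}"
  proof (rule equals0I)
    fix \<alpha> assume "\<alpha> \<in> (?A \<union> ?B) \<inter> {?c}"
    then have ab: "\<alpha> \<in> ?A \<or> \<alpha> \<in> ?B" and "\<alpha> = ?c" by blast+
    from this(2) have "\<alpha> (Suc n) = 2" using c by simp
    moreover have "\<alpha> (Suc n) = -1 \<or> \<alpha> (Suc n) = 1" using ab a b by blast
    ultimately show False by simp
  qed
  have d3: "pos_roots n \<inter> (?A \<union> ?B \<union> {?c}) = {}"
  proof (rule equals0I)
    fix \<alpha> assume "\<alpha> \<in> pos_roots n \<inter> (?A \<union> ?B \<union> {?c})"
    then have p: "\<alpha> \<in> pos_roots n" and "\<alpha> \<in> ?A \<or> \<alpha> \<in> ?B \<or> \<alpha> = ?c" by blast+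
    from this(2) have "\<alpha> (Suc n) \<noteq> 0"
    proof (elim disjE)
      assume "\<alpha> \<in> ?A" from a[OF this] show "\<alpha> (Suc n) \<noteq> 0" by simp
    next
      assume "\<alpha> \<in> ?B" from b[OF this] show "\<alpha> (Suc n) \<noteq> 0" by simp
    next
      assume "\<alpha> = ?c" then show "\<alpha> (Suc n) \<noteq> 0" using c by simp
    qed
    then show False using at[OF p] by simp
  qed
  have "F g (pos_roots (Suc n)) = F g (pos_roots n) \<^bold>* F g (?A \<union> ?B \<union> {?c})"
    unfolding pos_roots_Suc by (rule union_disjoint[OF finite_pos_roots _ d3]) simp
  also have "F g (?A \<union> ?B \<union> {?c}) = F g (?A \<union> ?B) \<^bold>* F g {?c}"
    by (rule union_disjoint[OF _ _ d2]) simp_all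
  also have "F g (?A \<union> ?B) = F g ?A \<^bold>* F g ?B"
    by (rule union_disjoint[OF _ _ d1]) simp_all
  also have "F g ?A \<^bold>* F g ?B = F (\<lambda>i. g (\<lambda>k. eps_var i k - eps_var n k) \<^bold>* g (\<lambda>k. eps_var i k + eps_var n k)) {..<n}"
    unfolding reindex[OF iA] reindex[OF iB] comp_def distrib ..
  finally show ?thesis by (simp add: assoc)
qed

lemma pos_roots_0: "pos_roots 0 = {}"
  by (auto simp: pos_roots_def)

lemma rho_eq: "rho n = weight_vec n (\<lambda>i. int n - int i)"
proof
  fix k
  have "(\<Sum>\<alpha>\<in>pos_roots n. \<alpha> k) = 2 * weight_vec n (\<lambda>i. int n - int i) k"
  proof (induction n)
    case 0
    then show ?case by (simp add: pos_roots_0 weight_vec_def)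
  next
    case (Suc n)
    have "(\<Sum>i<n. (eps_var i k - eps_var n k) + (eps_var i k + eps_var n k)) = 2 * (\<Sum>i<n. eps_var i k)"
      by (simp add: sum_distrib_left)
    also have "(\<Sum>i<n. eps_var i k) = (if 1 \<le> k \<and> k \<le> n then 1 else 0)"
      by (cases k) (simp_all add: Suc_le_eq)
    finally show ?case unfolding sum.pos_roots_Suc Suc.IH
      by (cases k) (auto simp: weight_vec_def)
  qed
  then show "rho n k = weight_vec n (\<lambda>i. int n - int i) k" by (simp add: rho_def)
qed

text \<open>A coordinate occurs with absolute value 1 in the \<open>2 (n - 1)\<close> roots that
  pair it with another one, and with value 2 in its long root.\<close>

lemma sum_abs_pos_roots: "(\<Sum>\<alpha>\<in>pos_roots n. \<bar>\<alpha> k\<bar>) = (if 1 \<le> k \<and> k \<le> n then 2 * real n else 0)"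
proof (induction n)
  case 0
  then show ?case by (simp add: pos_roots_0)
next
  case (Suc n)
  have "(\<Sum>i<n. \<bar>eps_var i k - eps_var n k\<bar> + \<bar>eps_var i k + eps_var n k\<bar>) =
     (if 1 \<le> k \<and> k \<le> n then 2 else if k = Suc n then 2 * real n else 0)"
  proof (cases "k = Suc n")
    case True
    have "(\<Sum>i<n. \<bar>eps_var i k - eps_var n k\<bar> + \<bar>eps_var i k + eps_var n k\<bar>) = (\<Sum>i<n. 2 :: real)"
      by (rule sum.cong) (use True in auto)
    then show ?thesis using True by simp
  next
    case False
    have "eps_var n k = 0" using False by (cases k) auto
    then have "(\<Sum>i<n. \<bar>eps_var i k - eps_var n k\<bar> + \<bar>eps_var i k + eps_var n k\<bar>) = (\<Sum>i<n. if i = k - 1 \<and> k \<noteq> 0 then 2 else 0)"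
      by (intro sum.cong) (cases k; auto)+
    also have "\<dots> = (if 1 \<le> k \<and> k \<le> n then 2 else 0)"
      by (cases k) (simp_all add: Suc_le_eq)
    finally show ?thesis using False by simp
  qed
  then show ?case unfolding sum.pos_roots_Suc Suc.IH
    by (cases k) auto
qed

lemma pos_roots_int: "\<alpha> \<in> pos_roots n \<Longrightarrow> \<alpha> k \<in> \<int>"
  by (cases rule: pos_roots_cases, assumption; cases k) auto

text \<open>Twice this vector is the sum of the roots outside \<open>S\<close> minus the sum of
  those inside, so the bound follows from \<open>sum_abs_pos_roots\<close>.\<close>

lemma rho_minus_subset:
  assumes S: "S \<subseteq> pos_roots n"
  shows "\<exists>l. rho n - sum (\<lambda>\<alpha>. \<alpha>) S = weight_vec n l \<and> (\<forall>i<n. \<bar>l i\<bar> \<le> int n)"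
proof -
  define v where "v = rho n - sum (\<lambda>\<alpha>. \<alpha>) S"
  have vk: "v k = rho n k - (\<Sum>\<alpha>\<in>S. \<alpha> k)" for k
    by (simp only: v_def minus_apply sum_fun_apply[of "\<lambda>\<alpha>. \<alpha>" S k])
  have int: "v k \<in> \<int>" for k
  proof -
    have "rho n k \<in> \<int>" unfolding rho_eq weight_vec_def by simp
    moreover have "(\<Sum>\<alpha>\<in>S. \<alpha> k) \<in> \<int>" using S pos_roots_int by (intro Ints_sum) blast
    ultimately show ?thesis unfolding vk by (rule Ints_diff)
  qed
  have bound: "\<bar>v k\<bar> \<le> real n" if k: "1 \<le> k" "k \<le> n" for k
  proof -
    have fin: "finite (pos_roots n)" by (rule finite_pos_roots)
    have "2 * v k = (\<Sum>\<alpha>\<in>pos_roots n. \<alpha> k) - 2 * (\<Sum>\<alpha>\<in>S. \<alpha> k)" unfolding vk rho_def by simp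
    also have "(\<Sum>\<alpha>\<in>pos_roots n. \<alpha> k) = (\<Sum>\<alpha>\<in>pos_roots n - S. \<alpha> k) + (\<Sum>\<alpha>\<in>S. \<alpha> k)"
      by (rule sum.subset_diff[OF S fin])
    finally have "2 * v k = (\<Sum>\<alpha>\<in>pos_roots n - S. \<alpha> k) - (\<Sum>\<alpha>\<in>S. \<alpha> k)" by simp
    then have "\<bar>2 * v k\<bar> \<le> \<bar>\<Sum>\<alpha>\<in>pos_roots n - S. \<alpha> k\<bar> + \<bar>\<Sum>\<alpha>\<in>S. \<alpha> k\<bar>" by linarith
    also have "\<dots> \<le> (\<Sum>\<alpha>\<in>pos_roots n - S. \<bar>\<alpha> k\<bar>) + (\<Sum>\<alpha>\<in>S. \<bar>\<alpha> k\<bar>)"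
      by (intro add_mono sum_abs)
    also have "\<dots> = (\<Sum>\<alpha>\<in>pos_roots n. \<bar>\<alpha> k\<bar>)"
      by (rule sum.subset_diff[OF S fin, symmetric])
    also have "\<dots> = 2 * real n" using k by (simp add: sum_abs_pos_roots)
    finally show ?thesis by linarith
  qed
  have out: "v k = 0" if "\<not> (1 \<le> k \<and> k \<le> n)" for k
  proof -
    have "(\<Sum>\<alpha>\<in>S. \<alpha> k) = 0" by (rule sum.neutral) (use S pos_roots_outside[OF _ that] in blast)
    then show ?thesis unfolding vk rho_eq weight_vec_def if_not_P[OF that] by simp
  qed
  let ?l = "\<lambda>i. \<lfloor>v (Suc i)\<rfloor>"
  have fl: "of_int \<lfloor>v k\<rfloor> = v k" for k using int[of k] by (auto elim!: Ints_cases)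
  have "v = weight_vec n ?l"
  proof
    fix k show "v k = weight_vec n ?l k"
    proof (cases "1 \<le> k \<and> k \<le> n")
      case True
      then have "Suc (k - 1) = k" by simp
      then show ?thesis using fl[of k] True by (simp only: weight_vec_def if_P)
    next
      case False
      show ?thesis unfolding weight_vec_def if_not_P[OF False] by (rule out[OF False])
    qed
  qed
  moreover have "\<bar>?l i\<bar> \<le> int n" if "i < n" for i
  proof -
    have "real_of_int \<bar>?l i\<bar> \<le> real n" unfolding of_int_abs fl by (rule bound) (use that in simp_all)
    then show ?thesis by linarith
  qed
  ultimately show ?thesis unfolding v_def by blast
qed

lemma alt_rho_minus_subset:
  assumes "S \<subseteq> pos_roots n"
  shows "\<exists>c. alt n (mon (rho n - sum (\<lambda>\<alpha>. \<alpha>) S)) = of_int c * weyl_alternant n (\<lambda>i. int n - int i) eps_var"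
proof -
  obtain l where l: "rho n - sum (\<lambda>\<alpha>. \<alpha>) S = weight_vec n l" "\<forall>i<n. \<bar>l i\<bar> \<le> int n"
    using rho_minus_subset[OF assms] by blast
  show ?thesis unfolding l(1) weyl_alternant_alt[symmetric]
    by (rule weyl_alternant_small) (use l(2) in blast)
qed

definition lift_int :: "int fps \<Rightarrow> laurent fps" where
  "lift_int c = Abs_fps (\<lambda>k. of_int (fps_nth c k))"

lemma lift_int_mult: "lift_int (c * d) = lift_int c * lift_int d"
  by (rule fps_ext) (simp add: lift_int_def fps_mult_nth)

lemma lift_int_one_minus_X: "lift_int (1 - fps_X) = 1 - fps_X"
  by (rule fps_ext) (simp add: lift_int_def)

lemma lift_int_one: "lift_int 1 = 1"
  by (rule fps_ext) (simp add: lift_int_def)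

lemma lift_int_one_minus_X_power: "lift_int ((1 - fps_X) ^ n) = (1 - fps_X) ^ n"
  by (induction n) (simp_all only: power_0 power_Suc lift_int_one lift_int_mult lift_int_one_minus_X)

lemma mon_uminus_sum: "(\<Prod>\<alpha>\<in>S. mon (- \<alpha>)) = mon (- sum (\<lambda>\<alpha>. \<alpha>) S)"
proof (induction S rule: infinite_finite_induct)
  case (insert x S)
  show ?case by (simp only: prod.insert[OF insert(1,2)] sum.insert[OF insert(1,2)] insert(3) mon_add[symmetric] minus_add_distrib)
qed (simp_all only: prod.infinite sum.infinite prod.empty sum.empty mon_zero neg_equal_0_iff_equal minus_zero not_False_eq_True)

text \<open>Expanding the product over subsets \<open>S\<close> of the positive roots produces only
  exponents \<open>\<rho>\<close> minus a sum of distinct positive roots. These are small, so each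
  alternating sum is an integer multiple of the Weyl denominator; the multiples collected by powers
  of t form \<open>c\<close> (the Poincare polynomial of the Weyl group, by Macdonald's
  identity).\<close>

lemma alt_macdonald:
  "\<exists>c. alt_fps n (fps_const (mon (rho n)) * (\<Prod>\<alpha>\<in>pos_roots n. root_factor (- \<alpha>))) =
     lift_int c * fps_const (weyl_alternant n (\<lambda>i. int n - int i) eps_var)"
proof -
  let ?a = "weyl_alternant n (\<lambda>i. int n - int i) eps_var"
  define c where "c S = (SOME c. alt n (mon (rho n - sum (\<lambda>\<alpha>. \<alpha>) S)) = of_int c * ?a)" for S
  have c: "alt n (mon (rho n - sum (\<lambda>\<alpha>. \<alpha>) S)) = of_int (c S) * ?a" if "S \<subseteq> pos_roots n" for S
    unfolding c_def by (rule someI_ex[OF alt_rho_minus_subset[OF that]])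
  have "(\<Prod>\<alpha>\<in>pos_roots n. root_factor (- \<alpha>)) = (\<Prod>\<alpha>\<in>pos_roots n. fps_const (- mon (- \<alpha>)) * fps_X + 1)"
  proof (rule prod.cong)
    fix \<alpha> show "root_factor (- \<alpha>) = fps_const (- mon (- \<alpha>)) * fps_X + 1"
      unfolding root_factor_def fps_const_neg[symmetric] mult_minus_left mult.commute[of fps_X]
      by (simp only: add.commute[of _ 1] diff_conv_add_uminus)
  qed simp
  also have "\<dots> = (\<Sum>S\<in>Pow (pos_roots n). \<Prod>\<alpha>\<in>S. fps_const (- mon (- \<alpha>)) * fps_X)"
    by (subst prod_add[OF finite_pos_roots]) simp
  also have "\<dots> = (\<Sum>S\<in>Pow (pos_roots n). fps_const (of_int ((-1) ^ card S) * mon (- sum (\<lambda>\<alpha>. \<alpha>) S)) * fps_X ^ card S)"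
  proof (rule sum.cong)
    fix S assume "S \<in> Pow (pos_roots n)"
    have "(\<Prod>\<alpha>\<in>S. - mon (- \<alpha>)) = (-1) ^ card S * (\<Prod>\<alpha>\<in>S. mon (- \<alpha>))"
      by (simp add: prod_uminus)
    then have "(\<Prod>\<alpha>\<in>S. - mon (- \<alpha>)) = of_int ((-1) ^ card S) * mon (- sum (\<lambda>\<alpha>. \<alpha>) S)"
      unfolding mon_uminus_sum by simp
    then show "(\<Prod>\<alpha>\<in>S. fps_const (- mon (- \<alpha>)) * fps_X) = fps_const (of_int ((-1) ^ card S) * mon (- sum (\<lambda>\<alpha>. \<alpha>) S)) * fps_X ^ card S"
      by (simp only: prod.distrib prod_constant fps_const_prod)
  qed simp
  finally have P: "(\<Prod>\<alpha>\<in>pos_roots n. root_factor (- \<alpha>)) = \<dots>" .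
  have nth: "fps_nth (fps_const (mon (rho n)) * (\<Prod>\<alpha>\<in>pos_roots n. root_factor (- \<alpha>))) k =
     (\<Sum>S\<in>Pow (pos_roots n). of_int (of_bool (card S = k) * (-1) ^ card S) * mon (rho n - sum (\<lambda>\<alpha>. \<alpha>) S))" for k
    unfolding P sum_distrib_left fps_sum_nth
  proof (rule sum.cong)
    fix S assume "S \<in> Pow (pos_roots n)"
    have m: "mon (rho n - sum (\<lambda>\<alpha>. \<alpha>) S) = mon (rho n) * mon (- sum (\<lambda>\<alpha>. \<alpha>) S)"
      unfolding mon_add[symmetric] by (rule arg_cong[where f = mon]) (simp only: diff_conv_add_uminus)
    show "fps_nth (fps_const (mon (rho n)) * (fps_const (of_int ((-1) ^ card S) * mon (- sum (\<lambda>\<alpha>. \<alpha>) S)) * fps_X ^ card S)) k =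
      of_int (of_bool (card S = k) * (-1) ^ card S) * mon (rho n - sum (\<lambda>\<alpha>. \<alpha>) S)"
      unfolding m by (simp add: mult.assoc[symmetric] fps_mult_right_const_nth fps_X_power_nth)
  qed simp
  define d where "d = Abs_fps (\<lambda>k. \<Sum>S\<in>Pow (pos_roots n). of_bool (card S = k) * (-1) ^ card S * c S)"
  have "alt_fps n (fps_const (mon (rho n)) * (\<Prod>\<alpha>\<in>pos_roots n. root_factor (- \<alpha>))) = lift_int d * fps_const ?a"
  proof (rule fps_ext)
    fix k
    have "fps_nth (alt_fps n (fps_const (mon (rho n)) * (\<Prod>\<alpha>\<in>pos_roots n. root_factor (- \<alpha>)))) k =
      (\<Sum>S\<in>Pow (pos_roots n). of_int (of_bool (card S = k) * (-1) ^ card S) * alt n (mon (rho n - sum (\<lambda>\<alpha>. \<alpha>) S)))"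
      unfolding alt_fps_def fps_nth_Abs_fps nth alt_sum alt_of_int ..
    also have "\<dots> = (\<Sum>S\<in>Pow (pos_roots n). of_int (of_bool (card S = k) * (-1) ^ card S * c S) * ?a)"
    proof (rule sum.cong)
      fix S assume "S \<in> Pow (pos_roots n)"
      then have "alt n (mon (rho n - sum (\<lambda>\<alpha>. \<alpha>) S)) = of_int (c S) * ?a" by (intro c) blast
      then show "of_int (of_bool (card S = k) * (-1) ^ card S) * alt n (mon (rho n - sum (\<lambda>\<alpha>. \<alpha>) S)) =
        of_int (of_bool (card S = k) * (-1) ^ card S * c S) * ?a"
        by (simp only: of_int_mult mult.assoc)
    qed simp
    also have "\<dots> = of_int (\<Sum>S\<in>Pow (pos_roots n). of_bool (card S = k) * (-1) ^ card S * c S) * ?a"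
      by (simp only: of_int_sum sum_distrib_right)
    also have "\<dots> = fps_nth (lift_int d * fps_const ?a) k"
      by (simp only: lift_int_def d_def fps_mult_right_const_nth fps_nth_Abs_fps)
    finally show "fps_nth (alt_fps n (fps_const (mon (rho n)) * (\<Prod>\<alpha>\<in>pos_roots n. root_factor (- \<alpha>)))) k =
      fps_nth (lift_int d * fps_const ?a) k" .
  qed
  then show ?thesis by blast
qed

section \<open>The product over all roots and its invariance\<close>

definition all_roots :: "nat \<Rightarrow> (nat \<Rightarrow> real) set" where
  "all_roots n = {\<lambda>k. of_int s * eps_var i k + of_int t * eps_var j k | i j s t.
     i < n \<and> j < n \<and> s \<in> {-1, 1::int} \<and> t \<in> {-1, 1::int} \<and> (i = j \<longrightarrow> s = t)}"

lemma all_rootsI: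
  assumes "\<And>k. \<alpha> k = of_int s * eps_var i k + of_int t * eps_var j k"
    "i < n" "j < n" "s \<in> {-1, 1::int}" "t \<in> {-1, 1::int}" "i = j \<longrightarrow> s = t"
  shows "\<alpha> \<in> all_roots n"
proof -
  have "\<alpha> = (\<lambda>k. of_int s * eps_var i k + of_int t * eps_var j k)" using assms(1) by (rule ext)
  then show ?thesis unfolding all_roots_def using assms(2-) by blast
qed

lemma pos_roots_subset_all_roots: "pos_roots n \<subseteq> all_roots n"
proof
  fix \<alpha> assume "\<alpha> \<in> pos_roots n"
  then show "\<alpha> \<in> all_roots n"
  proof (cases rule: pos_roots_cases)
    case (1 i j)
    show ?thesis by (rule all_rootsI[of _ 1 i "-1" j]) (use 1 in simp_all)
  next
    case (2 i j)
    show ?thesis by (rule all_rootsI[of _ 1 i 1 j]) (use 2 in simp_all)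
  next
    case (3 i)
    show ?thesis by (rule all_rootsI[of _ 1 i 1 i]) (use 3 in simp_all)
  qed
qed

lemma uminus_all_roots:
  assumes "\<alpha> \<in> all_roots n"
  shows "- \<alpha> \<in> all_roots n"
proof -
  obtain i j s t where a: "\<alpha> = (\<lambda>k. of_int s * eps_var i k + of_int t * eps_var j k)"
    "i < n" "j < n" "s \<in> {-1, 1::int}" "t \<in> {-1, 1::int}" "i = j \<longrightarrow> s = t"
    using assms unfolding all_roots_def by blast
  show ?thesis
    by (rule all_rootsI[of _ "- s" i "- t" j]) (use a in auto)
qed

lemma all_roots_eq: "all_roots n = pos_roots n \<union> uminus ` pos_roots n"
proof
  show "pos_roots n \<union> uminus ` pos_roots n \<subseteq> all_roots n"
    using pos_roots_subset_all_roots uminus_all_roots by blast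
  note A = pos_rootsI(1) and B = pos_rootsI(2) and C = pos_rootsI(3)
  show "all_roots n \<subseteq> pos_roots n \<union> uminus ` pos_roots n"
  proof
    fix \<alpha> assume "\<alpha> \<in> all_roots n"
    then obtain i j s t where a: "\<alpha> = (\<lambda>k. of_int s * eps_var i k + of_int t * eps_var j k)"
      "i < n" "j < n" "s \<in> {-1, 1::int}" "t \<in> {-1, 1::int}" "i = j \<longrightarrow> s = t"
      unfolding all_roots_def by blast
    have neg: "\<alpha> \<in> uminus ` pos_roots n" if "(\<lambda>k. - \<alpha> k) \<in> pos_roots n"
    proof (rule image_eqI[OF _ that])
      show "\<alpha> = - (\<lambda>k. - \<alpha> k)" by (rule ext) simp
    qed
    have pos: "(\<lambda>k. eps_var i k + eps_var j k) \<in> pos_roots n"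
    proof -
      consider "i < j" | "j < i" | "i = j" by linarith
      then show ?thesis
      proof cases
        case 1 then show ?thesis using B a by blast
      next
        case 2 then show ?thesis using B[of j i] a by (simp add: add.commute)
      next
        case 3 then show ?thesis using C[of i] a by simp
      qed
    qed
    have "s = 1 \<and> t = 1 \<or> s = -1 \<and> t = -1 \<or> s = 1 \<and> t = -1 \<and> i \<noteq> j \<or> s = -1 \<and> t = 1 \<and> i \<noteq> j"
      using a(4-6) by auto
    then consider "s = 1" "t = 1" | "s = -1" "t = -1" | "s = 1" "t = -1" "i \<noteq> j" | "s = -1" "t = 1" "i \<noteq> j"
      by blast
    then show "\<alpha> \<in> pos_roots n \<union> uminus ` pos_roots n"
    proof cases
      case 1
      then have "\<alpha> = (\<lambda>k. eps_var i k + eps_var j k)" by (simp add: a(1))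
      then show ?thesis using pos by simp
    next
      case 2
      then have "(\<lambda>k. - \<alpha> k) = (\<lambda>k. eps_var i k + eps_var j k)" by (intro ext) (simp add: a(1))
      then show ?thesis using pos neg by simp
    next
      case 3
      then have e: "\<alpha> = (\<lambda>k. eps_var i k - eps_var j k)" "(\<lambda>k. - \<alpha> k) = (\<lambda>k. eps_var j k - eps_var i k)" by (simp_all add: a(1))
      show ?thesis
      proof (cases "i < j")
        case True
        then have "\<alpha> \<in> pos_roots n" unfolding e(1) by (rule A[OF _ a(3)])
        then show ?thesis ..
      next
        case False
        then have "j < i" using 3 by simp
        then have "(\<lambda>k. - \<alpha> k) \<in> pos_roots n" unfolding e(2) by (rule A[OF _ a(2)])
        then show ?thesis using neg by blast
      qed
    next
      case 4
      then have e: "\<alpha> = (\<lambda>k. eps_var j k - eps_var i k)" "(\<lambda>k. - \<alpha> k) = (\<lambda>k. eps_var i k - eps_var j k)" by (simp_all add: a(1))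
      show ?thesis
      proof (cases "i < j")
        case True
        then have "(\<lambda>k. - \<alpha> k) \<in> pos_roots n" unfolding e(2) by (rule A[OF _ a(3)])
        then show ?thesis using neg by blast
      next
        case False
        then have "j < i" using 4 by simp
        then have "\<alpha> \<in> pos_roots n" unfolding e(1) by (rule A[OF _ a(2)])
        then show ?thesis ..
      qed
    qed
  qed
qed

lemma finite_all_roots: "finite (all_roots n)"
  unfolding all_roots_eq using finite_pos_roots by blast

text \<open>Positive roots have positive height and their negatives negative height, so the two
  halves are disjoint.\<close>

lemma prod_all_roots:
  fixes g :: "(nat \<Rightarrow> real) \<Rightarrow> 'a :: comm_monoid_mult"
  shows "(\<Prod>\<alpha>\<in>all_roots n. g \<alpha>) = (\<Prod>\<alpha>\<in>pos_roots n. g \<alpha> * g (- \<alpha>))"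
proof -
  have h: "height n (- \<alpha>) = - height n \<alpha>" for \<alpha>
    unfolding height_def by (simp add: sum_negf)
  have "pos_roots n \<inter> uminus ` pos_roots n = {}"
  proof (rule ccontr)
    assume "pos_roots n \<inter> uminus ` pos_roots n \<noteq> {}"
    then obtain \<alpha> where "- \<alpha> \<in> pos_roots n" "\<alpha> \<in> pos_roots n" by blast
    then have "height n (- \<alpha>) \<ge> 1" "height n \<alpha> \<ge> 1" using height_pos_root by blast+
    then show False unfolding h by linarith
  qed
  moreover have "inj_on uminus (pos_roots n)" by (rule inj_onI) (simp only: neg_equal_iff_equal)
  ultimately show ?thesis unfolding all_roots_eq
    by (subst prod.union_disjoint) (simp_all add: finite_pos_roots prod.reindex prod.distrib)
qed

text \<open>On a root written as a signed sum of two basis vectors, a signed permutation acts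
  separately on the indices and on the signs; this is the reason for the shape of
  \<open>all_roots\<close>. The side condition for equal indices is preserved, because equal indices
  receive the same sign.\<close>

lemma sp_act_all_roots_subset:
  assumes w: "w \<in> signed_perms n" and a: "\<alpha> \<in> all_roots n"
  shows "sp_act n w \<alpha> \<in> all_roots n"
proof -
  obtain i j s t where a: "\<alpha> = (\<lambda>k. of_int s * eps_var i k + of_int t * eps_var j k)"
    "i < n" "j < n" "s \<in> {-1, 1::int}" "t \<in> {-1, 1::int}" "i = j \<longrightarrow> s = t"
    using a unfolding all_roots_def by blast
  let ?p = "fst w" and ?c = "snd w"
  have p: "?p permutes {0..<n}" by (rule signed_permsD(1)[OF w])
  let ?q = "inv_into UNIV ?p"
  have q: "?q permutes {0..<n}" by (rule permutes_inv[OF p])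
  have qlt: "?q m < n" if "m < n" for m using permutes_in_image[OF q, of m] that by simp
  have pq: "?p m = m' \<longleftrightarrow> m = ?q m'" for m m' using permutes_inverses[OF p] by metis
  have "sp_act n w \<alpha> k = of_int (?c (?q i) * s) * eps_var (?q i) k + of_int (?c (?q j) * t) * eps_var (?q j) k" for k
  proof (cases "1 \<le> k \<and> k \<le> n")
    case True
    then obtain m where m: "k = Suc m" "m < n" by (metis Suc_le_D Suc_le_lessD One_nat_def)
    show ?thesis unfolding m(1) sp_act_Suc[OF m(2)] a(1) eps_var_Suc pq by (simp add: distrib_left)
  next
    case False
    have z: "eps_var m k = 0" if "m < n" for m using that False by (cases k) auto
    show ?thesis unfolding sp_act_outside[OF False] a(1) by (simp only: z a(2,3) qlt mult_zero_right)
  qed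
  then show ?thesis
  proof (rule all_rootsI)
    show "?q i < n" "?q j < n" using qlt a by blast+
    show "?c (?q i) * s \<in> {-1, 1}" "?c (?q j) * t \<in> {-1, 1}"
      using signed_permsD(2)[OF w qlt[OF a(2)]] signed_permsD(2)[OF w qlt[OF a(3)]] a(4,5) by auto
    show "?q i = ?q j \<longrightarrow> ?c (?q i) * s = ?c (?q j) * t"
      using a(6) inj_eq[OF permutes_inj[OF q], of i j] by auto
  qed
qed

lemma sp_act_all_roots:
  assumes w: "w \<in> signed_perms n"
  shows "sp_act n (sp_inv n w) ` all_roots n = all_roots n"
proof -
  have "sp_act n w ` all_roots n = all_roots n"
    by (rule endo_inj_surj[OF finite_all_roots])
      (use sp_act_all_roots_subset[OF w] inj_on_subset[OF inj_sp_act[OF w]] in blast)+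
  then have "sp_act n (sp_inv n w) ` all_roots n = sp_act n (sp_inv n w) ` sp_act n w ` all_roots n" by simp
  also have "\<dots> = all_roots n" by (simp add: image_image sp_inv[OF w])
  finally show ?thesis .
qed

lemma all_root_factors_invariant:
  assumes w: "w \<in> signed_perms n"
  shows "fact_act n w (\<Prod>\<alpha>\<in>all_roots n. root_factor \<alpha>) = (\<Prod>\<alpha>\<in>all_roots n. root_factor \<alpha>)"
proof -
  have inj: "inj_on (sp_act n (sp_inv n w)) (all_roots n)"
    by (rule inj_onI) (metis sp_inv(2)[OF w])
  have "(\<Prod>\<alpha>\<in>all_roots n. root_factor \<alpha>) = (\<Prod>\<alpha>\<in>sp_act n (sp_inv n w) ` all_roots n. root_factor \<alpha>)"
    unfolding sp_act_all_roots[OF w] ..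
  also have "\<dots> = (\<Prod>\<alpha>\<in>all_roots n. root_factor (sp_act n (sp_inv n w) \<alpha>))"
    by (simp add: prod.reindex[OF inj])
  also have "\<dots> = fact_act n w (\<Prod>\<alpha>\<in>all_roots n. root_factor \<alpha>)"
    unfolding fact_act_prod[OF w] fact_act_root_factor[OF w] ..
  finally show ?thesis ..
qed

lemma root_factor_add: "1 - fps_X * fps_const (pw u 1 * pw v 1) = root_factor (u + v)"
  unfolding root_factor_def mon_add by (simp add: pw_def)

text \<open>The products of two of the variables and their inverses are the exponentials of the
  roots, each occurring once, except for a variable times its own inverse: this is 1 and yields one
  factor \<open>1 - t\<close> for each of the \<open>n\<close> pairs.\<close>

lemma littlewood_prod_eps_var:
  "littlewood_prod (2 * n) (pairs eps_var) = (1 - fps_X) ^ n * (\<Prod>\<alpha>\<in>all_roots n. root_factor \<alpha>)"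
proof -
  let ?z = "pairs eps_var"
  have split: "(\<Prod>a<2 * m. g a) = (\<Prod>i<m. g (2 * i) * g (Suc (2 * i)))" for g :: "nat \<Rightarrow> laurent fps" and m
    by (induction m) (simp_all add: mult.assoc)
  have "littlewood_prod (2 * n) ?z = (1 - fps_X) ^ n * (\<Prod>\<alpha>\<in>pos_roots n. root_factor \<alpha> * root_factor (- \<alpha>))"
  proof (induction n)
    case 0
    then show ?case by (simp add: littlewood_prod_def pos_roots_0)
  next
    case (Suc n)
    let ?R = "\<lambda>a b. root_factor (?z a + ?z b)"
    let ?m = "\<lambda>i k. eps_var i k - eps_var n k" and ?p = "\<lambda>i k. eps_var i k + eps_var n k" and ?t = "\<lambda>k. 2 * eps_var n k"
    have e: "- eps_var i + - eps_var n = - ?p i" "eps_var i + - eps_var n = ?m i"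
      "- eps_var i + eps_var n = - ?m i" "eps_var i + eps_var n = ?p i" for i
      by (rule ext, simp)+
    have e2: "- eps_var n + - eps_var n = - ?t" "- eps_var n + eps_var n = 0" "eps_var n + eps_var n = ?t"
      by (rule ext, simp)+
    have z: "root_factor 0 = 1 - fps_X" by (simp add: root_factor_def)
    have "littlewood_prod (2 * Suc n) ?z = littlewood_prod (2 * n) ?z *
      ((\<Prod>a<2 * n. ?R a (2 * n)) * ?R (2 * n) (2 * n)) *
      ((\<Prod>a<2 * n. ?R a (Suc (2 * n))) * ?R (2 * n) (Suc (2 * n)) * ?R (Suc (2 * n)) (Suc (2 * n)))"
      unfolding littlewood_prod_def root_factor_add
      by (simp add: lessThan_Suc_atMost[symmetric])
    also have "\<dots> = littlewood_prod (2 * n) ?z *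
      ((\<Prod>i<n. root_factor (- ?p i) * root_factor (?m i)) * root_factor (- ?t)) *
      ((\<Prod>i<n. root_factor (- ?m i) * root_factor (?p i)) * (1 - fps_X) * root_factor ?t)"
      unfolding split pairs_double e2 unfolding e z ..
    also have "\<dots> = (1 - fps_X) ^ Suc n * (\<Prod>\<alpha>\<in>pos_roots (Suc n). root_factor \<alpha> * root_factor (- \<alpha>))"
      unfolding Suc.IH prod.pos_roots_Suc prod.distrib power_Suc by (simp only: mult_ac)
    finally show ?case .
  qed
  then show ?thesis unfolding prod_all_roots .
qed

section \<open>Generalized exponents as coefficients of an alternating sum\<close>

definition geo :: "(nat \<Rightarrow> real) \<Rightarrow> laurent fps" where
  "geo \<alpha> = Abs_fps (\<lambda>k. mon \<alpha> ^ k)"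

lemma root_factor_mult_nth:
  "fps_nth (root_factor \<alpha> * F) k = fps_nth F k - (if k = 0 then 0 else mon \<alpha> * fps_nth F (k - 1))"
  unfolding root_factor_def left_diff_distrib mult.assoc by (simp)

lemma root_factor_geo: "root_factor \<alpha> * geo \<alpha> = 1"
proof (rule fps_ext)
  fix k show "fps_nth (root_factor \<alpha> * geo \<alpha>) k = fps_nth 1 k"
    unfolding root_factor_mult_nth geo_def fps_nth_Abs_fps by (cases k) simp_all
qed

text \<open>Both sides obey the recursion that expresses division by one more root factor, which for
  \<open>partition_series\<close> is \<open>partition_series_insert\<close>.\<close>

lemma lookup_geo_prod:
  assumes "S \<subseteq> pos_roots n"
  shows "Poly_Mapping.lookup (fps_nth (\<Prod>\<alpha>\<in>S. geo \<alpha>) k) \<beta> = coeff (partition_series S \<beta>) k"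
proof -
  have "finite S" by (rule finite_subset[OF assms finite_pos_roots])
  then show ?thesis using assms
  proof (induction S arbitrary: k \<beta> rule: finite_induct)
    case empty
    show ?case
    proof (cases "\<beta> = 0")
      case True
      show ?thesis unfolding True partition_series_empty zero_fun_def[symmetric] prod.empty fps_one_nth
        by (cases k) (simp_all only: if_True if_False lookup_one lookup_zero when_def nat.simps refl simp_thms coeff_1 coeff_0 of_bool_eq)
    next
      case False
      have ne: "\<not> \<beta> = (\<lambda>_. 0)" using False unfolding zero_fun_def .
      show ?thesis unfolding partition_series_empty prod.empty fps_one_nth if_not_P[OF ne]
      proof (cases k)
        case 0
        have "Poly_Mapping.lookup (1 :: laurent) \<beta> = 0" unfolding lookup_one when_def by (rule if_not_P[OF False])
        then show "Poly_Mapping.lookup (if k = 0 then 1 else 0 :: laurent) \<beta> = coeff 0 k" unfolding 0 by simp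
      qed simp
    qed
  next
    case (insert \<alpha> S)
    let ?Q = "\<Prod>\<alpha>\<in>insert \<alpha> S. geo \<alpha>"
    have "root_factor \<alpha> * ?Q = (\<Prod>\<alpha>\<in>S. geo \<alpha>)"
      unfolding prod.insert[OF insert(1,2)] mult.assoc[symmetric] root_factor_geo by simp
    then have Q: "fps_nth ?Q k = fps_nth (\<Prod>\<alpha>\<in>S. geo \<alpha>) k + (if k = 0 then 0 else mon \<alpha> * fps_nth ?Q (k - 1))" for k
      using root_factor_mult_nth[of \<alpha> ?Q k] by simp
    have S: "S \<subseteq> pos_roots n" using insert(4) by blast
    show ?case
    proof (induction k arbitrary: \<beta>)
      case 0
      have "coeff (partition_series (insert \<alpha> S) \<beta>) 0 = coeff (partition_series S \<beta>) 0"
        unfolding partition_series_insert[OF insert(4,2), symmetric] coeff_diff coeff_monom_mult by simp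
      then show ?case unfolding Q[of 0] by (simp add: insert.IH[OF S])
    next
      case (Suc k)
      have d: "\<beta> - \<alpha> = (\<lambda>k. \<beta> k - \<alpha> k)" by (rule ext) simp
      have c: "coeff (partition_series (insert \<alpha> S) \<beta>) (Suc k) =
        coeff (partition_series S \<beta>) (Suc k) + coeff (partition_series (insert \<alpha> S) (\<beta> - \<alpha>)) k"
        unfolding partition_series_insert[OF insert(4,2), symmetric] coeff_diff coeff_monom_mult d by simp
      show ?case unfolding Q[of "Suc k"] c
        by (simp only: nat.simps if_False diff_Suc_1 lookup_add insert.IH[OF S] lookup_mon_mult Suc.IH)
    qed
  qed
qed

text \<open>The coefficient of an alternating sum at \<open>u\<close> is the signed sum of the
  coefficients at the points \<open>w u\<close>. For \<open>u = \<Lambda> + \<rho>\<close>, and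
  after removing the factor \<open>mon (rho n)\<close>, these are the values of the partition
  function in the definition.\<close>

lemma coeff_gen_exponent:
  "coeff (gen_exponent_C n \<Lambda>) k =
     Poly_Mapping.lookup (fps_nth (alt_fps n (fps_const (mon (rho n)) * (\<Prod>\<alpha>\<in>pos_roots n. geo \<alpha>))) k) (\<Lambda> + rho n)"
proof -
  have e: "(\<lambda>j. \<Lambda> j + rho n j) = \<Lambda> + rho n" by (rule ext) simp
  have d: "(\<lambda>k. sp_act n w (\<Lambda> + rho n) k - rho n k) = sp_act n w (\<Lambda> + rho n) - rho n" for w by (rule ext) simp
  have c: "coeff (of_int c * p) k = c * coeff p k" for c :: int and p :: "int poly"
    by (simp add: of_int_poly)
  show ?thesis
    unfolding gen_exponent_signed_perms coeff_sum c kostant_partition_def e d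
    unfolding lookup_geo_prod[OF subset_refl, symmetric] alt_fps_def fps_nth_Abs_fps lookup_alt
      fps_mult_left_const_nth lookup_mon_mult ..
qed

lemma generic_vars_eps_var: "generic_vars n eps_var"
  unfolding generic_vars_def
proof (intro allI impI conjI notI)
  fix i j :: nat assume "i \<noteq> j"
  { assume "eps_var i = eps_var j"
    from fun_cong[OF this, of "Suc i"] show False using \<open>i \<noteq> j\<close> by simp }
  { assume "eps_var i + eps_var j = 0"
    from fun_cong[OF this, of "Suc i"] show False using \<open>i \<noteq> j\<close> by simp }
qed

text \<open>What matters is that \<open>d\<close> comes before \<Lambda>. The invariant product over
  all roots is moved inside the alternating sum, where its positive half cancels the geometric
  series and its negative half is handled by \<open>alt_macdonald\<close>. Expressing the Weyl
  denominator by the chain series brings the same product back on the other side, and its inverse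
  removes it from both.\<close>

lemma gen_exponent_chain_series:
  "\<exists>d. \<forall>\<Lambda>. Abs_fps (coeff (gen_exponent_C n \<Lambda>)) =
     d * Abs_fps (\<lambda>k. Poly_Mapping.lookup (fps_nth (chain_series n eps_var) k) (\<Lambda> + rho n))"
proof -
  let ?F = "fps_const (mon (rho n))" and ?G = "\<Prod>\<alpha>\<in>pos_roots n. geo \<alpha>" and ?R = "\<Prod>\<alpha>\<in>all_roots n. root_factor \<alpha>"
    and ?a = "fps_const (weyl_alternant n (\<lambda>i. int n - int i) eps_var)"
  obtain c where c: "alt_fps n (?F * (\<Prod>\<alpha>\<in>pos_roots n. root_factor (- \<alpha>))) = lift_int c * ?a"
    using alt_macdonald by blast
  have GR: "?G * ?R = (\<Prod>\<alpha>\<in>pos_roots n. root_factor (- \<alpha>))"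
    unfolding prod_all_roots prod.distrib[symmetric] mult.assoc[symmetric]
    by (rule prod.cong) (simp_all add: mult.commute[of "geo _"] root_factor_geo)
  have inv: "?R * (\<Prod>\<alpha>\<in>all_roots n. geo \<alpha>) = 1"
    unfolding prod.distrib[symmetric] by (simp add: root_factor_geo)
  let ?d = "c * (1 - fps_X) ^ n"
  have "alt_fps n (?F * ?G) * ?R = alt_fps n (?F * ?G * ?R)"
    by (rule alt_fps_mult_invariant[symmetric]) (rule all_root_factors_invariant)
  also have "\<dots> = lift_int c * ?a" by (simp only: mult.assoc GR c)
  also have "?a = (1 - fps_X) ^ n * ?R * chain_series n eps_var"
    unfolding littlewood_prod_eps_var[symmetric]
    by (rule littlewood_prod_chain_series[OF generic_vars_eps_var, symmetric])
  also have "lift_int c * ((1 - fps_X) ^ n * ?R * chain_series n eps_var) = lift_int ?d * chain_series n eps_var * ?R"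
    unfolding lift_int_mult lift_int_one_minus_X_power by (simp only: mult_ac)
  finally have "alt_fps n (?F * ?G) * (?R * (\<Prod>\<alpha>\<in>all_roots n. geo \<alpha>)) =
    lift_int ?d * chain_series n eps_var * (?R * (\<Prod>\<alpha>\<in>all_roots n. geo \<alpha>))"
    unfolding mult.assoc[symmetric] by simp
  then have eq: "alt_fps n (?F * ?G) = lift_int ?d * chain_series n eps_var" unfolding inv by simp
  have "Abs_fps (coeff (gen_exponent_C n \<Lambda>)) =
     ?d * Abs_fps (\<lambda>k. Poly_Mapping.lookup (fps_nth (chain_series n eps_var) k) (\<Lambda> + rho n))" for \<Lambda>
  proof (rule fps_ext)
    fix k
    show "fps_nth (Abs_fps (coeff (gen_exponent_C n \<Lambda>))) k =
      fps_nth (?d * Abs_fps (\<lambda>k. Poly_Mapping.lookup (fps_nth (chain_series n eps_var) k) (\<Lambda> + rho n))) k"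
      unfolding fps_nth_Abs_fps coeff_gen_exponent eq fps_mult_nth lookup_sum lift_int_def lookup_of_int_mult ..
  qed
  then show ?thesis by blast
qed

section \<open>The zero weight\<close>

lemma height_partition_function:
  assumes "m \<in> partition_functions (pos_roots n) \<beta>"
  shows "height n \<beta> = (\<Sum>\<alpha>\<in>pos_roots n. real (m \<alpha>) * height n \<alpha>)"
proof -
  have "\<beta> k = (\<Sum>\<alpha>\<in>pos_roots n. real (m \<alpha>) * \<alpha> k)" for k
    using assms by (simp add: partition_functions_def)
  then have "height n \<beta> = (\<Sum>k=1..n. \<Sum>\<alpha>\<in>pos_roots n. (real n + 1 - real k) * (real (m \<alpha>) * \<alpha> k))"
    by (simp add: height_def sum_distrib_left)
  also have "\<dots> = (\<Sum>\<alpha>\<in>pos_roots n. real (m \<alpha>) * height n \<alpha>)"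
    by (subst sum.swap) (simp add: height_def sum_distrib_left mult_ac)
  finally show ?thesis .
qed

lemma kostant_partition_zero: "kostant_partition n (\<lambda>_. 0) = 1"
proof -
  have "partition_functions (pos_roots n) (\<lambda>_. 0) = {\<lambda>_. 0}"
  proof (intro equalityI subsetI)
    fix m assume m: "m \<in> partition_functions (pos_roots n) (\<lambda>_. 0)"
    have "(\<Sum>\<alpha>\<in>pos_roots n. real (m \<alpha>) * height n \<alpha>) = 0"
      using height_partition_function[OF m] by (simp add: height_def)
    moreover have "0 \<le> real (m \<alpha>) * height n \<alpha>" if "\<alpha> \<in> pos_roots n" for \<alpha>
      using height_pos_root[OF that] by simp
    ultimately have z: "real (m \<alpha>) * height n \<alpha> = 0" if "\<alpha> \<in> pos_roots n" for \<alpha>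
      using that finite_pos_roots by (simp add: sum_nonneg_eq_0_iff)
    have "m \<alpha> = 0" for \<alpha>
    proof (cases "\<alpha> \<in> pos_roots n")
      case True
      then show ?thesis using z[OF True] height_pos_root[OF True] by simp
    next
      case False
      then show ?thesis using m by (simp add: partition_functions_def)
    qed
    then show "m \<in> {\<lambda>_. 0}" by (simp add: fun_eq_iff)
  next
    fix m :: "(nat \<Rightarrow> real) \<Rightarrow> nat" assume "m \<in> {\<lambda>_. 0}"
    then show "m \<in> partition_functions (pos_roots n) (\<lambda>_. 0)" by (simp add: partition_functions_def)
  qed
  then show ?thesis by (simp add: kostant_partition_def partition_series_def monom_0)
qed

text \<open>\<open>height\<close> is the scalar product with \<rho>. As \<open>w\<close> preserves
  length, the height of \<open>w \<rho> - \<rho>\<close> is minus half the square of its length,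
  whereas a sum of positive roots has nonnegative height. Hence \<open>w\<close> fixes \<rho>, whose
  coordinates are positive and distinct, and \<open>w\<close> is the identity.\<close>

lemma kostant_partition_rho_orbit:
  assumes w: "w \<in> signed_perms n" and ne: "w \<noteq> sp_id n"
  shows "kostant_partition n (\<lambda>k. sp_act n w (rho n) k - rho n k) = 0"
proof -
  let ?p = "fst w" and ?c = "snd w"
  have p: "?p permutes {0..<n}" by (rule signed_permsD(1)[OF w])
  have rho: "rho n (Suc i) = real n - real i" if "i < n" for i
    using that by (simp add: rho_eq weight_vec_def)
  let ?v = "\<lambda>k. sp_act n w (rho n) k - rho n k"
  have "partition_functions (pos_roots n) ?v = {}"
  proof (rule ccontr)
    assume "partition_functions (pos_roots n) ?v \<noteq> {}"
    then obtain m where m: "m \<in> partition_functions (pos_roots n) ?v" by blast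
    have nonneg: "0 \<le> height n ?v" unfolding height_partition_function[OF m]
      by (intro sum_nonneg mult_nonneg_nonneg) (use height_pos_root in force)+
    define x where "x i = real_of_int (?c i) * (real n - real (?p i))" for i
    have pl: "?p i < n" if "i < n" for i using permutes_in_image[OF p, of i] that by simp
    have act: "sp_act n w (rho n) (Suc i) = x i" if "i < n" for i
      by (simp add: sp_act_Suc[OF that] x_def rho[OF pl[OF that]])
    have "height n ?v = (\<Sum>i<n. (real n - real i) * (x i - (real n - real i)))"
      unfolding height_def
    proof (rule sum.reindex_bij_witness[of _ Suc "\<lambda>k. k - 1"])
      fix k assume "k \<in> {1..n}"
      then obtain i where "k = Suc i" "i < n" by (cases k) auto
      then show "(real n - real (k - 1)) * (x (k - 1) - (real n - real (k - 1))) =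
        (real n + 1 - real k) * (sp_act n w (rho n) k - rho n k)"
        by (simp add: act rho)
    qed auto
    moreover have "(\<Sum>i<n. (x i)\<^sup>2) = (\<Sum>i<n. (real n - real i)\<^sup>2)"
    proof -
      have "(x i)\<^sup>2 = (real n - real (?p i))\<^sup>2" if "i < n" for i
        using signed_permsD(2)[OF w that] by (auto simp: x_def power2_eq_square algebra_simps)
      then have "(\<Sum>i<n. (x i)\<^sup>2) = (\<Sum>i<n. (real n - real (?p i))\<^sup>2)" by simp
      also have "\<dots> = (\<Sum>i<n. (real n - real i)\<^sup>2)"
        using sum.permute[OF p, of "\<lambda>i. (real n - real i)\<^sup>2"] by (simp add: comp_def lessThan_atLeast0)
      finally show ?thesis .
    qed
    moreover have "(\<Sum>i<n. (x i - (real n - real i))\<^sup>2) = (\<Sum>i<n. (x i)\<^sup>2) - (\<Sum>i<n. (real n - real i)\<^sup>2)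
      - 2 * (\<Sum>i<n. (real n - real i) * (x i - (real n - real i)))"
      unfolding sum_distrib_left sum_subtractf[symmetric]
      by (rule sum.cong) (simp_all add: power2_eq_square algebra_simps)
    ultimately have "2 * height n ?v + (\<Sum>i<n. (x i - (real n - real i))\<^sup>2) = 0" by simp
    moreover have "0 \<le> (\<Sum>i<n. (x i - (real n - real i))\<^sup>2)" by (intro sum_nonneg) simp
    ultimately have "(\<Sum>i<n. (x i - (real n - real i))\<^sup>2) = 0" using nonneg by linarith
    then have xeq: "x i = real n - real i" if "i < n" for i
      using that by (simp add: sum_nonneg_eq_0_iff)
    have pc: "?p i = i \<and> ?c i = 1" if i: "i < n" for i
      using xeq[OF i] pl[OF i] i signed_permsD(2)[OF w i] by (auto simp: x_def)
    have "?p = id"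
    proof
      fix i show "?p i = id i"
        using pc[of i] permutes_not_in[OF p, of i] by (cases "i < n") auto
    qed
    moreover have "?c = restrict (\<lambda>_. 1) {..<n}"
      by (rule extensionalityI[OF signed_permsD(4)[OF w]]) (use pc in auto)
    ultimately have "w = sp_id n" unfolding sp_id_def by (intro prod_eqI) (simp_all only: fst_conv snd_conv)
    then show False using ne by blast
  qed
  then show ?thesis by (simp add: kostant_partition_def partition_series_def)
qed

lemma gen_exponent_zero: "gen_exponent_C n (\<lambda>_. 0) = 1"
proof -
  have "gen_exponent_C n (\<lambda>_. 0) = (\<Sum>w\<in>signed_perms n. of_int (sp_sign n w) *
     kostant_partition n (\<lambda>k. sp_act n w (rho n) k - rho n k))"
    unfolding gen_exponent_signed_perms by simp
  also have "\<dots> = (\<Sum>w\<in>{sp_id n}. of_int (sp_sign n w) *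
     kostant_partition n (\<lambda>k. sp_act n w (rho n) k - rho n k))"
    by (rule sum.mono_neutral_right) (auto simp: finite_signed_perms sp_id kostant_partition_rho_orbit)
  also have "\<dots> = 1" by (simp add: sp_id kostant_partition_zero)
  finally show ?thesis .
qed

section \<open>The sign-reversing involution\<close>

definition level :: "(nat \<Rightarrow> int) \<Rightarrow> (nat \<Rightarrow> nat \<Rightarrow> nat) \<Rightarrow> nat \<Rightarrow> nat \<Rightarrow> int" where
  "level e a i j = e j - colsum a i j"

definition prefix_sum :: "(nat \<Rightarrow> nat \<Rightarrow> nat) \<Rightarrow> nat \<Rightarrow> nat \<Rightarrow> int" where
  "prefix_sum a i j = (\<Sum>k<j. int (a i k))"

text \<open>With column \<open>j\<close> standing for the letter \<open>Suc j\<close>, the row below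
  has more letters up to \<open>Suc j\<close> than the row above has letters up to \<open>j\<close>:
  some column of the tableau would fail to increase strictly.\<close>

definition lattice_fails :: "nat \<Rightarrow> (nat \<Rightarrow> nat \<Rightarrow> nat) \<Rightarrow> nat \<Rightarrow> nat \<Rightarrow> bool" where
  "lattice_fails n a i j \<longleftrightarrow> Suc i < n \<and> prefix_sum a i j < prefix_sum a (Suc i) (Suc j)"

text \<open>The levels \<open>level e a (Suc i) k\<close> are confined between bounds given by the rows \<open>i\<close> and
  \<open>Suc (Suc i)\<close>. From the pivot column \<open>j\<close> on, each is reflected in the interval of its admissible
  values. In column \<open>j\<close> the lower bound is the least value for which the lattice condition still fails, so
  that the pivot is not moved.\<close>

definition flip_lo :: "(nat \<Rightarrow> int) \<Rightarrow> nat \<Rightarrow> nat \<Rightarrow> (nat \<Rightarrow> nat \<Rightarrow> nat) \<Rightarrow> nat \<Rightarrow> int" where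
  "flip_lo e i j a k = (if k = j then level e a (Suc (Suc i)) j + 1 + prefix_sum a i j - prefix_sum a (Suc i) j
     else max (level e a (Suc (Suc i)) k) (level e a i (k - 1) + 1))"

definition flip_hi :: "nat \<Rightarrow> (nat \<Rightarrow> int) \<Rightarrow> nat \<Rightarrow> (nat \<Rightarrow> nat \<Rightarrow> nat) \<Rightarrow> nat \<Rightarrow> int" where
  "flip_hi n e i a k = (if Suc k < 2 * n then min (level e a i k) (level e a (Suc (Suc i)) (Suc k) - 1) else level e a i k)"

definition flipped :: "nat \<Rightarrow> (nat \<Rightarrow> int) \<Rightarrow> nat \<Rightarrow> nat \<Rightarrow> (nat \<Rightarrow> nat \<Rightarrow> nat) \<Rightarrow> nat \<Rightarrow> int" where
  "flipped n e i j a k = flip_lo e i j a k + flip_hi n e i a k - level e a (Suc i) k"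

definition flip :: "nat \<Rightarrow> (nat \<Rightarrow> int) \<Rightarrow> nat \<Rightarrow> nat \<Rightarrow> (nat \<Rightarrow> nat \<Rightarrow> nat) \<Rightarrow> nat \<Rightarrow> nat \<Rightarrow> nat" where
  "flip n e i j a r k =
     (if j \<le> k \<and> k < 2 * n \<and> r = i then nat (level e a i k - flipped n e i j a k)
      else if j \<le> k \<and> k < 2 * n \<and> r = Suc i then nat (flipped n e i j a k - level e a (Suc (Suc i)) k)
      else a r k)"

lemma level_Suc: "level e a (Suc i) j = level e a i j - int (a i j)"
  by (simp add: level_def colsum_def)

lemma sp_chains_level:
  assumes "a \<in> sp_chains n e"
  shows "i < n \<Longrightarrow> Suc j < 2 * n \<Longrightarrow> level e a i j < level e a (Suc i) (Suc j)"
    "a i j \<noteq> 0 \<Longrightarrow> i < n \<and> 2 * i \<le> j \<and> j < 2 * n"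
    "j < n \<Longrightarrow> level e a n (2 * j) + 1 = level e a n (Suc (2 * j))"
  using assms unfolding sp_chains_def level_def by blast+

lemma sp_chains_levelI:
  assumes "\<And>i j. i < n \<Longrightarrow> Suc j < 2 * n \<Longrightarrow> level e a i j < level e a (Suc i) (Suc j)"
    "\<And>i j. a i j \<noteq> 0 \<Longrightarrow> i < n \<and> 2 * i \<le> j \<and> j < 2 * n"
    "\<And>j. j < n \<Longrightarrow> level e a n (2 * j) + 1 = level e a n (Suc (2 * j))"
  shows "a \<in> sp_chains n e"
  using assms unfolding sp_chains_def level_def by blast

definition flippable :: "nat \<Rightarrow> (nat \<Rightarrow> int) \<Rightarrow> nat \<Rightarrow> nat \<Rightarrow> (nat \<Rightarrow> nat \<Rightarrow> nat) \<Rightarrow> bool" where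
  "flippable n e i j a \<longleftrightarrow> a \<in> sp_chains n e \<and> lattice_fails n a i j \<and> (\<forall>k<j. \<not> lattice_fails n a i k)"

text \<open>At the first failure \<open>a (Suc i) j\<close> is positive, since otherwise the
  preceding column would fail already. The support condition for row \<open>Suc i\<close> then
  places \<open>j\<close>, so that altering this row from column \<open>j\<close> on cannot violate
  it.\<close>

lemma flippable_ge:
  assumes "flippable n e i j a"
  shows "2 * Suc i \<le> j" "j < 2 * n" "Suc i < n"
proof -
  have a: "a \<in> sp_chains n e" and f: "lattice_fails n a i j" and m: "\<And>k. k < j \<Longrightarrow> \<not> lattice_fails n a i k"
    using assms by (auto simp: flippable_def)
  show i: "Suc i < n" using f by (simp add: lattice_fails_def)
  have pos: "0 \<le> prefix_sum a i j" for j unfolding prefix_sum_def by (intro sum_nonneg) simp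
  have "a (Suc i) j \<noteq> 0"
  proof
    assume z: "a (Suc i) j = 0"
    have lt: "prefix_sum a i j < prefix_sum a (Suc i) j"
      using f z by (simp add: lattice_fails_def prefix_sum_def)
    then have "j \<noteq> 0" by (intro notI) (simp add: prefix_sum_def)
    then obtain k where k: "j = Suc k" by (cases j) auto
    have "prefix_sum a i k \<le> prefix_sum a i j" unfolding k prefix_sum_def by simp
    then have "lattice_fails n a i k" using lt i unfolding lattice_fails_def k by simp
    then show False using m[of k] k by simp
  qed
  then show "2 * Suc i \<le> j" "j < 2 * n" using sp_chains_level(2)[OF a] by blast+
qed

text \<open>In column \<open>j\<close> the failure keeps the modified lower bound at or below the
  present level, and the absence of a failure in column \<open>j - 1\<close> keeps it at or above
  the bounds imposed by the two neighbouring rows. In the later columns the bounds are the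
  interlacing inequalities themselves.\<close>

lemma flip_bounds:
  assumes fl: "flippable n e i j a" and k: "j \<le> k" "k < 2 * n"
  shows "flip_lo e i j a k \<le> level e a (Suc i) k" "level e a (Suc i) k \<le> flip_hi n e i a k"
    "level e a (Suc (Suc i)) k \<le> flip_lo e i j a k" "flip_hi n e i a k \<le> level e a i k"
    "level e a i (k - 1) < flip_lo e i j a k"
    "Suc k < 2 * n \<Longrightarrow> flip_hi n e i a k < level e a (Suc (Suc i)) (Suc k)"
    "k = j \<Longrightarrow> flip_lo e i j a k = level e a (Suc (Suc i)) k + 1 + prefix_sum a i k - prefix_sum a (Suc i) k"
proof -
  have a: "a \<in> sp_chains n e" and f: "lattice_fails n a i j" and m: "\<And>k. k < j \<Longrightarrow> \<not> lattice_fails n a i k"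
    using fl by (auto simp: flippable_def)
  note ge = flippable_ge[OF fl]
  have i: "i < n" "Suc i < n" using ge by simp_all
  have kk: "Suc (k - 1) = k" "k - 1 < k" using ge k by auto
  have L1: "level e a i (k - 1) < level e a (Suc i) k" and L2: "level e a (Suc i) (k - 1) < level e a (Suc (Suc i)) k"
    using sp_chains_level(1)[OF a i(1), of "k - 1"] sp_chains_level(1)[OF a i(2), of "k - 1"] k unfolding kk by simp_all
  have S: "level e a (Suc i) m = level e a i m - int (a i m)" "level e a (Suc (Suc i)) m = level e a (Suc i) m - int (a (Suc i) m)" for m
    by (rule level_Suc)+
  have jj: "k = j \<Longrightarrow> prefix_sum a i k < prefix_sum a (Suc i) k + int (a (Suc i) k)"
    using f by (simp add: lattice_fails_def prefix_sum_def)
  have "k = j \<Longrightarrow> \<not> lattice_fails n a i (k - 1)" using m kk(2) by blast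
  then have prev: "k = j \<Longrightarrow> prefix_sum a (Suc i) k \<le> prefix_sum a i (k - 1)"
    using i(2) kk(1) unfolding lattice_fails_def by simp
  have "prefix_sum a i (Suc (k - 1)) = prefix_sum a i (k - 1) + int (a i (k - 1))"
    by (simp only: prefix_sum_def sum.lessThan_Suc)
  then have pk: "prefix_sum a i k = prefix_sum a i (k - 1) + int (a i (k - 1))" unfolding kk .
  show "flip_lo e i j a k \<le> level e a (Suc i) k"
    using jj L1 S(2)[of k] by (auto simp: flip_lo_def)
  show "level e a (Suc i) k \<le> flip_hi n e i a k"
    using S(1)[of k] sp_chains_level(1)[OF a i(2), of k] by (auto simp: flip_hi_def)
  show "level e a (Suc (Suc i)) k \<le> flip_lo e i j a k"
    using prev pk by (auto simp: flip_lo_def)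
  show "flip_hi n e i a k \<le> level e a i k" by (auto simp: flip_hi_def)
  show "level e a i (k - 1) < flip_lo e i j a k"
    using prev pk L2 S(1)[of "k - 1"] by (cases "k = j") (simp_all add: flip_lo_def less_max_iff_disj)
  show "Suc k < 2 * n \<Longrightarrow> flip_hi n e i a k < level e a (Suc (Suc i)) (Suc k)" by (auto simp: flip_hi_def)
  show "k = j \<Longrightarrow> flip_lo e i j a k = level e a (Suc (Suc i)) k + 1 + prefix_sum a i k - prefix_sum a (Suc i) k"
    by (simp add: flip_lo_def)
qed

lemma flipped_bounds:
  assumes fl: "flippable n e i j a" and k: "j \<le> k" "k < 2 * n"
  shows "flip_lo e i j a k \<le> flipped n e i j a k" "flipped n e i j a k \<le> flip_hi n e i a k"
  using flip_bounds(1,2)[OF assms] unfolding flipped_def by linarith+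

text \<open>What row \<open>i\<close> loses, row \<open>Suc i\<close> gains, so only the level
  between the two rows changes.\<close>

lemma level_flip:
  assumes fl: "flippable n e i j a"
  shows "level e (flip n e i j a) r k = (if r = Suc i \<and> j \<le> k \<and> k < 2 * n then flipped n e i j a k else level e a r k)"
proof (cases "j \<le> k \<and> k < 2 * n")
  case False
  then show ?thesis by (auto simp: level_def colsum_def flip_def)
next
  case True
  note b = flip_bounds[OF fl conjunct1[OF True] conjunct2[OF True]] flipped_bounds[OF fl conjunct1[OF True] conjunct2[OF True]]
  have f1: "int (flip n e i j a i k) = level e a i k - flipped n e i j a k"
    and f2: "int (flip n e i j a (Suc i) k) = flipped n e i j a k - level e a (Suc (Suc i)) k"
    using True b by (simp_all add: flip_def)
  have f3: "flip n e i j a r k = a r k" if "r \<noteq> i" "r \<noteq> Suc i" for r using that by (simp add: flip_def)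
  show ?thesis
  proof (induction r)
    case 0
    then show ?case by (simp add: level_def colsum_def)
  next
    case (Suc r)
    consider "r = i" | "r = Suc i" | "r \<noteq> i" "r \<noteq> Suc i" by blast
    then show ?case
      using Suc True by cases (simp_all add: level_Suc f1 f2 f3)
  qed
qed

lemma prefix_sum_flip: "m \<le> j \<Longrightarrow> prefix_sum (flip n e i j a) r m = prefix_sum a r m"
  unfolding prefix_sum_def by (rule sum.cong) (auto simp: flip_def)

lemma flip_sp_chains:
  assumes fl: "flippable n e i j a"
  shows "flip n e i j a \<in> sp_chains n e"
proof (rule sp_chains_levelI)
  have a: "a \<in> sp_chains n e" using fl by (simp add: flippable_def)
  note ge = flippable_ge[OF fl]
  fix r k
  show "flip n e i j a r k \<noteq> 0 \<Longrightarrow> r < n \<and> 2 * r \<le> k \<and> k < 2 * n"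
    using ge sp_chains_level(2)[OF a, of r k] by (auto simp: flip_def split: if_splits)
  show "level e (flip n e i j a) n (2 * k) + 1 = level e (flip n e i j a) n (Suc (2 * k))" if "k < n"
    using sp_chains_level(3)[OF a that] ge unfolding level_flip[OF fl] by simp
  show "level e (flip n e i j a) r k < level e (flip n e i j a) (Suc r) (Suc k)" if "r < n" "Suc k < 2 * n"
  proof -
    consider "r = i" "j \<le> Suc k" | "r = Suc i" "j \<le> k" | "\<not> (r = i \<and> j \<le> Suc k)" "\<not> (r = Suc i \<and> j \<le> k)" by blast
    then show ?thesis
    proof cases
      case 1
      then show ?thesis
        using flip_bounds(5)[OF fl, of "Suc k"] flipped_bounds(1)[OF fl, of "Suc k"] that
        unfolding level_flip[OF fl] by simp
    next
      case 2
      then show ?thesis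
        using flip_bounds(6)[OF fl, of k] flipped_bounds(2)[OF fl, of k] that
        unfolding level_flip[OF fl] by simp
    next
      case 3
      then show ?thesis using sp_chains_level(1)[OF a that] unfolding level_flip[OF fl] by auto
    qed
  qed
qed

text \<open>The bounds depend only on levels outside the flipped row and on prefix sums before
  column \<open>j\<close>, all of which the flip preserves; so the second flip reflects in the same
  intervals.\<close>

lemma flip_flip:
  assumes fl: "flippable n e i j a" and k: "flip n e i j a = b"
  shows "flip n e i j b = a"
proof (intro ext)
  fix r k
  have lev: "level e b i m = level e a i m" "level e b (Suc (Suc i)) m = level e a (Suc (Suc i)) m" for m
    unfolding assms(2)[symmetric] level_flip[OF fl] by simp_all
  have pre: "prefix_sum b r j = prefix_sum a r j" for r
    unfolding assms(2)[symmetric] by (rule prefix_sum_flip) simp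
  have lo: "flip_lo e i j b = flip_lo e i j a" and hi: "flip_hi n e i b = flip_hi n e i a"
    by (rule ext, simp add: flip_lo_def flip_hi_def lev pre)+
  show "flip n e i j b r k = a r k"
  proof (cases "j \<le> k \<and> k < 2 * n")
    case True
    then have "level e b (Suc i) k = flipped n e i j a k" unfolding assms(2)[symmetric] level_flip[OF fl] by simp
    then have fb: "flipped n e i j b k = level e a (Suc i) k" unfolding flipped_def lo hi by simp
    have d: "nat (level e a i k - level e a (Suc i) k) = a i k"
      "nat (level e a (Suc i) k - level e a (Suc (Suc i)) k) = a (Suc i) k"
      by (simp_all add: level_Suc)
    consider "r = i" | "r = Suc i" | "r \<noteq> i" "r \<noteq> Suc i" by blast
    then show ?thesis
    proof cases
      case 3 then show ?thesis unfolding assms(2)[symmetric] by (simp add: flip_def)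
    qed (use True in \<open>simp_all add: flip_def[of n e i j b] fb lev d\<close>)
  next
    case False
    then show ?thesis unfolding assms(2)[symmetric] by (auto simp: flip_def)
  qed
qed

text \<open>Telescoping: \<open>max c (a + 1) + min a (c - 1) = a + c\<close> combines the lower
  bound of a column with the upper bound of the preceding one. Only the special lower bound in
  column \<open>j\<close> survives; its prefix sums compensate the columns that were not flipped,
  and its summand 1 is the correction in the exchanged row sums.\<close>

lemma flip_row_sums:
  assumes fl: "flippable n e i j a"
  shows "prefix_sum (flip n e i j a) i (2 * n) = prefix_sum a (Suc i) (2 * n) - 1"
    "prefix_sum (flip n e i j a) (Suc i) (2 * n) = prefix_sum a i (2 * n) + 1"
proof -
  let ?b = "flip n e i j a" and ?A = "level e a i" and ?B = "level e a (Suc i)" and ?C = "level e a (Suc (Suc i))"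
  let ?u = "1 + prefix_sum a i j - prefix_sum a (Suc i) j"
  note ge = flippable_ge[OF fl]
  have split: "prefix_sum c r (2 * n) = prefix_sum c r j + (\<Sum>k=j..<2 * n. int (c r k))" for c r
    unfolding prefix_sum_def lessThan_atLeast0
    by (rule sum.atLeastLessThan_concat[symmetric]) (use ge in simp_all)
  have partial: "(\<Sum>k=j..<m. flip_lo e i j a k + flip_hi n e i a k) =
     ?u + (\<Sum>k=j..<m. ?A k + ?C k) + (flip_hi n e i a (m - 1) - ?A (m - 1))" if "Suc j \<le> m" "m \<le> 2 * n" for m
    using that
  proof (induction m rule: dec_induct)
    case base
    then show ?case by (simp add: flip_lo_def)
  next
    case (step m)
    have "flip_lo e i j a m + flip_hi n e i a (m - 1) = ?A (m - 1) + ?C m"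
      using step by (auto simp: flip_lo_def flip_hi_def)
    then show ?case using step by simp
  qed
  have "flip_hi n e i a (2 * n - 1) = ?A (2 * n - 1)" using ge by (simp add: flip_hi_def)
  then have tot: "(\<Sum>k=j..<2 * n. flip_lo e i j a k + flip_hi n e i a k) = ?u + (\<Sum>k=j..<2 * n. ?A k + ?C k)"
    using partial[of "2 * n"] ge by simp
  have b1: "int (?b i k) = ?A k - flipped n e i j a k" and b2: "int (?b (Suc i) k) = flipped n e i j a k - ?C k"
    if "k \<in> {j..<2 * n}" for k
    using that flip_bounds[OF fl, of k] flipped_bounds[OF fl, of k] by (simp_all add: flip_def)
  have a1: "int (a i k) = ?A k - ?B k" and a2: "int (a (Suc i) k) = ?B k - ?C k" for k
    by (simp_all add: level_Suc)
  have F: "(\<Sum>k=j..<2 * n. flipped n e i j a k) = ?u + (\<Sum>k=j..<2 * n. ?A k) + (\<Sum>k=j..<2 * n. ?C k) - (\<Sum>k=j..<2 * n. ?B k)"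
    using tot by (simp add: flipped_def sum.distrib sum_subtractf)
  have s1: "(\<Sum>k=j..<2 * n. int (?b i k)) = (\<Sum>k=j..<2 * n. ?A k) - (\<Sum>k=j..<2 * n. flipped n e i j a k)"
    and s2: "(\<Sum>k=j..<2 * n. int (?b (Suc i) k)) = (\<Sum>k=j..<2 * n. flipped n e i j a k) - (\<Sum>k=j..<2 * n. ?C k)"
    by (simp_all only: sum_subtractf[symmetric] b1 b2 cong: sum.cong)
  have s3: "(\<Sum>k=j..<2 * n. int (a i k)) = (\<Sum>k=j..<2 * n. ?A k) - (\<Sum>k=j..<2 * n. ?B k)"
    and s4: "(\<Sum>k=j..<2 * n. int (a (Suc i) k)) = (\<Sum>k=j..<2 * n. ?B k) - (\<Sum>k=j..<2 * n. ?C k)"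
    by (simp_all only: sum_subtractf a1 a2)
  show "prefix_sum ?b i (2 * n) = prefix_sum a (Suc i) (2 * n) - 1"
    "prefix_sum ?b (Suc i) (2 * n) = prefix_sum a i (2 * n) + 1"
    unfolding split s1 s2 s3 s4 F by (simp_all add: prefix_sum_flip)
qed

definition lattice :: "nat \<Rightarrow> (nat \<Rightarrow> nat \<Rightarrow> nat) \<Rightarrow> bool" where
  "lattice n a \<longleftrightarrow> (\<forall>i j. \<not> lattice_fails n a i j)"

definition pivot_column :: "nat \<Rightarrow> (nat \<Rightarrow> nat \<Rightarrow> nat) \<Rightarrow> nat" where
  "pivot_column n a = (LEAST j. \<exists>i. lattice_fails n a i j)"

text \<open>The flip changes the rows \<open>i\<close> and \<open>Suc i\<close> from the pivot
  column on. At this column it cannot alter the status of rows with larger index, but it may alter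
  that of row \<open>i - 1\<close>; taking the last failing row therefore makes the pivot
  stable.\<close>

definition pivot_row :: "nat \<Rightarrow> (nat \<Rightarrow> nat \<Rightarrow> nat) \<Rightarrow> nat" where
  "pivot_row n a = Max {i. lattice_fails n a i (pivot_column n a)}"

lemma finite_lattice_fails: "finite {i. lattice_fails n a i j}"
  by (rule finite_subset[of _ "{..<n}"]) (auto simp: lattice_fails_def)

lemma pivot:
  assumes "a \<in> sp_chains n e" "\<not> lattice n a"
  shows "flippable n e (pivot_row n a) (pivot_column n a) a"
    "k < pivot_column n a \<Longrightarrow> \<not> lattice_fails n a i k"
    "pivot_row n a < i \<Longrightarrow> \<not> lattice_fails n a i (pivot_column n a)"
proof -
  have "\<exists>j i. lattice_fails n a i j" using assms(2) by (auto simp: lattice_def)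
  then have ex: "\<exists>i. lattice_fails n a i (pivot_column n a)" unfolding pivot_column_def by (rule LeastI_ex)
  show small: "\<not> lattice_fails n a i k" if "k < pivot_column n a" for i k
    using not_less_Least[OF that[unfolded pivot_column_def]] by blast
  have "pivot_row n a \<in> {i. lattice_fails n a i (pivot_column n a)}"
    unfolding pivot_row_def using ex by (intro Max_in finite_lattice_fails) auto
  then show "flippable n e (pivot_row n a) (pivot_column n a) a"
    using small assms(1) by (simp add: flippable_def)
  show "\<not> lattice_fails n a i (pivot_column n a)" if "pivot_row n a < i"
  proof
    assume "lattice_fails n a i (pivot_column n a)"
    then have "i \<le> pivot_row n a" unfolding pivot_row_def by (intro Max_ge finite_lattice_fails) simp
    then show False using that by simp
  qed
qed

definition pivot_flip :: "nat \<Rightarrow> (nat \<Rightarrow> int) \<Rightarrow> (nat \<Rightarrow> nat \<Rightarrow> nat) \<Rightarrow> nat \<Rightarrow> nat \<Rightarrow> nat" where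
  "pivot_flip n e a = flip n e (pivot_row n a) (pivot_column n a) a"

lemma pivot_flip:
  assumes a: "a \<in> sp_chains n e" and nl: "\<not> lattice n a"
  shows "pivot_flip n e a \<in> sp_chains n e" "\<not> lattice n (pivot_flip n e a)"
    "pivot_flip n e (pivot_flip n e a) = a"
proof -
  let ?i = "pivot_row n a" and ?j = "pivot_column n a"
  define b where "b = pivot_flip n e a"
  have b: "flip n e ?i ?j a = b" by (simp add: b_def pivot_flip_def)
  note p = pivot[OF a nl]
  note fl = p(1)
  show "pivot_flip n e a \<in> sp_chains n e" unfolding pivot_flip_def by (rule flip_sp_chains[OF fl])
  note ge = flippable_ge[OF fl]
  have pre: "prefix_sum b r m = prefix_sum a r m" if "m \<le> ?j" for r m
    unfolding b[symmetric] by (rule prefix_sum_flip[OF that])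
  have "b (Suc ?i) ?j = nat (flipped n e ?i ?j a ?j - level e a (Suc (Suc ?i)) ?j)"
    using ge unfolding b[symmetric] by (simp add: flip_def)
  then have "prefix_sum a ?i ?j - prefix_sum a (Suc ?i) ?j < int (b (Suc ?i) ?j)"
    using flipped_bounds(1)[OF fl order_refl ge(2)] flip_bounds(7)[OF fl order_refl ge(2) refl] by linarith
  then have f: "lattice_fails n b ?i ?j" unfolding lattice_fails_def
    using ge(3) pre[of ?j ?i] pre[of ?j "Suc ?i"] by (simp add: prefix_sum_def)
  then show "\<not> lattice n (pivot_flip n e a)" unfolding b_def[symmetric] lattice_def by blast
  have small: "lattice_fails n b i k \<longleftrightarrow> lattice_fails n a i k" if "k < ?j" for i k
    unfolding lattice_fails_def using that by (simp add: pre)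
  have col: "pivot_column n b = ?j" unfolding pivot_column_def[of n b]
  proof (rule Least_equality)
    show "\<exists>i. lattice_fails n b i ?j" using f by blast
    fix y assume "\<exists>i. lattice_fails n b i y"
    then show "?j \<le> y" using small p(2) not_le by blast
  qed
  have big: "\<not> lattice_fails n b i ?j" if "?i < i" for i
  proof -
    have "b (Suc i) k = a (Suc i) k" for k using that unfolding b[symmetric] by (simp add: flip_def)
    then have "prefix_sum b (Suc i) (Suc ?j) = prefix_sum a (Suc i) (Suc ?j)" by (simp add: prefix_sum_def)
    then have "lattice_fails n b i ?j \<longleftrightarrow> lattice_fails n a i ?j" unfolding lattice_fails_def by (simp add: pre)
    then show ?thesis using p(3)[OF that] by simp
  qed
  have row: "pivot_row n b = ?i" unfolding pivot_row_def[of n b] col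
  proof (rule Max_eqI[OF finite_lattice_fails])
    show "?i \<in> {i. lattice_fails n b i ?j}" using f by simp
    fix y assume "y \<in> {i. lattice_fails n b i ?j}"
    then show "y \<le> ?i" using big by (meson mem_Collect_eq not_le)
  qed
  show "pivot_flip n e (pivot_flip n e a) = a"
    unfolding b_def[symmetric] unfolding pivot_flip_def[of n e b] row col by (rule flip_flip[OF fl b])
qed

lemma chain_exponent_prefix: "chain_exponent n a i = prefix_sum a i (2 * n) + int n - int i"
  by (simp add: chain_exponent_def prefix_sum_def)

text \<open>The shift by \<open>n - i\<close> in \<open>chain_exponent\<close> absorbs the
  correction by 1 in the exchanged row sums, so the flip interchanges two rows of the
  determinant.\<close>

lemma chain_exponent_pivot_flip:
  assumes a: "a \<in> sp_chains n e" and nl: "\<not> lattice n a"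
  shows "weyl_alternant n (chain_exponent n (pivot_flip n e a)) v = - weyl_alternant n (chain_exponent n a) v"
proof -
  let ?i = "pivot_row n a" and ?j = "pivot_column n a" and ?b = "pivot_flip n e a"
  note fl = pivot(1)[OF a nl]
  have i: "Suc ?i < n" by (rule flippable_ge(3)[OF fl])
  have rest: "prefix_sum ?b r m = prefix_sum a r m" if "r \<noteq> ?i" "r \<noteq> Suc ?i" for r m
    unfolding prefix_sum_def by (rule sum.cong) (use that in \<open>simp_all add: pivot_flip_def flip_def\<close>)
  have ch: "chain_exponent n ?b r = chain_exponent n a (if r = ?i then Suc ?i else if r = Suc ?i then ?i else r)" for r
    using flip_row_sums[OF fl, folded pivot_flip_def] rest[of r "2 * n"] unfolding chain_exponent_prefix by auto
  let ?M = "mat n n (\<lambda>(i, j). pw_anti (v j) (chain_exponent n a i))"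
  have "weyl_alternant n (chain_exponent n ?b) v = det (swaprows ?i (Suc ?i) ?M)"
    unfolding weyl_alternant_def
    by (rule arg_cong[where f = det], rule eq_matI) (use i in \<open>auto simp: ch\<close>)
  also have "\<dots> = - det ?M" by (rule det_swaprows[of _ n]) (use i in auto)
  finally show ?thesis by (simp only: weyl_alternant_def)
qed

section \<open>Coefficients at dominant weights\<close>

lemma increasing_ge:
  fixes q :: "nat \<Rightarrow> nat"
  assumes q: "\<And>i j. i < j \<Longrightarrow> j < n \<Longrightarrow> q i < q j" and k: "k < n"
  shows "k \<le> q k"
  using k
proof (induction k)
  case (Suc k)
  have "q k < q (Suc k)" by (rule q) (use Suc in simp_all)
  then show ?case using Suc by simp
qed simp

lemma increasing_permutes_id:
  fixes p :: "nat \<Rightarrow> nat"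
  assumes p: "p permutes {0..<n}" and mono: "\<And>i j. i < j \<Longrightarrow> j < n \<Longrightarrow> p i < p j"
  shows "p = id"
proof -
  let ?q = "inv_into UNIV p"
  have pq: "p (?q k) = k" "?q (p k) = k" for k using permutes_inverses[OF p] by blast+
  have qlt: "?q k < n" if "k < n" for k using permutes_in_image[OF permutes_inv[OF p], of k] that by simp
  have qm: "?q i < ?q j" if "i < j" "j < n" for i j
  proof (rule ccontr)
    assume "\<not> ?q i < ?q j"
    then have "?q j < ?q i \<or> ?q j = ?q i" by linarith
    then show False
    proof
      assume "?q j < ?q i"
      then have "p (?q j) < p (?q i)" by (rule mono) (use qlt[of i] that in simp)
      then show False using that by (simp only: pq)
    next
      assume "?q j = ?q i"
      then have "p (?q j) = p (?q i)" by simp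
      then show False using that by (simp only: pq)
    qed
  qed
  have "?q k = k" if "k < n" for k
  proof -
    have "?q k \<le> p (?q k)" by (rule increasing_ge[OF mono qlt[OF that]])
    moreover have "k \<le> ?q k" by (rule increasing_ge[OF qm that])
    ultimately show ?thesis by (simp only: pq)
  qed
  then have "p k = k" for k
  proof (cases "k < n")
    case True
    then show ?thesis using \<open>\<And>k. k < n \<Longrightarrow> ?q k = k\<close>[OF True] pq(1)[of k] by simp
  next
    case False
    then show ?thesis using permutes_not_in[OF p] by simp
  qed
  then show ?thesis by auto
qed

definition dominant :: "nat \<Rightarrow> (nat \<Rightarrow> int) \<Rightarrow> bool" where
  "dominant n l \<longleftrightarrow> (\<forall>i<n. 0 < l i) \<and> (\<forall>i j. i < j \<longrightarrow> j < n \<longrightarrow> l j < l i)"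

text \<open>Positive coordinates force all signs to be positive, and strictly decreasing coordinates
  force the permutation to be increasing, hence trivial.\<close>

lemma sp_act_dominant:
  assumes l: "dominant n l" and v: "dominant n v" and w: "w \<in> signed_perms n"
  shows "sp_act n w (weight_vec n l) = weight_vec n v \<longleftrightarrow> w = sp_id n \<and> (\<forall>i<n. v i = l i)"
proof
  assume "w = sp_id n \<and> (\<forall>i<n. v i = l i)"
  then have w: "w = sp_id n" and vl: "\<And>i. i < n \<Longrightarrow> v i = l i" by blast+
  show "sp_act n w (weight_vec n l) = weight_vec n v" unfolding w sp_id(2) id_apply
    by (rule sp_act_ext[of n]) (auto simp: weight_vec_def vl)
next
  assume eq: "sp_act n w (weight_vec n l) = weight_vec n v"
  let ?p = "fst w" and ?c = "snd w"
  have p: "?p permutes {0..<n}" by (rule signed_permsD(1)[OF w])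
  have pl: "?p i < n" if "i < n" for i using permutes_in_image[OF p, of i] that by simp
  have veq: "v i = ?c i * l (?p i)" if "i < n" for i
  proof -
    have "sp_act n w (weight_vec n l) (Suc i) = weight_vec n v (Suc i)" by (simp only: eq)
    then have "real_of_int (?c i * l (?p i)) = real_of_int (v i)"
      unfolding sp_act_Suc[OF that] using that pl[OF that] by (simp add: weight_vec_def)
    then show ?thesis by linarith
  qed
  have c: "?c i = 1" if "i < n" for i
  proof (rule ccontr)
    assume "?c i \<noteq> 1"
    then have "v i = - l (?p i)" using veq[OF that] signed_permsD(2)[OF w that] by auto
    moreover have "0 < v i" "0 < l (?p i)" using l v that pl by (auto simp: dominant_def)
    ultimately show False by simp
  qed
  have "?p = id"
  proof (rule increasing_permutes_id[OF p])
    fix i j assume ij: "i < j" "j < n"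
    then have "v j < v i" using v by (simp add: dominant_def)
    then have "l (?p j) < l (?p i)" using veq c ij by simp
    moreover have "l (?p i) < l (?p j)" if "?p j < ?p i"
      using l pl[of i] ij that by (simp add: dominant_def)
    ultimately show "?p i < ?p j" by (cases "?p i" "?p j" rule: linorder_cases) simp_all
  qed
  moreover have "?c = restrict (\<lambda>_. 1) {..<n}"
    by (rule extensionalityI[OF signed_permsD(4)[OF w]]) (use c in auto)
  ultimately have "w = sp_id n" unfolding sp_id_def by (intro prod_eqI) (simp_all only: fst_conv snd_conv)
  moreover have "v i = l i" if "i < n" for i using veq[OF that] c[OF that] \<open>?p = id\<close> by simp
  ultimately show "w = sp_id n \<and> (\<forall>i<n. v i = l i)" by blast
qed

lemma lookup_weyl_alternant_dominant:
  assumes l: "dominant n l" and v: "dominant n v"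
  shows "Poly_Mapping.lookup (weyl_alternant n v eps_var) (weight_vec n l) = of_bool (\<forall>i<n. v i = l i)"
proof -
  note act = sp_act_dominant[OF l v]
  have "Poly_Mapping.lookup (weyl_alternant n v eps_var) (weight_vec n l) =
    (\<Sum>w\<in>signed_perms n. sp_sign n w * (if sp_act n w (weight_vec n l) = weight_vec n v then 1 else 0))"
    unfolding weyl_alternant_alt lookup_alt lookup_mon ..
  also have "\<dots> = (\<Sum>w\<in>signed_perms n. if w = sp_id n then of_bool (\<forall>i<n. v i = l i) else 0)"
  proof (rule sum.cong[OF refl])
    fix w assume w: "w \<in> signed_perms n"
    show "sp_sign n w * (if sp_act n w (weight_vec n l) = weight_vec n v then 1 else 0) =
      (if w = sp_id n then of_bool (\<forall>i<n. v i = l i) else 0)"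
    proof (cases "w = sp_id n")
      case True
      show ?thesis unfolding act[OF w] unfolding True by (simp add: sp_id(3) of_bool_def)
    next
      case False
      then show ?thesis unfolding act[OF w] by (simp only: simp_thms if_False mult_zero_right)
    qed
  qed
  also have "\<dots> = of_bool (\<forall>i<n. v i = l i)"
    by (subst sum.delta[OF finite_signed_perms]) (simp only: sp_id(1) if_True)
  finally show ?thesis .
qed

text \<open>The lattice condition in the last column makes the row sums weakly decreasing; the shift
  by \<open>n - i\<close> makes the exponents strictly decreasing and positive.\<close>

lemma chain_exponent_dominant:
  assumes "lattice n a"
  shows "dominant n (chain_exponent n a)"
proof -
  have pos: "0 \<le> prefix_sum a i j" for i j unfolding prefix_sum_def by (intro sum_nonneg) simp
  have step: "chain_exponent n a (Suc i) < chain_exponent n a i" if "Suc i < n" for i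
  proof -
    have "prefix_sum a (Suc i) (Suc (2 * n - 1)) \<le> prefix_sum a i (2 * n - 1)"
      using assms that unfolding lattice_def lattice_fails_def by (meson not_less)
    moreover have "prefix_sum a i (Suc (2 * n - 1)) = prefix_sum a i (2 * n - 1) + int (a i (2 * n - 1))"
      by (simp only: prefix_sum_def sum.lessThan_Suc)
    moreover have "Suc (2 * n - 1) = 2 * n" using that by simp
    ultimately show ?thesis unfolding chain_exponent_prefix by simp
  qed
  have "chain_exponent n a j < chain_exponent n a i" if "i < j" "j < n" for i j
    using that
  proof (induction j)
    case (Suc j)
    then show ?case using step[of j] by (cases "i = j") force+
  qed simp
  moreover have "0 < chain_exponent n a i" if "i < n" for i
    using pos[of i "2 * n"] that unfolding chain_exponent_prefix by linarith
  ultimately show ?thesis by (simp add: dominant_def)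
qed

theorem lookup_chain_sum:
  assumes e: "incr (2 * n) e" and l: "dominant n l"
  shows "Poly_Mapping.lookup (chain_sum n e eps_var) (weight_vec n l) =
    int (card {a \<in> sp_chains n e. lattice n a \<and> (\<forall>i<n. chain_exponent n a i = l i)})"
proof -
  let ?g = "\<lambda>a. Poly_Mapping.lookup (weyl_alternant n (chain_exponent n a) eps_var) (weight_vec n l)"
  have fin: "finite (sp_chains n e)" by (rule finite_sp_chains[OF e])
  let ?N = "{a \<in> sp_chains n e. \<not> lattice n a}" and ?L = "{a \<in> sp_chains n e. lattice n a}"
  have "sum ?g ?N = (\<Sum>a\<in>?N. - ?g a)"
  proof (rule sum.reindex_bij_witness[of _ "pivot_flip n e" "pivot_flip n e"])
    fix a assume "a \<in> ?N"
    then have a: "a \<in> sp_chains n e" "\<not> lattice n a" by auto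
    show "pivot_flip n e (pivot_flip n e a) = a" "pivot_flip n e a \<in> ?N"
      "pivot_flip n e (pivot_flip n e a) = a" "pivot_flip n e a \<in> ?N"
      using pivot_flip[OF a] by simp_all
    show "- ?g (pivot_flip n e a) = ?g a"
      unfolding chain_exponent_pivot_flip[OF a] by simp
  qed
  then have N: "sum ?g ?N = 0" by (simp add: sum_negf)
  have "Poly_Mapping.lookup (chain_sum n e eps_var) (weight_vec n l) = sum ?g (sp_chains n e)"
    by (simp only: chain_sum_def lookup_sum)
  also have "sp_chains n e = ?L \<union> ?N" by blast
  also have "sum ?g (?L \<union> ?N) = sum ?g ?L + sum ?g ?N" by (rule sum.union_disjoint) (use fin in auto)
  also have "sum ?g ?L = (\<Sum>a\<in>?L. of_bool (\<forall>i<n. chain_exponent n a i = l i))"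
    by (rule sum.cong) (simp_all add: lookup_weyl_alternant_dominant[OF l chain_exponent_dominant])
  also have "\<dots> = int (card (?L \<inter> {a. \<forall>i<n. chain_exponent n a i = l i}))"
    using fin by (subst sum_of_bool_eq) simp_all
  also have "?L \<inter> {a. \<forall>i<n. chain_exponent n a i = l i} =
    {a \<in> sp_chains n e. lattice n a \<and> (\<forall>i<n. chain_exponent n a i = l i)}" by blast
  finally show ?thesis using N by simp
qed

section \<open>Tableaux and their letter counts\<close>

text \<open>The dictionary between entries and letter counts: it turns a comparison of cells in
  neighbouring rows into a comparison of prefix sums.\<close>

lemma sorted_nth_le_iff:
  fixes xs :: "nat list"
  assumes "sorted xs" "c < length xs"
  shows "xs ! c \<le> v \<longleftrightarrow> c < length (filter (\<lambda>x. x \<le> v) xs)"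
  using assms
proof (induction xs arbitrary: c)
  case (Cons x xs)
  show ?case
  proof (cases "x \<le> v")
    case True
    then show ?thesis using Cons by (cases c) auto
  next
    case False
    then have "\<And>y. y \<in> set (x # xs) \<Longrightarrow> \<not> y \<le> v" using Cons.prems(1) by auto
    then have "filter (\<lambda>x. x \<le> v) (x # xs) = []" "\<not> (x # xs) ! c \<le> v"
      using Cons.prems(2) nth_mem unfolding filter_empty_conv by blast+
    then show ?thesis by simp
  qed
qed simp

lemma sum_count_list_Suc:
  assumes "0 \<notin> set xs"
  shows "(\<Sum>k<v. count_list xs (Suc k)) = length (filter (\<lambda>x. x \<le> v) xs)"
  using assms
proof (induction xs)
  case (Cons x xs)
  have "(\<Sum>k<v. count_list (x # xs) (Suc k)) = (\<Sum>k<v. count_list xs (Suc k)) + (\<Sum>k<v. if k = x - 1 then 1 else 0)"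
    unfolding sum.distrib[symmetric] by (rule sum.cong) (use Cons in auto)
  also have "(\<Sum>k<v. if k = x - 1 then 1 else 0) = (if x \<le> v then 1 else 0)"
    using Cons.prems by auto
  finally show ?case using Cons by simp
qed simp

lemma ssytD:
  assumes "b \<in> ssyt N lam"
  shows "map length b = lam" "length b = length lam" "r < length b \<Longrightarrow> length (b ! r) = lam ! r"
    "r < length b \<Longrightarrow> sorted (b ! r)" "r < length b \<Longrightarrow> set (b ! r) \<subseteq> {1..N}"
    "Suc r < length b \<Longrightarrow> c < length (b ! Suc r) \<Longrightarrow> b ! r ! c < b ! Suc r ! c"
proof -
  show l: "map length b = lam" using assms by (simp add: ssyt_def)
  then show "length b = length lam" "r < length b \<Longrightarrow> length (b ! r) = lam ! r" by auto
  show "r < length b \<Longrightarrow> sorted (b ! r)" "r < length b \<Longrightarrow> set (b ! r) \<subseteq> {1..N}"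
    "Suc r < length b \<Longrightarrow> c < length (b ! Suc r) \<Longrightarrow> b ! r ! c < b ! Suc r ! c"
    using assms nth_mem unfolding ssyt_def by blast+
qed

lemma is_partition_nth:
  assumes "is_partition lam" "i \<le> j" "j < length lam"
  shows "lam ! j \<le> lam ! i"
proof (cases "i = j")
  case False
  then show ?thesis using assms unfolding is_partition_def
    by (metis le_neq_implies_less sorted_wrt_nth_less)
qed simp

lemma ssyt_column:
  assumes b: "b \<in> ssyt N lam" and lam: "is_partition lam" and r: "r < s" "s < length b" and k: "k < length (b ! s)"
  shows "k < length (b ! r)" "b ! r ! k < b ! s ! k"
proof -
  have len: "length (b ! i) = lam ! i" if "i < length b" for i by (rule ssytD(3)[OF b that])
  have step: "k < length (b ! i)" if "i \<le> s" for i
    using k is_partition_nth[OF lam that] r ssytD(2)[OF b] that by (simp add: len)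
  show "k < length (b ! r)" using r by (intro step) simp
  from r(1) show "b ! r ! k < b ! s ! k"
  proof (induction "s - Suc r" arbitrary: r)
    case 0
    then have "s = Suc r" by simp
    then show ?case using ssytD(6)[OF b] r(2) k by simp
  next
    case (Suc d)
    have "b ! r ! k < b ! Suc r ! k" by (rule ssytD(6)[OF b]) (use Suc r in \<open>simp_all add: step\<close>)
    also have "b ! Suc r ! k < b ! s ! k" by (rule Suc(1)) (use Suc in simp_all)
    finally show ?case .
  qed
qed

text \<open>Rows and columns of arrays are counted from 0 but letters from 1, so column
  \<open>j\<close> belongs to the letter \<open>Suc j\<close>.\<close>

definition tableau_counts :: "tableau \<Rightarrow> nat \<Rightarrow> nat \<Rightarrow> nat" where
  "tableau_counts b i j = (if i < length b then count_list (b ! i) (Suc j) else 0)"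

definition row_of_counts :: "nat \<Rightarrow> (nat \<Rightarrow> nat) \<Rightarrow> nat list" where
  "row_of_counts N f = concat (map (\<lambda>j. replicate (f j) (Suc j)) [0..<N])"

text \<open>Condition (C3) with rows counted from 0: \<open>2 * i < x\<close> is the same as
  \<open>2 * (i + 1) - 1 \<le> x\<close>.\<close>

definition odd_tableaux :: "nat \<Rightarrow> nat list \<Rightarrow> tableau set" where
  "odd_tableaux n lam = {b \<in> ssyt (2 * n) lam. \<forall>i<length b. \<forall>x\<in>set (b ! i). 2 * i < x}"

definition count_arrays :: "nat \<Rightarrow> nat list \<Rightarrow> (nat \<Rightarrow> nat \<Rightarrow> nat) set" where
  "count_arrays n lam = {a. (\<forall>i j. a i j \<noteq> 0 \<longrightarrow> i < n \<and> 2 * i \<le> j \<and> j < 2 * n) \<and> lattice n a \<and>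
     (\<forall>i<n. prefix_sum a i (2 * n) = (if i < length lam then int (lam ! i) else 0))}"

lemma row_of_counts:
  "length (row_of_counts N f) = (\<Sum>j<N. f j)"
  "sorted (row_of_counts N f)"
  "x \<in> set (row_of_counts N f) \<Longrightarrow> \<exists>j<N. x = Suc j \<and> f j \<noteq> 0"
  "count_list (row_of_counts N f) (Suc j) = (if j < N then f j else 0)"
proof -
  have S: "row_of_counts (Suc N) f = row_of_counts N f @ replicate (f N) (Suc N)" for N by (simp add: row_of_counts_def)
  have Z: "row_of_counts 0 f = []" by (simp add: row_of_counts_def)
  show m: "\<exists>j<N. x = Suc j \<and> f j \<noteq> 0" if "x \<in> set (row_of_counts N f)" for x N
    using that unfolding row_of_counts_def by auto
  show "length (row_of_counts N f) = (\<Sum>j<N. f j)" by (induction N) (simp_all add: S Z)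
  show "sorted (row_of_counts N f)"
    by (induction N) (auto simp: S Z sorted_append dest!: m)
  have r: "count_list (replicate m y) x = (if x = y then m else 0)" for m and x y :: nat by (induction m) auto
  show "count_list (row_of_counts N f) (Suc j) = (if j < N then f j else 0)"
    by (induction N) (auto simp: S Z r less_Suc_eq)
qed

lemma prefix_sum_tableau_counts:
  assumes b: "b \<in> ssyt N lam" and i: "i < length b"
  shows "prefix_sum (tableau_counts b) i v = int (length (filter (\<lambda>x. x \<le> v) (b ! i)))"
proof -
  have "0 \<notin> set (b ! i)" using ssytD(5)[OF b i] by auto
  from sum_count_list_Suc[OF this, of v] show ?thesis
    using i by (simp add: prefix_sum_def tableau_counts_def flip: of_nat_sum)
qed

lemma tableau_counts_in:
  assumes lam: "is_partition lam" "length lam \<le> n" and b: "b \<in> odd_tableaux n lam"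
  shows "tableau_counts b \<in> count_arrays n lam"
proof -
  have bs: "b \<in> ssyt (2 * n) lam" and odd: "\<And>i x. i < length b \<Longrightarrow> x \<in> set (b ! i) \<Longrightarrow> 2 * i < x"
    using b by (auto simp: odd_tableaux_def)
  note D = ssytD[OF bs]
  let ?a = "tableau_counts b"
  have supp: "i < n \<and> 2 * i \<le> j \<and> j < 2 * n" if "?a i j \<noteq> 0" for i j
  proof -
    have i: "i < length b" and "count_list (b ! i) (Suc j) \<noteq> 0"
      using that by (simp_all add: tableau_counts_def split: if_splits)
    then have "Suc j \<in> set (b ! i)" by (simp add: count_list_0_iff)
    then show ?thesis using odd[OF i] D(5)[OF i] i D(2) lam(2) by force
  qed
  have "\<not> lattice_fails n ?a i j" for i j
  proof
    assume "lattice_fails n ?a i j"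
    then have lt: "prefix_sum ?a i j < prefix_sum ?a (Suc i) (Suc j)" by (simp add: lattice_fails_def)
    have i: "Suc i < length b"
    proof (rule ccontr)
      assume "\<not> Suc i < length b"
      then have "prefix_sum ?a (Suc i) (Suc j) = 0" by (simp add: prefix_sum_def tableau_counts_def)
      moreover have "0 \<le> prefix_sum ?a i j" unfolding prefix_sum_def by (intro sum_nonneg) simp
      ultimately show False using lt by simp
    qed
    have i': "i < length b" using i by simp
    let ?m = "length (filter (\<lambda>x. x \<le> Suc j) (b ! Suc i))"
    have lt2: "length (filter (\<lambda>x. x \<le> j) (b ! i)) < ?m"
      using lt unfolding prefix_sum_tableau_counts[OF bs i] prefix_sum_tableau_counts[OF bs i'] by simp
    \<comment> \<open>\<open>c\<close> is the last cell of the lower row with an entry at most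
      \<open>Suc j\<close>. The cell above it has an entry at most \<open>j\<close>, which
      contradicts the smaller count in the upper row.\<close>
    then obtain c where c: "?m = Suc c" by (cases ?m) auto
    have cl: "c < length (b ! Suc i)" using c length_filter_le[of "\<lambda>x. x \<le> Suc j" "b ! Suc i"] by simp
    have "b ! Suc i ! c \<le> Suc j" using sorted_nth_le_iff[OF D(4)[OF i] cl] c by simp
    then have "b ! i ! c \<le> j" using D(6)[OF i cl] by simp
    moreover have "c < length (b ! i)" by (rule ssyt_column(1)[OF bs lam(1) _ i cl]) simp
    ultimately have "c < length (filter (\<lambda>x. x \<le> j) (b ! i))" using sorted_nth_le_iff[OF D(4)[OF i']] by simp
    then show False using lt2 c by simp
  qed
  moreover have "prefix_sum ?a i (2 * n) = (if i < length lam then int (lam ! i) else 0)" for i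
  proof (cases "i < length b")
    case True
    have "filter (\<lambda>x. x \<le> 2 * n) (b ! i) = b ! i" using D(5)[OF True] by (intro filter_True) auto
    then show ?thesis using True D(2) D(3)[OF True] by (simp add: prefix_sum_tableau_counts[OF bs True])
  next
    case False
    then show ?thesis using D(2) by (simp add: prefix_sum_def tableau_counts_def)
  qed
  ultimately show ?thesis using supp unfolding count_arrays_def lattice_def by blast
qed

lemma tableau_counts_inj:
  "inj_on tableau_counts (odd_tableaux n lam)"
proof (rule inj_onI)
  fix b b' assume b: "b \<in> odd_tableaux n lam" "b' \<in> odd_tableaux n lam" and eq: "tableau_counts b = tableau_counts b'"
  have s: "b \<in> ssyt (2 * n) lam" "b' \<in> ssyt (2 * n) lam" using b by (auto simp: odd_tableaux_def)
  note D = ssytD[OF s(1)] and D' = ssytD[OF s(2)]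
  show "b = b'"
  proof (rule nth_equalityI)
    show "length b = length b'" using D(2) D'(2) by simp
    fix i assume i: "i < length b"
    then have i': "i < length b'" using D(2) D'(2) by simp
    have "count_list (b ! i) x = count_list (b' ! i) x" for x
    proof (cases x)
      case 0
      then have "x \<notin> set (b ! i)" "x \<notin> set (b' ! i)" using D(5)[OF i] D'(5)[OF i'] by auto
      then show ?thesis by simp
    next
      case (Suc j)
      then show ?thesis using fun_cong[OF fun_cong[OF eq, of i], of j] i i' by (simp add: tableau_counts_def)
    qed
    then have "mset (b ! i) = mset (b' ! i)" by (intro multiset_eqI) (simp only: count_mset)
    then show "b ! i = b' ! i" using D(4)[OF i] D'(4)[OF i'] by (metis properties_for_sort)
  qed
qed

lemma tableau_counts_surj:
  assumes lam: "is_partition lam" "length lam \<le> n" and a: "a \<in> count_arrays n lam"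
  shows "\<exists>b\<in>odd_tableaux n lam. tableau_counts b = a"
proof
  have supp: "\<And>i j. a i j \<noteq> 0 \<Longrightarrow> i < n \<and> 2 * i \<le> j \<and> j < 2 * n" and lat: "\<And>i j. \<not> lattice_fails n a i j"
    and sums: "\<And>i. i < n \<Longrightarrow> prefix_sum a i (2 * n) = (if i < length lam then int (lam ! i) else 0)"
    using a by (auto simp: count_arrays_def lattice_def)
  define b where "b = map (\<lambda>i. row_of_counts (2 * n) (a i)) [0..<length lam]"
  have len: "length b = length lam" by (simp add: b_def)
  have row: "b ! i = row_of_counts (2 * n) (a i)" if "i < length b" for i using that by (simp add: b_def)
  have tc: "tableau_counts b i j = a i j" for i j
  proof (cases "i < length b")
    case True
    then show ?thesis using supp[of i j] by (auto simp: tableau_counts_def row row_of_counts)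
  next
    case False
    have "a i j = 0"
    proof (rule ccontr)
      assume nz: "a i j \<noteq> 0"
      then have "prefix_sum a i (2 * n) = 0" using sums[of i] False len supp[OF nz] by simp
      then have "\<forall>k\<in>{..<2 * n}. int (a i k) = 0" unfolding prefix_sum_def
        by (subst (asm) sum_nonneg_eq_0_iff) auto
      then show False using nz supp[OF nz] by auto
    qed
    then show ?thesis using False by (simp add: tableau_counts_def)
  qed
  have rlen: "length (b ! i) = lam ! i" if "i < length b" for i
  proof -
    have "int (\<Sum>j<2 * n. a i j) = int (lam ! i)" using sums[of i] that len lam(2) by (simp add: prefix_sum_def)
    then show ?thesis by (simp only: row[OF that] row_of_counts(1) of_nat_eq_iff)
  qed
  have mem: "1 \<le> x \<and> x \<le> 2 * n \<and> 2 * i < x" if "i < length b" "x \<in> set (b ! i)" for i x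
  proof -
    have "x \<in> set (row_of_counts (2 * n) (a i))" using that(2) unfolding row[OF that(1)] .
    from row_of_counts(3)[OF this] obtain j where "j < 2 * n" "x = Suc j" "a i j \<noteq> 0" by blast
    then show ?thesis using supp[of i j] by simp
  qed
  have srt: "sorted (b ! i)" if "i < length b" for i by (simp add: row[OF that] row_of_counts)
  have pre: "prefix_sum a i v = int (length (filter (\<lambda>x. x \<le> v) (b ! i)))" if i: "i < length b" for i v
  proof -
    have "0 \<notin> set (b ! i)" using mem[OF i] by force
    from sum_count_list_Suc[OF this, of v] have "(\<Sum>k<v. tableau_counts b i k) = length (filter (\<lambda>x. x \<le> v) (b ! i))"
      using i by (simp add: tableau_counts_def)
    then show ?thesis by (simp add: tc prefix_sum_def flip: of_nat_sum)
  qed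
  have col: "b ! r ! c < b ! Suc r ! c" if r: "Suc r < length b" and c: "c < length (b ! Suc r)" for r c
  proof -
    have r': "r < length b" using r by simp
    have "b ! Suc r ! c \<noteq> 0" using mem[OF r nth_mem[OF c]] by simp
    then obtain j where j: "b ! Suc r ! c = Suc j" by (cases "b ! Suc r ! c") auto
    have "c < length (filter (\<lambda>x. x \<le> Suc j) (b ! Suc r))" using sorted_nth_le_iff[OF srt[OF r] c, of "Suc j"] j by simp
    also have "int \<dots> \<le> int (length (filter (\<lambda>x. x \<le> j) (b ! r)))"
      using lat[of r j] r len lam(2) unfolding lattice_fails_def pre[OF r] pre[OF r'] by simp
    finally have cj: "c < length (filter (\<lambda>x. x \<le> j) (b ! r))" by simp
    also have "\<dots> \<le> length (b ! r)" by simp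
    finally have "b ! r ! c \<le> j" using sorted_nth_le_iff[OF srt[OF r'], of c j] cj by simp
    then show ?thesis using j by simp
  qed
  have "map length b = lam" by (rule nth_equalityI) (simp_all add: len rlen)
  moreover have "\<forall>row\<in>set b. sorted row \<and> set row \<subseteq> {1..2 * n}"
    unfolding all_set_conv_all_nth using srt mem by auto
  ultimately show "b \<in> odd_tableaux n lam" using col mem by (simp add: odd_tableaux_def ssyt_def)
  show "tableau_counts b = a" by (intro ext) (rule tc)
qed

lemma bij_tableau_counts:
  assumes "is_partition lam" "length lam \<le> n"
  shows "bij_betw tableau_counts (odd_tableaux n lam) (count_arrays n lam)"
  unfolding bij_betw_def using tableau_counts_inj tableau_counts_in[OF assms] tableau_counts_surj[OF assms] by blast

section \<open>Crystal statistics\<close>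

definition sign_excess :: "nat \<Rightarrow> nat list \<Rightarrow> int" where
  "sign_excess i w = int (count_list w (Suc i)) - int (count_list w i)"

text \<open>The subtraction in the first claim is truncated: if there is no \<open>Minus\<close> to
  delete, the new \<open>Plus\<close> survives.\<close>

lemma cancel_Plus: "count_list (cancel (Plus # xs)) Minus = count_list (cancel xs) Minus - 1"
  "int (count_list (cancel (Plus # xs)) Plus) - int (count_list (cancel (Plus # xs)) Minus) =
     1 + int (count_list (cancel xs) Plus) - int (count_list (cancel xs) Minus)"
proof -
  obtain p q where pq: "cancel xs = replicate p Minus @ replicate q Plus" using cancel_normal_form by blast
  have r: "count_list (replicate m y) x = (if x = y then m else 0)" for m and x y :: sign by (induction m) auto
  have "cancel (Plus # xs) = (if p = 0 then replicate (Suc q) Plus else replicate (p - 1) Minus @ replicate q Plus)"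
    using pq by (cases p; cases q) simp_all
  then show "count_list (cancel (Plus # xs)) Minus = count_list (cancel xs) Minus - 1"
    "int (count_list (cancel (Plus # xs)) Plus) - int (count_list (cancel (Plus # xs)) Minus) =
     1 + int (count_list (cancel xs) Plus) - int (count_list (cancel xs) Minus)"
    unfolding pq by (simp_all add: r)
qed

lemma cancel_Minus: "cancel (Minus # xs) = Minus # cancel xs"
  by simp

lemma cancel_difference:
  "int (count_list (cancel xs) Plus) - int (count_list (cancel xs) Minus) = int (count_list xs Plus) - int (count_list xs Minus)"
proof (induction xs)
  case (Cons x xs)
  show ?case
  proof (cases x)
    case Plus
    then show ?thesis using cancel_Plus(2)[of xs] Cons by simp
  next
    case Minus
    then show ?thesis using Cons by (simp only: cancel_Minus) simp
  qed
qed simp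

lemma signature_simps:
  "signature i [] = []"
  "signature i (x # w) = (if x = i then Plus # signature i w else if x = Suc i then Minus # signature i w else signature i w)"
  "signature i (u @ w) = signature i u @ signature i w"
  by (simp_all add: signature_def)

lemma count_signature:
  "count_list (signature i w) Plus = count_list w i" "count_list (signature i w) Minus = count_list w (Suc i)"
  by (induction w) (simp_all add: signature_simps)

lemma signature_column:
  assumes "sorted_wrt (<) cl"
  shows "signature i cl = (if i \<in> set cl then [Plus] else []) @ (if Suc i \<in> set cl then [Minus] else [])"
  using assms
proof (induction cl)
  case (Cons x cl)
  then have lt: "\<And>y. y \<in> set cl \<Longrightarrow> x < y" by simp
  have "x \<notin> set cl" "x = Suc i \<Longrightarrow> i \<notin> set cl" using lt[of x] lt[of i] by auto
  then show ?case using Cons by (auto simp: signature_simps)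
qed (simp add: signature_simps)

text \<open>Inside a strictly increasing column a letter \<open>i\<close> is read before \<open>i + 1\<close>, so the excess of
  the letters \<open>i + 1\<close> over a prefix of the word is maximal at a boundary between two columns.\<close>

lemma cancel_columns_le_iff:
  assumes "\<forall>cl\<in>set L. sorted_wrt (<) cl"
  shows "int (count_list (cancel (signature i (concat L))) Minus) \<le> K \<longleftrightarrow>
    (\<forall>m\<le>length L. (\<Sum>k<m. sign_excess i (L ! k)) \<le> K)"
  using assms
proof (induction L arbitrary: K)
  case Nil
  then show ?case by (simp add: signature_simps)
next
  case (Cons cl L)
  let ?p = "\<lambda>xs. count_list (cancel xs) Minus" and ?s = "signature i (concat L)"
  have IH: "int (?p ?s) \<le> K \<longleftrightarrow> (\<forall>m\<le>length L. (\<Sum>k<m. sign_excess i (L ! k)) \<le> K)" for K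
    by (rule Cons.IH) (use Cons.prems in simp)
  have "(\<forall>m\<le>length (cl # L). (\<Sum>k<m. sign_excess i ((cl # L) ! k)) \<le> K) \<longleftrightarrow>
    0 \<le> K \<and> (\<forall>m\<le>length L. (\<Sum>k<m. sign_excess i (L ! k)) \<le> K - sign_excess i cl)" (is "?A \<longleftrightarrow> ?B")
  proof
    assume A: ?A
    have "0 \<le> K" using A[rule_format, of 0] by simp
    moreover have "(\<Sum>k<m. sign_excess i (L ! k)) \<le> K - sign_excess i cl" if "m \<le> length L" for m
      using A[rule_format, of "Suc m"] that by (simp add: sum.lessThan_Suc_shift del: sum.lessThan_Suc)
    ultimately show ?B by blast
  next
    assume B: ?B
    show ?A
    proof (intro allI impI)
      fix m assume "m \<le> length (cl # L)"
      then show "(\<Sum>k<m. sign_excess i ((cl # L) ! k)) \<le> K"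
        using B by (cases m) (auto simp: sum.lessThan_Suc_shift simp del: sum.lessThan_Suc)
    qed
  qed
  also have "\<dots> \<longleftrightarrow> 0 \<le> K \<and> int (?p ?s) \<le> K - sign_excess i cl" by (simp only: IH)
  also have "\<dots> \<longleftrightarrow> int (?p (signature i cl @ ?s)) \<le> K"
  proof -
    have cl: "sorted_wrt (<) cl" using Cons.prems by simp
    have ex: "sign_excess i cl = of_bool (Suc i \<in> set cl) - of_bool (i \<in> set cl)"
      unfolding sign_excess_def count_signature[symmetric] signature_column[OF cl] by simp
    have pm: "?p (Plus # Minus # xs) = ?p xs" for xs using cancel_factor[of "[]" xs] by simp
    consider "i \<in> set cl" "Suc i \<in> set cl" | "i \<in> set cl" "Suc i \<notin> set cl"
      | "i \<notin> set cl" "Suc i \<in> set cl" | "i \<notin> set cl" "Suc i \<notin> set cl" by blast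
    then show ?thesis
    proof cases
      case 1
      then show ?thesis unfolding signature_column[OF cl] ex using pm[of ?s] by (simp del: cancel.simps) linarith
    next
      case 2
      then show ?thesis unfolding signature_column[OF cl] ex by (simp del: cancel.simps add: cancel_Plus(1)) linarith
    next
      case 3
      then show ?thesis unfolding signature_column[OF cl] ex by (simp del: cancel.simps add: cancel_Minus) linarith
    next
      case 4
      then show ?thesis unfolding signature_column[OF cl] ex by (simp del: cancel.simps) linarith
    qed
  qed
  finally show ?case by (simp add: signature_simps)
qed

lemma count_list_map_filter:
  "count_list (map f (filter P xs)) x = (\<Sum>r<length xs. of_bool (P (xs ! r) \<and> f (xs ! r) = x))"
  by (induction xs) (simp_all add: sum.lessThan_Suc_shift del: sum.lessThan_Suc)

lemma count_list_nth: "length xs \<le> M \<Longrightarrow> count_list xs x = (\<Sum>k<M. of_bool (k < length xs \<and> xs ! k = x))"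
proof (induction xs arbitrary: M)
  case (Cons y xs)
  then obtain M' where "M = Suc M'" "length xs \<le> M'" by (cases M) auto
  then show ?case using Cons by (simp add: sum.lessThan_Suc_shift del: sum.lessThan_Suc)
qed simp

lemma length_le_transpose:
  assumes "r < length b"
  shows "length (b ! r) \<le> length (List.transpose b)"
proof -
  have "length row \<le> foldr (\<lambda>xs. max (length xs)) b 0" if "row \<in> set b" for row
    using that by (induction b) auto
  then show ?thesis using assms by (simp add: length_transpose)
qed

lemma transpose_column_increasing:
  assumes b: "b \<in> ssyt N lam" and lam: "is_partition lam" and cl: "cl \<in> set (List.transpose b)"
  shows "sorted_wrt (<) cl"
proof -
  obtain k where k: "k < length (List.transpose b)" "cl = List.transpose b ! k" using cl by (auto simp: in_set_conv_nth)
  have "sorted_wrt (\<lambda>row row'. k < length row' \<longrightarrow> row ! k < row' ! k) b"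
    unfolding sorted_wrt_iff_nth_less using ssyt_column(2)[OF b lam] by blast
  then have "sorted_wrt (\<lambda>row row'. k < length row' \<longrightarrow> row ! k < row' ! k) (filter (\<lambda>ys. k < length ys) b)"
    by (rule sorted_wrt_filter)
  then have "sorted_wrt (\<lambda>row row'. row ! k < row' ! k) (filter (\<lambda>ys. k < length ys) b)"
    by (rule sorted_wrt_mono_rel[rotated]) simp
  then show ?thesis unfolding k(2) nth_transpose[OF k(1)] sorted_wrt_map .
qed

text \<open>Columns are read from right to left, so a prefix of the word that ends between two
  columns consists of the columns from some \<open>c\<close> on. The value
  \<open>c = length (List.transpose b)\<close> is the empty prefix and contributes the condition
  \<open>0 \<le> K\<close>.\<close>

lemma crystal_eps_columns:
  assumes b: "b \<in> ssyt N lam" and lam: "is_partition lam"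
  shows "int (crystal_eps i b) \<le> K \<longleftrightarrow>
    (\<forall>c\<le>length (List.transpose b). (\<Sum>k=c..<length (List.transpose b). sign_excess i (List.transpose b ! k)) \<le> K)"
proof -
  let ?T = "List.transpose b" and ?M = "length (List.transpose b)"
  have s: "(\<Sum>k<m. sign_excess i (rev ?T ! k)) = (\<Sum>k=?M - m..<?M. sign_excess i (?T ! k))" if m: "m \<le> ?M" for m
    by (rule sum.reindex_bij_witness[of _ "\<lambda>k. ?M - 1 - k" "\<lambda>k. ?M - 1 - k"]) (use m in \<open>auto simp: rev_nth\<close>)
  have "int (crystal_eps i b) \<le> K \<longleftrightarrow> (\<forall>m\<le>?M. (\<Sum>k<m. sign_excess i (rev ?T ! k)) \<le> K)"
    unfolding crystal_eps_def reading_word_def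
    using cancel_columns_le_iff[of "rev ?T" i K] transpose_column_increasing[OF b lam] by simp
  also have "\<dots> \<longleftrightarrow> (\<forall>m\<le>?M. (\<Sum>k=?M - m..<?M. sign_excess i (?T ! k)) \<le> K)" using s by auto
  also have "\<dots> \<longleftrightarrow> (\<forall>c\<le>?M. (\<Sum>k=c..<?M. sign_excess i (?T ! k)) \<le> K)"
  proof (intro iffI allI impI)
    fix c assume A: "\<forall>m\<le>?M. (\<Sum>k=?M - m..<?M. sign_excess i (?T ! k)) \<le> K" and c: "c \<le> ?M"
    show "(\<Sum>k=c..<?M. sign_excess i (?T ! k)) \<le> K" using A[rule_format, of "?M - c"] c by simp
  next
    fix m assume "\<forall>c\<le>?M. (\<Sum>k=c..<?M. sign_excess i (?T ! k)) \<le> K"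
    then show "(\<Sum>k=?M - m..<?M. sign_excess i (?T ! k)) \<le> K" by simp
  qed
  finally show ?thesis .
qed

text \<open>Indicators that sum along a row to \<open>tableau_counts\<close> and along a column to
  the excess of that column; exchanging the two summations links the reading word to the
  arrays.\<close>

definition cell :: "tableau \<Rightarrow> nat \<Rightarrow> nat \<Rightarrow> nat \<Rightarrow> int" where
  "cell b x r k = of_bool (k < length (b ! r) \<and> b ! r ! k = x)"

lemma sign_excess_transpose:
  assumes "k < length (List.transpose b)"
  shows "sign_excess i (List.transpose b ! k) = (\<Sum>r<length b. cell b (Suc i) r k - cell b i r k)"
  unfolding sign_excess_def nth_transpose[OF assms] count_list_map_filter cell_def sum_subtractf
  by simp

lemma sum_sign_excess_transpose:
  assumes "d \<le> length (List.transpose b)"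
  shows "(\<Sum>k=c..<d. sign_excess i (List.transpose b ! k)) =
    (\<Sum>r<length b. (\<Sum>k=c..<d. cell b (Suc i) r k) - (\<Sum>k=c..<d. cell b i r k))"
proof -
  have "(\<Sum>k=c..<d. sign_excess i (List.transpose b ! k)) = (\<Sum>k=c..<d. \<Sum>r<length b. cell b (Suc i) r k - cell b i r k)"
    by (rule sum.cong) (use assms in \<open>auto intro!: sign_excess_transpose\<close>)
  then show ?thesis unfolding sum_subtractf[symmetric] by (simp only: sum.swap[of _ "{c..<d}"])
qed

lemma tableau_counts_cell:
  assumes "r < length b"
  shows "int (tableau_counts b r j) = (\<Sum>k<length (List.transpose b). cell b (Suc j) r k)"
  using assms count_list_nth[OF length_le_transpose[OF assms], of "Suc j"]
  by (simp add: tableau_counts_def cell_def)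

lemma colsum_tableau_counts: "length b \<le> r \<Longrightarrow> colsum (tableau_counts b) r j = colsum (tableau_counts b) (length b) j"
  unfolding colsum_def by (rule sum.mono_neutral_right) (auto simp: tableau_counts_def)

text \<open>The maximum over columns in \<open>crystal_eps_columns\<close> equals a maximum over rows: for a row \<open>r\<close> take the
  first column in which its entry exceeds \<open>Suc j\<close>, for a column take the lowest row with an entry
  \<open>Suc (Suc j)\<close> from that column on.\<close>

lemma crystal_eps_rows:
  assumes b: "b \<in> ssyt N lam" and lam: "is_partition lam" and n: "length lam \<le> n" "1 \<le> n"
  shows "int (crystal_eps (Suc j) b) \<le> K \<longleftrightarrow>
    (\<forall>r<n. colsum (tableau_counts b) (Suc r) (Suc j) - colsum (tableau_counts b) r j \<le> K)"
proof -
  let ?M = "length (List.transpose b)" and ?R = "length b" and ?a = "tableau_counts b"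
  \<comment> \<open>\<open>H\<close> counts the letters \<open>x\<close> of row \<open>s\<close> to
    the left of column \<open>c\<close>, \<open>G\<close> those from column \<open>c\<close>
    on.\<close>
  define G where "G x s c = (\<Sum>k=c..<?M. cell b x s k)" for x s c
  define H where "H x s c = (\<Sum>k<c. cell b x s k)" for x s c
  let ?p = "Suc j" and ?q = "Suc (Suc j)"
  define E where "E c = (\<Sum>k=c..<?M. sign_excess ?p (List.transpose b ! k))" for c
  define F where "F r = colsum ?a (Suc r) (Suc j) - colsum ?a r j" for r
  note D = ssytD[OF b]
  have cell_nonneg: "0 \<le> cell b x s k" for x s k by (simp add: cell_def)
  have Gpos: "0 \<le> G x s c" for x s c unfolding G_def by (intro sum_nonneg cell_nonneg)
  have GH: "int (?a s i) = H (Suc i) s c + G (Suc i) s c" if "s < ?R" "c \<le> ?M" for s i c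
    unfolding tableau_counts_cell[OF that(1)] H_def G_def lessThan_atLeast0
    by (rule sum.atLeastLessThan_concat[symmetric]) (use that in simp_all)
  have E: "E c = (\<Sum>s<?R. G ?q s c) - (\<Sum>s<?R. G ?p s c)" for c
    unfolding E_def sum_sign_excess_transpose[OF order_refl] G_def sum_subtractf ..
  have F: "F r = (\<Sum>s<Suc r. H ?q s c) + (\<Sum>s<Suc r. G ?q s c) - (\<Sum>s<r. H ?p s c) - (\<Sum>s<r. G ?p s c)"
    if "r < ?R" "c \<le> ?M" for r c
  proof -
    have "colsum ?a (Suc r) (Suc j) = (\<Sum>s<Suc r. H ?q s c + G ?q s c)" "colsum ?a r j = (\<Sum>s<r. H ?p s c + G ?p s c)"
      unfolding colsum_def by (rule sum.cong; use that in \<open>simp add: GH[of _ c]\<close>)+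
    then show ?thesis unfolding F_def sum.distrib by simp
  qed
  have len: "?R \<le> n" using D(2) n by simp
  have "(\<forall>c\<le>?M. E c \<le> K) \<longleftrightarrow> (\<forall>r<n. F r \<le> K)"
  proof (intro iffI allI impI)
    fix r assume A: "\<forall>c\<le>?M. E c \<le> K" and r: "r < n"
    show "F r \<le> K"
    proof (cases "r < ?R")
      case False
      \<comment> \<open>Past the last row the column sums are totals over the whole tableau, which
        corresponds to the column \<open>c = 0\<close>.\<close>
      have "colsum ?a ?R i = (\<Sum>s<?R. G (Suc i) s 0)" for i
        unfolding colsum_def by (rule sum.cong) (simp_all add: GH[of _ 0] H_def)
      moreover have "colsum ?a r j = colsum ?a ?R j" "colsum ?a (Suc r) (Suc j) = colsum ?a ?R (Suc j)"
        using False by (intro colsum_tableau_counts; simp)+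
      ultimately have "F r = E 0" unfolding F_def E by simp
      then show ?thesis using A by simp
    next
      case True
      define c where "c = length (filter (\<lambda>x. x \<le> ?p) (b ! r))"
      have cl: "c \<le> length (b ! r)" by (simp add: c_def)
      then have cM: "c \<le> ?M" using length_le_transpose[OF True] by simp
      have le: "b ! r ! k \<le> ?p \<longleftrightarrow> k < c" if "k < length (b ! r)" for k
        unfolding c_def by (rule sorted_nth_le_iff[OF D(4)[OF True] that])
      \<comment> \<open>To the left of \<open>c\<close>, row \<open>r\<close> has entries at most
        \<open>Suc j\<close>, so the rows above have smaller ones. From \<open>c\<close> on, row
        \<open>r\<close> has entries at least \<open>Suc (Suc j)\<close>, so the rows below have
        larger ones. Neither region contains a letter that matters, and the two differences
        agree.\<close>
      have H0: "H x s c = 0" if "s < r" "x = ?p \<or> x = ?q" for s x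
        unfolding H_def
      proof (rule sum.neutral, rule ballI)
        fix k assume "k \<in> {..<c}"
        then have k: "k < length (b ! r)" "b ! r ! k \<le> ?p" using cl le[of k] by auto
        have "b ! s ! k < b ! r ! k" by (rule ssyt_column(2)[OF b lam that(1) True k(1)])
        then show "cell b x s k = 0" using k(2) that(2) by (auto simp: cell_def)
      qed
      have H1: "H ?q r c = 0" unfolding H_def
      proof (rule sum.neutral, rule ballI)
        fix k assume "k \<in> {..<c}"
        then show "cell b ?q r k = 0" using cl le[of k] by (auto simp: cell_def)
      qed
      have G1: "G ?p r c = 0" unfolding G_def
      proof (rule sum.neutral, rule ballI)
        fix k assume "k \<in> {c..<?M}"
        then show "cell b ?p r k = 0" using le[of k] by (auto simp: cell_def)
      qed
      have G0: "G x s c = 0" if s: "r < s" "s < ?R" and "x = ?p \<or> x = ?q" for s x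
        unfolding G_def
      proof (rule sum.neutral, rule ballI)
        note x = that(3)
        fix k assume k: "k \<in> {c..<?M}"
        have "b ! s ! k \<noteq> x" if "k < length (b ! s)"
          using ssyt_column[OF b lam s that] le[of k] k x by force
        then show "cell b x s k = 0" by (auto simp: cell_def)
      qed
      have split: "(\<Sum>s<?R. g s) = (\<Sum>s<r. g s) + g r + (\<Sum>s=Suc r..<?R. g s)" for g :: "nat \<Rightarrow> int"
        using sum.atLeastLessThan_concat[of 0 "Suc r" ?R g] True by (simp add: lessThan_atLeast0)
      have z: "(\<Sum>s=Suc r..<?R. G ?p s c) = 0" "(\<Sum>s=Suc r..<?R. G ?q s c) = 0"
        "(\<Sum>s<r. H ?p s c) = 0" "(\<Sum>s<r. H ?q s c) = 0"
        by (rule sum.neutral; use G0 H0 in simp)+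
      have "F r = E c" unfolding F[OF True cM] E split using z G1 H1 by simp
      then show ?thesis using A cM by simp
    qed
  next
    fix c assume A: "\<forall>r<n. F r \<le> K" and c: "c \<le> ?M"
    \<comment> \<open>Row 0, available because \<open>1 \<le> n\<close>, bounds \<open>K\<close>
      below by 0. This settles the case in which no letter \<open>Suc (Suc j)\<close> occurs from
      column \<open>c\<close> on.\<close>
    have "0 \<le> F 0" by (simp add: F_def colsum_def)
    then have K: "0 \<le> K" using A n by force
    let ?S = "{s. s < ?R \<and> G ?q s c \<noteq> 0}"
    show "E c \<le> K"
    proof (cases "?S = {}")
      case True
      then have "(\<Sum>s<?R. G ?q s c) = 0" by (intro sum.neutral) auto
      moreover have "0 \<le> (\<Sum>s<?R. G ?p s c)" by (intro sum_nonneg Gpos)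
      ultimately show ?thesis using K unfolding E by simp
    next
      case False
      have fin: "finite ?S" by simp
      define r where "r = Max ?S"
      have rS: "r \<in> ?S" unfolding r_def by (rule Max_in[OF fin False])
      then have r: "r < ?R" by simp
      have above: "G ?q s c = 0" if "r < s" "s < ?R" for s
      proof (rule ccontr)
        assume "G ?q s c \<noteq> 0"
        then have "s \<le> r" unfolding r_def using that by (intro Max_ge[OF fin]) simp
        then show False using that by simp
      qed
      have "\<exists>k\<in>{c..<?M}. cell b ?q r k \<noteq> 0"
        using rS unfolding G_def mem_Collect_eq by (meson sum.neutral)
      then obtain c0 where c0: "c \<le> c0" "c0 < length (b ! r)" "b ! r ! c0 = ?q"
        by (auto simp: cell_def split: if_splits)
      \<comment> \<open>Each letter \<open>Suc j\<close> in row \<open>s\<close> to the left of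
        \<open>c\<close> has a letter \<open>Suc (Suc j)\<close> directly below it: the entry there
        is larger than \<open>Suc j\<close> and, its row being sorted, at most the entry in column
        \<open>c0\<close>, which does not exceed \<open>Suc (Suc j)\<close> down to row
        \<open>r\<close>.\<close>
      have HH: "H ?p s c \<le> H ?q (Suc s) c" if s: "s < r" for s
        unfolding H_def
      proof (rule sum_mono)
        fix k assume k: "k \<in> {..<c}"
        show "cell b ?p s k \<le> cell b ?q (Suc s) k"
        proof (cases "k < length (b ! s) \<and> b ! s ! k = ?p")
          case True
          have Ss: "Suc s < ?R" using s r by simp
          have c0s: "c0 < length (b ! Suc s) \<and> b ! Suc s ! c0 \<le> ?q"
          proof (cases "Suc s = r")
            case False
            then have "Suc s < r" using s by simp
            from ssyt_column[OF b lam this r c0(2)] show ?thesis using c0 by simp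
          qed (use c0 in simp)
          have kl: "k < length (b ! Suc s)" using k c0 c0s by simp
          have "b ! Suc s ! k \<le> b ! Suc s ! c0"
            using D(4)[OF Ss] k c0(1) c0s by (intro sorted_nth_mono) auto
          moreover have "b ! s ! k < b ! Suc s ! k" by (rule D(6)[OF Ss kl])
          ultimately show ?thesis using True c0s kl by (simp add: cell_def)
        next
          case False
          then have "cell b ?p s k = 0" by (auto simp: cell_def)
          then show ?thesis using cell_nonneg by simp
        qed
      qed
      have "(\<Sum>s<r. H ?p s c) \<le> (\<Sum>s<r. H ?q (Suc s) c)" by (rule sum_mono) (simp add: HH)
      also have "\<dots> \<le> (\<Sum>s<Suc r. H ?q s c)"
        unfolding sum.lessThan_Suc_shift H_def by (simp add: sum_nonneg cell_nonneg)
      finally have 1: "(\<Sum>s<r. H ?p s c) \<le> (\<Sum>s<Suc r. H ?q s c)" .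
      have 2: "(\<Sum>s<?R. G ?q s c) = (\<Sum>s<Suc r. G ?q s c)"
        by (rule sum.mono_neutral_right) (use r above in auto)
      have 3: "(\<Sum>s<r. G ?p s c) \<le> (\<Sum>s<?R. G ?p s c)"
        by (rule sum_mono2) (use r Gpos in auto)
      have "F r \<le> K" using A r len by simp
      then show ?thesis using 1 2 3 unfolding F[OF r c] E by simp
    qed
  qed
  then show ?thesis unfolding crystal_eps_columns[OF b lam] E_def F_def .
qed

lemma count_list_concat: "count_list (concat L) x = (\<Sum>k<length L. count_list (L ! k) x)"
  by (induction L) (simp_all add: sum.lessThan_Suc_shift del: sum.lessThan_Suc)

text \<open>Every deletion removes one letter of each kind, so the difference of the two statistics
  is the difference of the letter counts in the whole tableau.\<close>

lemma crystal_eps_minus_phi: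
  assumes "length b \<le> n"
  shows "int (crystal_eps (Suc j) b) - int (crystal_phi (Suc j) b) =
    colsum (tableau_counts b) n (Suc j) - colsum (tableau_counts b) n j"
proof -
  let ?M = "length (List.transpose b)"
  have c: "int (count_list (reading_word b) x) = (\<Sum>k<?M. int (count_list (List.transpose b ! k) x))" for x
  proof -
    have "count_list (concat (rev L)) x = count_list (concat L) x" for L :: "nat list list" by (induction L) simp_all
    then show ?thesis by (simp add: reading_word_def count_list_concat)
  qed
  have "int (crystal_eps (Suc j) b) - int (crystal_phi (Suc j) b) = sign_excess (Suc j) (reading_word b)"
    using cancel_difference[of "signature (Suc j) (reading_word b)"]
    by (simp add: crystal_eps_def crystal_phi_def sign_excess_def count_signature)
  also have "\<dots> = (\<Sum>k=0..<?M. sign_excess (Suc j) (List.transpose b ! k))"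
    by (simp add: sign_excess_def c sum_subtractf lessThan_atLeast0)
  also have "\<dots> = colsum (tableau_counts b) (length b) (Suc j) - colsum (tableau_counts b) (length b) j"
    unfolding sum_sign_excess_transpose[OF order_refl] unfolding colsum_def sum_subtractf[symmetric] atLeast0LessThan
    by (rule sum.cong) (simp_all add: tableau_counts_cell sum_subtractf)
  finally show ?thesis unfolding colsum_tableau_counts[OF assms] .
qed

section \<open>Comparison of the generating functions\<close>

text \<open>The part of the chain conditions that links \<open>b\<close> to the exponents. The gap
  \<open>e (Suc j) - e j - 1\<close> is twice a difference of parts of \<mu>, and an even
  \<open>j\<close> belongs to the odd crystal index \<open>Suc j\<close>.\<close>

definition compatible :: "nat \<Rightarrow> (nat \<Rightarrow> int) \<Rightarrow> tableau \<Rightarrow> bool" where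
  "compatible n e b \<longleftrightarrow> (\<forall>j. Suc j < 2 * n \<longrightarrow> int (crystal_eps (Suc j) b) \<le> e (Suc j) - e j - 1 \<and>
     (even j \<longrightarrow> int (crystal_eps (Suc j) b) = e (Suc j) - e j - 1))"

definition shifted_part :: "nat \<Rightarrow> nat list \<Rightarrow> nat \<Rightarrow> int" where
  "shifted_part n lam i = (if i < length lam then int (lam ! i) else 0) + int n - int i"

lemma even_exp_gap:
  assumes "even_exp N e" "Suc j < N"
  shows "even (e (Suc j) - e j - 1)"
proof -
  have "even (e j - int j)" "even (e (Suc j) - int (Suc j))" using assms unfolding even_exp_def by auto
  then show ?thesis by presburger
qed

text \<open>By \<open>crystal_eps_rows\<close> the interlacing inequalities say that the statistic
  \<open>crystal_eps\<close> is at most the gap, and by \<open>crystal_eps_minus_phi\<close> the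
  final conditions say that for odd indices \<open>crystal_eps\<close> minus
  \<open>crystal_phi\<close> equals the gap. Both together force \<open>crystal_phi\<close> to
  vanish, which is (C1), and equality with the gap, which is even; this is (C2).\<close>

lemma odd_tableaux_chain_iff:
  assumes lam: "is_partition lam" "length lam \<le> n" "1 \<le> n" and e: "even_exp (2 * n) e" and b: "b \<in> odd_tableaux n lam"
  shows "tableau_counts b \<in> sp_chains n e \<longleftrightarrow> b \<in> Dbar_star n lam \<and> compatible n e b"
proof -
  let ?a = "tableau_counts b"
  have bs: "b \<in> ssyt (2 * n) lam" and odd: "\<And>i x. i < length b \<Longrightarrow> x \<in> set (b ! i) \<Longrightarrow> 2 * i < x"
    using b by (auto simp: odd_tableaux_def)
  have len: "length b \<le> n" using ssytD(2)[OF bs] lam by simp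
  have supp: "\<forall>i j. ?a i j \<noteq> 0 \<longrightarrow> i < n \<and> 2 * i \<le> j \<and> j < 2 * n"
    using tableau_counts_in[OF lam(1,2) b] by (simp add: count_arrays_def)
  have c2: "(\<forall>i. i < n \<longrightarrow> e j - colsum ?a i j < e (Suc j) - colsum ?a (Suc i) (Suc j)) \<longleftrightarrow>
     int (crystal_eps (Suc j) b) \<le> e (Suc j) - e j - 1" for j
    unfolding crystal_eps_rows[OF bs lam] by (intro iff_allI imp_cong refl) linarith
  have c3: "e (2 * j) - colsum ?a n (2 * j) + 1 = e (Suc (2 * j)) - colsum ?a n (Suc (2 * j)) \<longleftrightarrow>
     int (crystal_eps (Suc (2 * j)) b) - int (crystal_phi (Suc (2 * j)) b) = e (Suc (2 * j)) - e (2 * j) - 1" for j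
    unfolding crystal_eps_minus_phi[OF len] by linarith
  have "?a \<in> sp_chains n e \<longleftrightarrow> (\<forall>j. Suc j < 2 * n \<longrightarrow> int (crystal_eps (Suc j) b) \<le> e (Suc j) - e j - 1) \<and>
     (\<forall>j<n. int (crystal_eps (Suc (2 * j)) b) - int (crystal_phi (Suc (2 * j)) b) = e (Suc (2 * j)) - e (2 * j) - 1)"
    unfolding sp_chains_def mem_Collect_eq c2[symmetric] c3[symmetric] using supp by blast
  also have "\<dots> \<longleftrightarrow> (\<forall>i\<in>{1..2 * n - 1}. odd i \<longrightarrow> crystal_phi i b = 0) \<and>
      (\<forall>i\<in>{1..2 * n - 1}. odd i \<longrightarrow> even (crystal_eps i b)) \<and> compatible n e b" (is "?L \<longleftrightarrow> ?R")
  proof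
    assume L: ?L
    have *: "crystal_phi (Suc j) b = 0 \<and> even (crystal_eps (Suc j) b) \<and> int (crystal_eps (Suc j) b) = e (Suc j) - e j - 1"
      if j: "Suc j < 2 * n" "even j" for j
    proof -
      obtain k where k: "j = 2 * k" using j(2) by blast
      have "int (crystal_eps (Suc j) b) \<le> e (Suc j) - e j - 1" using L j(1) by blast
      moreover have "int (crystal_eps (Suc j) b) - int (crystal_phi (Suc j) b) = e (Suc j) - e j - 1"
        using L j(1) unfolding k by simp
      ultimately have 1: "crystal_phi (Suc j) b = 0" "int (crystal_eps (Suc j) b) = e (Suc j) - e j - 1" by linarith+
      have "even (int (crystal_eps (Suc j) b))" unfolding 1(2) by (rule even_exp_gap[OF e j(1)])
      then have "even (crystal_eps (Suc j) b)" by presburger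
      then show ?thesis using 1 by blast
    qed
    have "crystal_phi i b = 0 \<and> even (crystal_eps i b)" if "i \<in> {1..2 * n - 1}" "odd i" for i
      using that *[of "i - 1"] by (cases i) auto
    moreover have "compatible n e b" unfolding compatible_def using L * by blast
    ultimately show ?R by blast
  next
    assume R: ?R
    have "int (crystal_eps (Suc (2 * j)) b) - int (crystal_phi (Suc (2 * j)) b) = e (Suc (2 * j)) - e (2 * j) - 1" if "j < n" for j
    proof -
      have "Suc (2 * j) \<in> {1..2 * n - 1}" "odd (Suc (2 * j))" "Suc (2 * j) < 2 * n" using that by auto
      then have "crystal_phi (Suc (2 * j)) b = 0" "int (crystal_eps (Suc (2 * j)) b) = e (Suc (2 * j)) - e (2 * j) - 1"
        using R unfolding compatible_def by (blast, simp)
      then show ?thesis by simp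
    qed
    then show ?L using R unfolding compatible_def by blast
  qed
  also have "\<dots> \<longleftrightarrow> b \<in> Dbar_star n lam \<and> compatible n e b"
  proof -
    have "\<forall>i\<in>{1..n}. i \<le> length b \<longrightarrow> (\<forall>x\<in>set (b ! (i - 1)). 2 * i - 1 \<le> x)"
    proof (intro ballI impI)
      fix i x assume "i \<in> {1..n}" "i \<le> length b" "x \<in> set (b ! (i - 1))"
      then show "2 * i - 1 \<le> x" using odd[of "i - 1" x] by (cases i) auto
    qed
    then show ?thesis using bs by (simp add: Dbar_star_def)
  qed
  finally show ?thesis .
qed

lemma Dbar_star_odd_tableaux:
  assumes "length lam \<le> n"
  shows "Dbar_star n lam \<subseteq> odd_tableaux n lam"
proof
  fix b assume b: "b \<in> Dbar_star n lam"
  then have bs: "b \<in> ssyt (2 * n) lam" by (simp add: Dbar_star_def)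
  have "2 * i < x" if "i < length b" "x \<in> set (b ! i)" for i x
  proof -
    have "Suc i \<in> {1..n}" "Suc i \<le> length b" using that ssytD(2)[OF bs] assms by auto
    then have "\<forall>x\<in>set (b ! (Suc i - 1)). 2 * Suc i - 1 \<le> x" using b unfolding Dbar_star_def by blast
    then show ?thesis using that(2) by force
  qed
  then show "b \<in> odd_tableaux n lam" using bs by (simp add: odd_tableaux_def)
qed

lemma count_arrays_alt:
  assumes "a \<in> sp_chains n e"
  shows "a \<in> count_arrays n lam \<longleftrightarrow> lattice n a \<and> (\<forall>i<n. chain_exponent n a i = shifted_part n lam i)"
  using assms unfolding count_arrays_def chain_exponent_prefix shifted_part_def sp_chains_def by auto

lemma card_lattice_chains:
  assumes lam: "is_partition lam" "length lam \<le> n" "1 \<le> n" and e: "even_exp (2 * n) e"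
  shows "card {a \<in> sp_chains n e. lattice n a \<and> (\<forall>i<n. chain_exponent n a i = shifted_part n lam i)} =
     card {b \<in> Dbar_star n lam. compatible n e b}"
proof -
  have "{a \<in> sp_chains n e. lattice n a \<and> (\<forall>i<n. chain_exponent n a i = shifted_part n lam i)} =
    {a \<in> count_arrays n lam. a \<in> sp_chains n e}"
    by (rule Collect_cong) (metis count_arrays_alt)
  also have "\<dots> = tableau_counts ` {b \<in> odd_tableaux n lam. tableau_counts b \<in> sp_chains n e}"
    unfolding bij_betw_imp_surj_on[OF bij_tableau_counts[OF lam(1,2)], symmetric] by auto
  also have "{b \<in> odd_tableaux n lam. tableau_counts b \<in> sp_chains n e} = {b \<in> Dbar_star n lam. compatible n e b}"
    using odd_tableaux_chain_iff[OF lam e] Dbar_star_odd_tableaux[OF lam(2)] by blast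
  also have "card (tableau_counts ` \<dots>) = card \<dots>"
    by (rule card_image) (rule inj_on_subset[OF tableau_counts_inj], use Dbar_star_odd_tableaux[OF lam(2)] in blast)
  finally show ?thesis .
qed

text \<open>The exponents compatible with the empty tableau: the parts of \<mu> are equal in pairs.
  They parametrize the differences from the smallest compatible exponents for any
  \<open>b\<close>.\<close>

definition free_exps :: "nat \<Rightarrow> int \<Rightarrow> (nat \<Rightarrow> int) set" where
  "free_exps n k = {e \<in> even_exps (2 * n) k. \<forall>j. Suc j < 2 * n \<longrightarrow> even j \<longrightarrow> e (Suc j) = e j + 1}"

lemma sum_triangle: "(\<Sum>i<N. \<Sum>j<i. h j) = (\<Sum>j<N. (N - 1 - j) * h j)" for h :: "nat \<Rightarrow> nat"
proof (induction N)
  case (Suc N)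
  have "(\<Sum>j<N. (N - j) * h j) = (\<Sum>j<N. (N - 1 - j) * h j) + (\<Sum>j<N. h j)"
    unfolding sum.distrib[symmetric]
  proof (rule sum.cong[OF refl])
    fix j assume "j \<in> {..<N}"
    then have "N - j = Suc (N - 1 - j)" by auto
    then show "(N - j) * h j = (N - 1 - j) * h j + h j" by simp
  qed
  then show ?case using Suc by simp
qed simp

lemma ceiling_half: "nat \<lceil>real m / 2\<rceil> = (m + 1) div 2"
proof (cases "even m")
  case True
  then show ?thesis by (auto elim!: evenE)
next
  case False
  then obtain k where "m = 2 * k + 1" by (auto elim: oddE)
  moreover have "\<lceil>real (2 * k + 1) / 2\<rceil> = int k + 1" by (rule ceiling_unique) auto
  ultimately show ?thesis by simp
qed

text \<open>The weight \<open>2 * n - i\<close> is the number of indices from \<open>i\<close> to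
  \<open>2 * n - 1\<close>, so the charge is the sum of all partial sums of the rounded
  halves.\<close>

lemma ch_C_eq: "ch_C n b = (\<Sum>i<2 * n. \<Sum>j<i. (crystal_eps (Suc j) b + 1) div 2)"
proof -
  let ?h = "\<lambda>j. (crystal_eps (Suc j) b + 1) div 2"
  have "ch_C n b = (\<Sum>j<2 * n - 1. (2 * n - Suc j) * ?h j)"
    unfolding ch_C_def ceiling_half
    by (rule sum.reindex_bij_witness[of _ Suc "\<lambda>i. i - 1"]) auto
  also have "\<dots> = (\<Sum>j<2 * n. (2 * n - 1 - j) * ?h j)"
    by (rule sum.mono_neutral_cong_left) auto
  finally show ?thesis by (simp only: sum_triangle)
qed

text \<open>Since the gaps are even, a lower bound on a gap may be rounded up to an even number. The
  partial sums \<open>v\<close> of these rounded bounds are the least possible increase over the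
  minimal exponents, and subtracting \<open>v\<close> removes all dependence on \<open>b\<close>.
  For even \<open>j\<close> the required equality survives, because by (C2) no rounding takes
  place.\<close>

lemma card_compatible_exps:
  assumes b: "b \<in> Dbar_star n lam"
  shows "card {e \<in> even_exps (2 * n) k. compatible n e b} = card (free_exps n (k - int (ch_C n b)))"
proof -
  let ?h = "\<lambda>j. (crystal_eps (Suc j) b + 1) div 2"
  define v where "v i = (if i < 2 * n then 2 * int (\<Sum>j<i. ?h j) else 0)" for i
  have vS: "v (Suc j) = v j + 2 * int (?h j)" if "Suc j < 2 * n" for j using that by (simp add: v_def)
  have v0: "v 0 = 0" by (simp add: v_def)
  have v_nonneg: "0 \<le> v j" for j unfolding v_def by (simp del: of_nat_sum)
  have v_even: "even (v j)" for j by (simp add: v_def)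
  have v_out: "v j = 0" if "2 * n \<le> j" for j using that by (simp add: v_def)
  have v_sum: "(\<Sum>i<2 * n. v i) = 2 * int (ch_C n b)"
    by (simp add: v_def ch_C_eq sum_distrib_left)
  have eps_even: "even (crystal_eps (Suc j) b)" if "Suc j < 2 * n" "even j" for j
  proof -
    have "Suc j \<in> {1..2 * n - 1}" "odd (Suc j)" using that by auto
    then show ?thesis using b unfolding Dbar_star_def by blast
  qed
  have "bij_betw (\<lambda>e i. e i - v i) {e \<in> even_exps (2 * n) k. compatible n e b} (free_exps n (k - int (ch_C n b)))"
  proof (rule bij_betw_byWitness[where f' = "\<lambda>e i. e i + v i"])
    show "(\<lambda>e i. e i - v i) ` {e \<in> even_exps (2 * n) k. compatible n e b} \<subseteq> free_exps n (k - int (ch_C n b))"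
    proof safe
      fix e assume e: "e \<in> even_exps (2 * n) k" and c: "compatible n e b"
      have ev: "even_exp (2 * n) e" and out: "\<And>i. 2 * n \<le> i \<Longrightarrow> e i = 0" and s: "(\<Sum>i<2 * n. e i - int i) = 2 * k"
        using e by (auto simp: even_exps_def)
      have gap: "2 * int (?h j) \<le> e (Suc j) - e j - 1 \<and> (even j \<longrightarrow> 2 * int (?h j) = e (Suc j) - e j - 1)"
        if j: "Suc j < 2 * n" for j
      proof -
        obtain g where g: "e (Suc j) - e j - 1 = 2 * g" using even_exp_gap[OF ev j] by blast
        have le: "int (crystal_eps (Suc j) b) \<le> 2 * g" and eq: "even j \<Longrightarrow> int (crystal_eps (Suc j) b) = 2 * g"
          using c j unfolding compatible_def g[symmetric] by blast+
        have "2 * int (?h j) \<le> 2 * g" using le by presburger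
        moreover have "2 * int (?h j) = 2 * g" if "even j" using eq[OF that] by presburger
        ultimately show ?thesis unfolding g by blast
      qed
      have inc: "incr (2 * n) (\<lambda>i. e i - v i)"
        unfolding incr_def
      proof (intro allI impI)
        fix q assume "Suc q < 2 * n"
        then show "e q - v q < e (Suc q) - v (Suc q)" using gap[of q] vS[of q] by linarith
      qed
      have "0 \<le> e i - v i" if "i < 2 * n" for i
        using that
      proof (induction i)
        case 0
        then show ?case using ev by (simp add: v0 even_exp_def)
      next
        case (Suc i)
        have "e i - v i < e (Suc i) - v (Suc i)" by (rule incrD[OF inc Suc(2)])
        then show ?case using Suc by simp
      qed
      moreover have "even (e i - v i - int i)" if "i < 2 * n" for i
      proof -
        have "even (e i - int i)" "even (v i)" using ev that v_even unfolding even_exp_def by blast+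
        then show ?thesis by presburger
      qed
      ultimately have "even_exp (2 * n) (\<lambda>i. e i - v i)" using inc by (simp add: even_exp_def)
      moreover have "(\<Sum>i<2 * n. e i - v i - int i) = 2 * (k - int (ch_C n b))"
        using s v_sum by (simp add: sum_subtractf)
      ultimately show "(\<lambda>i. e i - v i) \<in> free_exps n (k - int (ch_C n b))"
        unfolding free_exps_def even_exps_def mem_Collect_eq
      proof (intro conjI allI impI)
        show "e i - v i = 0" if "2 * n \<le> i" for i using out[OF that] v_out[OF that] by simp
        show "e (Suc j) - v (Suc j) = e j - v j + 1" if "Suc j < 2 * n" "even j" for j
          using gap[OF that(1)] vS[OF that(1)] that(2) by simp
      qed
    qed
    show "(\<lambda>e i. e i + v i) ` free_exps n (k - int (ch_C n b)) \<subseteq> {e \<in> even_exps (2 * n) k. compatible n e b}"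
    proof (rule image_subsetI)
      fix e assume e: "e \<in> free_exps n (k - int (ch_C n b))"
      have ev: "even_exp (2 * n) e" and out: "\<And>i. 2 * n \<le> i \<Longrightarrow> e i = 0"
        and s: "(\<Sum>i<2 * n. e i - int i) = 2 * (k - int (ch_C n b))"
        and fr: "\<And>j. Suc j < 2 * n \<Longrightarrow> even j \<Longrightarrow> e (Suc j) = e j + 1"
        using e by (auto simp: free_exps_def even_exps_def)
      have inc: "e j < e (Suc j)" if "Suc j < 2 * n" for j using ev that by (auto simp: even_exp_def incr_def)
      have "compatible n (\<lambda>i. e i + v i) b"
        unfolding compatible_def
      proof (intro allI impI conjI)
        fix j assume j: "Suc j < 2 * n"
        have "int (crystal_eps (Suc j) b) \<le> 2 * int (?h j)" by linarith
        then show "int (crystal_eps (Suc j) b) \<le> e (Suc j) + v (Suc j) - (e j + v j) - 1"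
          using inc[OF j] vS[OF j] by simp
        assume ej: "even j"
        have "int (crystal_eps (Suc j) b) = 2 * int (?h j)" using eps_even[OF j ej] by auto
        then show "int (crystal_eps (Suc j) b) = e (Suc j) + v (Suc j) - (e j + v j) - 1"
          using fr[OF j ej] vS[OF j] by simp
      qed
      moreover have "even_exp (2 * n) (\<lambda>i. e i + v i)"
      proof -
        have "incr (2 * n) (\<lambda>i. e i + v i)" unfolding incr_def
        proof (intro allI impI)
          fix q assume "Suc q < 2 * n"
          then show "e q + v q < e (Suc q) + v (Suc q)" using inc[of q] vS[of q] by simp
        qed
        moreover have "even (e i + v i - int i)" if "i < 2 * n" for i
        proof -
          have "even (e i - int i)" "even (v i)" using ev that v_even unfolding even_exp_def by blast+
          then show ?thesis by presburger
        qed
        moreover have "0 \<le> e i + v i" if "i < 2 * n" for i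
          using ev that v_nonneg[of i] by (simp add: even_exp_def)
        ultimately show ?thesis by (simp add: even_exp_def)
      qed
      moreover have "(\<Sum>i<2 * n. e i + v i - int i) = 2 * k"
        using s v_sum by (simp add: sum_subtractf sum.distrib)
      ultimately show "(\<lambda>i. e i + v i) \<in> {e \<in> even_exps (2 * n) k. compatible n e b}"
        using out v_out by (simp add: even_exps_def)
    qed
  qed simp_all
  then show ?thesis by (rule bij_betw_same_card)
qed

lemma weight_of_plus_rho:
  assumes "length lam \<le> n"
  shows "weight_of lam + rho n = weight_vec n (shifted_part n lam)"
proof
  fix k show "(weight_of lam + rho n) k = weight_vec n (shifted_part n lam) k"
    using assms unfolding rho_eq plus_fun_apply by (cases k) (auto simp: weight_of_def weight_vec_def shifted_part_def)
qed

lemma dominant_shifted_part: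
  assumes "is_partition lam"
  shows "dominant n (shifted_part n lam)"
proof -
  have "shifted_part n lam j < shifted_part n lam i" if "i < j" "j < n" for i j
    using is_partition_nth[OF assms, of i j] that by (cases "j < length lam") (simp_all add: shifted_part_def)
  then show ?thesis by (simp add: dominant_def shifted_part_def)
qed

text \<open>The sums over exponents and tableaux are exchanged. For each \<open>b\<close> the
  compatible exponents are a translate of the free ones, which multiplies their series by a power of
  t given by the charge.\<close>

lemma chain_series_weight:
  assumes lam: "is_partition lam" "length lam \<le> n" "1 \<le> n"
  shows "Abs_fps (\<lambda>k. Poly_Mapping.lookup (fps_nth (chain_series n eps_var) k) (weight_of lam + rho n)) =
     (\<Sum>b\<in>Dbar_star n lam. fps_X ^ ch_C n b) * Abs_fps (\<lambda>k. int (card (free_exps n (int k))))"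
proof (rule fps_ext)
  fix k
  let ?E = "even_exps (2 * n) (int k)" and ?B = "Dbar_star n lam"
  have finE: "finite ?E" by (rule finite_even_exps)
  have neg: "free_exps n m = {}" if "m < 0" for m
    using even_exps_negative[OF that, of "2 * n"] by (simp add: free_exps_def)
  have "Poly_Mapping.lookup (fps_nth (chain_series n eps_var) k) (weight_of lam + rho n) =
    (\<Sum>e\<in>?E. Poly_Mapping.lookup (chain_sum n e eps_var) (weight_vec n (shifted_part n lam)))"
    unfolding chain_series_def fps_nth_Abs_fps lookup_sum weight_of_plus_rho[OF lam(2)] ..
  also have "\<dots> = (\<Sum>e\<in>?E. \<Sum>b\<in>?B. of_bool (compatible n e b))"
  proof (rule sum.cong[OF refl])
    fix e assume "e \<in> ?E"
    then have e: "even_exp (2 * n) e" by (simp add: even_exps_def)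
    then have i: "incr (2 * n) e" by (simp add: even_exp_def)
    show "Poly_Mapping.lookup (chain_sum n e eps_var) (weight_vec n (shifted_part n lam)) = (\<Sum>b\<in>?B. of_bool (compatible n e b))"
      unfolding lookup_chain_sum[OF i dominant_shifted_part[OF lam(1)]] card_lattice_chains[OF lam e]
      by (simp add: finite_Dbar_star Int_def)
  qed
  also have "\<dots> = (\<Sum>b\<in>?B. \<Sum>e\<in>?E. of_bool (compatible n e b))" by (rule sum.swap)
  also have "\<dots> = (\<Sum>b\<in>?B. int (card (free_exps n (int k - int (ch_C n b)))))"
  proof (rule sum.cong[OF refl])
    fix b assume b: "b \<in> ?B"
    show "(\<Sum>e\<in>?E. of_bool (compatible n e b)) = int (card (free_exps n (int k - int (ch_C n b))))"
      unfolding card_compatible_exps[OF b, symmetric] using finE by (simp add: Int_def)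
  qed
  also have "\<dots> = fps_nth ((\<Sum>b\<in>?B. fps_X ^ ch_C n b) * Abs_fps (\<lambda>k. int (card (free_exps n (int k))))) k"
    unfolding sum_distrib_right fps_sum_nth
    by (rule sum.cong) (simp_all add: fps_X_power_mult_nth neg of_nat_diff)
  finally show "fps_nth (Abs_fps (\<lambda>k. Poly_Mapping.lookup (fps_nth (chain_series n eps_var) k) (weight_of lam + rho n))) k =
    fps_nth ((\<Sum>b\<in>?B. fps_X ^ ch_C n b) * Abs_fps (\<lambda>k. int (card (free_exps n (int k))))) k"
    by (simp only: fps_nth_Abs_fps)
qed

lemma Dbar_star_Nil: "Dbar_star n [] = {[]}"
proof -
  have "crystal_phi i [] = 0" "crystal_eps i [] = 0" for i
    by (simp_all add: crystal_phi_def crystal_eps_def reading_word_def signature_def)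
  then show ?thesis by (auto simp: Dbar_star_def ssyt_def)
qed

lemma ch_C_Nil: "ch_C n [] = 0"
  by (simp add: ch_C_def crystal_eps_def reading_word_def signature_def)

theorem theorem6p12:
  fixes n :: nat and lam :: "nat list"
  assumes "n \<ge> 1" and "is_partition lam" and "length lam \<le> n"
  shows "gen_exponent_C n (weight_of lam) = (\<Sum>b\<in>Dbar_star n lam. monom 1 (ch_C n b))"
proof -
  let ?Z = "\<lambda>lam. Abs_fps (\<lambda>k. Poly_Mapping.lookup (fps_nth (chain_series n eps_var) k) (weight_of lam + rho n))"
    and ?E = "Abs_fps (\<lambda>k. int (card (free_exps n (int k))))"
  obtain d where d: "\<And>\<Lambda>. Abs_fps (coeff (gen_exponent_C n \<Lambda>)) =
     d * Abs_fps (\<lambda>k. Poly_Mapping.lookup (fps_nth (chain_series n eps_var) k) (\<Lambda> + rho n))"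
    using gen_exponent_chain_series by blast
  have nil: "is_partition []" by (simp add: is_partition_def)
  have w: "weight_of [] = (\<lambda>_. 0)" by (rule ext) (simp add: weight_of_def)
  \<comment> \<open>The only tableau for the empty partition is the empty one, of charge 0. So
    \<open>d\<close> is forced to be the inverse of \<open>?E\<close>, the series counting the free
    exponents.\<close>
  have "?Z [] = ?E"
    using chain_series_weight[OF nil _ assms(1)] by (simp add: Dbar_star_Nil ch_C_Nil)
  then have "d * ?E = Abs_fps (coeff (gen_exponent_C n (weight_of [])))" by (simp only: d)
  also have "\<dots> = 1" unfolding w gen_exponent_zero by (rule fps_ext) (simp add: coeff_1)
  finally have dE: "d * ?E = 1" .
  have "Abs_fps (coeff (gen_exponent_C n (weight_of lam))) = (\<Sum>b\<in>Dbar_star n lam. fps_X ^ ch_C n b) * (d * ?E)"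
    unfolding d chain_series_weight[OF assms(2,3,1)] by (simp only: mult.left_commute)
  also have "\<dots> = Abs_fps (coeff (\<Sum>b\<in>Dbar_star n lam. monom 1 (ch_C n b)))"
    unfolding dE mult_1_right by (rule fps_ext) (auto simp: fps_sum_nth coeff_sum fps_X_power_nth intro!: sum.cong)
  finally have eq: "Abs_fps (coeff (gen_exponent_C n (weight_of lam))) = \<dots>" .
  show ?thesis
  proof (rule poly_eqI)
    fix k
    show "coeff (gen_exponent_C n (weight_of lam)) k = coeff (\<Sum>b\<in>Dbar_star n lam. monom 1 (ch_C n b)) k"
      using arg_cong[OF eq, of "\<lambda>F. fps_nth F k"] by (simp only: fps_nth_Abs_fps)
  qed
qed

end
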